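(* Let $s>1$, $\theta=\frac{s+1}{2}$, $c=\frac{\theta^2}{s}$. (I) Let $u_0,v_0:\mathbb{R}\to\mathbb{R}$ with $v_0\ge0$, and set $w_0=u_0-v_0^\theta$, $z_0=u_0+v_0^\theta$. Suppose that $w_0,z_0\in W^{1,1}_{loc}(\mathbb{R})\cap L^\infty(\mathbb{R})$, that $w_0$ and $z_0$ are decreasing, and that for some $x,y\in\mathbb{R}$ $$w_0(x)>z_0(y).$$ Then the Cauchy problem $$v_t-u_x=0,\qquad u_t-c(|v|^{s-1}v)_x=0,\qquad (v,u)|_{t=0}=(v_0,u_0)$$ has no generalized solution $(v,u)$ such that, with $w=u-v^\theta$ and $z=u+v^\theta$, the properties (P1)–(P6) listed in the context hold. (II) Let $v_0\ge 0$ and $v_1\in L^1(\mathbb{R})$, and set $$w_0(x)=\int_{-\infty}^xv_1(y)\,dy-v_0^\theta(x),\qquad z_0(x)=-\int_x^\infty v_1(y)\,dy+v_0^\theta(x).$$ Suppose that $w_0,z_0\in W^{1,1}_{loc}(\mathbb{R})\cap L^\infty(\mathbb{R})$, that the limits $v_0^\theta(\pm\infty):=\lim_{x\to\pm\infty}v_0^\theta(x)$ exist, that for both choices of sign $$v_1(x)\pm\theta\,v_0^{\frac{s-1}{2}}(x)\,\partial_xv_0(x)\le0,$$ and that $$\int_{-\infty}^\infty v_1(x)\,dx+v_0^\theta(+\infty)+v_0^\theta(-\infty)<0.$$ Then the Cauchy problem $$v_{tt}=c(|v|^{s-1}v)_{xx},\qquad (v,v_t)|_{t=0}=(v_0,v_1)$$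 has no generalized solution $v$ such that property (P7) of the context holds and, with $$w(x,t)=\int_{-\infty}^xv_t(y,t)\,dy-v^\theta(x,t),\qquad z(x,t)=-\int_x^\infty v_t(y,t)\,dy+v^\theta(x,t),$$ the properties (P1)–(P6) of the context hold.
   Context: The spatial variable is $x\in\mathbb{R}$, time is $t\in\mathbb{R}^+=(0,\infty)$. "Decreasing" means non-increasing; "a.a." means almost all. Generalized solution of the system: a pair $(v,u)\in L^\infty(\mathbb{R}\times\mathbb{R}^+)\times L^\infty(\mathbb{R}\times\mathbb{R}^+)$ such that for all $\phi_1,\phi_2\in C_0^\infty(\mathbb{R}\times[0,\infty))$, $$\int_0^\infty\!\!\int_{-\infty}^\infty \big(v\,\partial_t\phi_1-u\,\partial_x\phi_1\big)\,dx\,dt+\int_{-\infty}^\infty v_0(x)\phi_1(x,0)\,dx=0,$$ $$\int_0^\infty\!\!\int_{-\infty}^\infty \big(u\,\partial_t\phi_2-c|v|^{s-1}v\,\partial_x\phi_2\big)\,dx\,dt+\int_{-\infty}^\infty u_0(x)\phi_2(x,0)\,dx=0.$$ Generalized solution of the wave equation: a function $v\in L^\infty(\mathbb{R}\times\mathbb{R}^+)$ such that for all $\phi\in C_0^\infty(\mathbb{R}\times[0,\infty))$, $$\int_0^\infty\!\!\int_{-\infty}^\infty \big(v\,\partial_t^2\phi-c|v|^{s-1}v\,\partial_x^2\phi\big)\,dx\,dt+\int_{-\infty}^\infty \big(v_0(x)\,\partial_t\phi(x,0)-v_1(x)\phi(x,0)\big)\,dx=0.$$ Properties: (P1) $v(x,t)\ge0$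 for a.a. $(x,t)\in\mathbb{R}\times\mathbb{R}^+$. (P2) $w(\cdot,t)$ and $z(\cdot,t)$ are decreasing in $x$ for a.a. $t\ge0$. (P3) $w,z\in L^\infty(\mathbb{R}\times\mathbb{R}^+)$. (P4) $w,z\in W^{1,1}_{loc}(\mathbb{R}\times\mathbb{R}^+)$. (P5) $\|w_x(t)\|_{L^1(\mathbb{R})}+\|z_x(t)\|_{L^1(\mathbb{R})}\le\|w_x(0)\|_{L^1(\mathbb{R})}+\|z_x(0)\|_{L^1(\mathbb{R})}$ for a.a. $t\ge0$. (P6) There is a constant $C$ such that $\|w_t(t)\|_{L^1(\mathbb{R})}+\|z_t(t)\|_{L^1(\mathbb{R})}\le C\big(\|w_x(0)\|_{L^1(\mathbb{R})}+\|z_x(0)\|_{L^1(\mathbb{R})}\big)$ for a.a. $t\ge0$. (P7) $\partial_tv(\cdot,t)\in L^1(\mathbb{R})$ for a.a. $t\ge0$. Here $w_x(0)=w_0'$ and $z_x(0)=z_0'$, where $w_0=w(\cdot,0)$, $z_0=z(\cdot,0)$ are the initial functions in the claim. In part (II), $\theta v_0^{\frac{s-1}{2}}\partial_xv_0$ stands for the weak derivative $\partial_x(v_0^{\theta})$ (note $\theta-1=\frac{s-1}{2}$), which exists in $L^1_{loc}$ since $w_0\in W^{1,1}_{loc}(\mathbb{R})$ and $v_1\in L^1(\mathbb{R})$; the inequality holds almost everywhere. *)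

theory Defs
  imports "HOL-Analysis.Analysis"
begin

text \<open>All measure-theoretic notions refer to (the completion of) Lebesgue measure, and a function
  stands for its almost-everywhere class: every notion below that is applied to a solution is
  invariant under modification on a null set. Points of the plane are pairs \<open>(x, t)\<close>.\<close>

section \<open>Test functions\<close>

definition dir_deriv :: "'a::real_normed_vector \<Rightarrow> ('a \<Rightarrow> real) \<Rightarrow> 'a \<Rightarrow> real" where
  "dir_deriv b f = (\<lambda>x. frechet_derivative f (at x) b)"

primrec C_k :: "nat \<Rightarrow> ('a::euclidean_space \<Rightarrow> real) \<Rightarrow> bool" where
  "C_k 0 f \<longleftrightarrow> continuous_on UNIV f"
| "C_k (Suc k) f \<longleftrightarrow> (\<forall>x. f differentiable (at x)) \<and> (\<forall>b\<in>Basis. C_k k (dir_deriv b f))"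

definition smooth :: "('a::euclidean_space \<Rightarrow> real) \<Rightarrow> bool" where
  "smooth f \<longleftrightarrow> (\<forall>k. C_k k f)"

definition test_function :: "'a::euclidean_space set \<Rightarrow> ('a \<Rightarrow> real) \<Rightarrow> bool" where
  "test_function \<Omega> \<phi> \<longleftrightarrow>
     smooth \<phi> \<and> compact (closure {x. \<phi> x \<noteq> 0}) \<and> closure {x. \<phi> x \<noteq> 0} \<subseteq> \<Omega>"

section \<open>Function spaces and weak derivatives\<close>

definition Linf :: "'a::euclidean_space set \<Rightarrow> ('a \<Rightarrow> real) set" where
  "Linf \<Omega> = {f \<in> borel_measurable (lebesgue_on \<Omega>). \<exists>B. AE x in lebesgue_on \<Omega>. \<bar>f x\<bar> \<le> B}"

definition locally_integrable :: "'a::euclidean_space set \<Rightarrow> ('a \<Rightarrow> real) \<Rightarrow> bool" where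
  "locally_integrable \<Omega> f \<longleftrightarrow> (\<forall>K. compact K \<and> K \<subseteq> \<Omega> \<longrightarrow> integrable (lebesgue_on K) f)"

definition has_weak_deriv ::
    "'a::euclidean_space \<Rightarrow> 'a set \<Rightarrow> ('a \<Rightarrow> real) \<Rightarrow> ('a \<Rightarrow> real) \<Rightarrow> bool" where
  "has_weak_deriv b \<Omega> f g \<longleftrightarrow>
     locally_integrable \<Omega> f \<and> locally_integrable \<Omega> g \<and>
     (\<forall>\<phi>. test_function \<Omega> \<phi> \<longrightarrow>
        (LINT x|lebesgue_on \<Omega>. f x * dir_deriv b \<phi> x) = - (LINT x|lebesgue_on \<Omega>. g x * \<phi> x))"

definition weakly_differentiable ::
    "'a::euclidean_space \<Rightarrow> 'a set \<Rightarrow> ('a \<Rightarrow> real) \<Rightarrow> bool" where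
  "weakly_differentiable b \<Omega> f \<longleftrightarrow> (\<exists>g. has_weak_deriv b \<Omega> f g)"

text \<open>Some representative of the weak derivative, which is unique up to null sets when it exists;
  meaningful only for functions that are \<open>weakly_differentiable\<close>.\<close>

definition weak_deriv :: "'a::euclidean_space \<Rightarrow> 'a set \<Rightarrow> ('a \<Rightarrow> real) \<Rightarrow> 'a \<Rightarrow> real" where
  "weak_deriv b \<Omega> f = (SOME g. has_weak_deriv b \<Omega> f g)"

definition W11_loc :: "'a::euclidean_space set \<Rightarrow> ('a \<Rightarrow> real) set" where
  "W11_loc \<Omega> = {f. locally_integrable \<Omega> f \<and> (\<forall>b\<in>Basis. weakly_differentiable b \<Omega> f)}"

definition L1_norm :: "(real \<Rightarrow> real) \<Rightarrow> ennreal" where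
  "L1_norm f = (\<integral>\<^sup>+ x. ennreal \<bar>f x\<bar> \<partial>lebesgue)"

definition ess_decreasing :: "(real \<Rightarrow> real) \<Rightarrow> bool" where
  "ess_decreasing f \<longleftrightarrow> (\<exists>g. antimono g \<and> (AE x in lebesgue. f x = g x))"

section \<open>Generalized solutions\<close>

definition halfplane :: "(real \<times> real) set" where
  "halfplane = UNIV \<times> {0<..}"

abbreviation dx :: "(real \<times> real \<Rightarrow> real) \<Rightarrow> real \<times> real \<Rightarrow> real" where
  "dx \<equiv> dir_deriv (1, 0)"

abbreviation dt :: "(real \<times> real \<Rightarrow> real) \<Rightarrow> real \<times> real \<Rightarrow> real" where
  "dt \<equiv> dir_deriv (0, 1)"

abbreviation weak_dx :: "(real \<times> real \<Rightarrow> real) \<Rightarrow> real \<times> real \<Rightarrow> real" where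
  "weak_dx \<equiv> weak_deriv (1, 0) halfplane"

abbreviation weak_dt :: "(real \<times> real \<Rightarrow> real) \<Rightarrow> real \<times> real \<Rightarrow> real" where
  "weak_dt \<equiv> weak_deriv (0, 1) halfplane"

text \<open>The test functions in \<open>C\<^sub>0\<^sup>\<infinity>(\<real> \<times> [0,\<infinity>))\<close> are the restrictions of those on the whole plane; they
  need not vanish at \<open>t = 0\<close>. All integrands are integrable for essentially bounded data, so the
  integrals over the half-plane agree with the iterated ones.\<close>

definition gen_solution_system ::
    "real \<Rightarrow> real \<Rightarrow> (real \<Rightarrow> real) \<Rightarrow> (real \<Rightarrow> real) \<Rightarrow>
     (real \<times> real \<Rightarrow> real) \<Rightarrow> (real \<times> real \<Rightarrow> real) \<Rightarrow> bool" where
  "gen_solution_system s c v0 u0 v u \<longleftrightarrow>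
     v \<in> Linf halfplane \<and> u \<in> Linf halfplane \<and>
     (\<forall>\<phi>. test_function UNIV \<phi> \<longrightarrow>
        (LINT p|lebesgue_on halfplane. v p * dt \<phi> p - u p * dx \<phi> p)
        + (LINT x|lebesgue. v0 x * \<phi> (x, 0)) = 0) \<and>
     (\<forall>\<phi>. test_function UNIV \<phi> \<longrightarrow>
        (LINT p|lebesgue_on halfplane.
           u p * dt \<phi> p - c * \<bar>v p\<bar> powr (s - 1) * v p * dx \<phi> p)
        + (LINT x|lebesgue. u0 x * \<phi> (x, 0)) = 0)"

definition gen_solution_wave ::
    "real \<Rightarrow> real \<Rightarrow> (real \<Rightarrow> real) \<Rightarrow> (real \<Rightarrow> real) \<Rightarrow> (real \<times> real \<Rightarrow> real) \<Rightarrow> bool" where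
  "gen_solution_wave s c v0 v1 v \<longleftrightarrow>
     v \<in> Linf halfplane \<and>
     (\<forall>\<phi>. test_function UNIV \<phi> \<longrightarrow>
        (LINT p|lebesgue_on halfplane.
           v p * dt (dt \<phi>) p - c * \<bar>v p\<bar> powr (s - 1) * v p * dx (dx \<phi>) p)
        + (LINT x|lebesgue. v0 x * dt \<phi> (x, 0) - v1 x * \<phi> (x, 0)) = 0)"

text \<open>The norms are extended-real valued, so their finiteness is part of what the last two
  inequalities say whenever the right-hand sides are finite.\<close>

definition solution_properties ::
    "(real \<Rightarrow> real) \<Rightarrow> (real \<Rightarrow> real) \<Rightarrow>
     (real \<times> real \<Rightarrow> real) \<Rightarrow> (real \<times> real \<Rightarrow> real) \<Rightarrow> (real \<times> real \<Rightarrow> real) \<Rightarrow> bool" where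
  "solution_properties w0 z0 v w z \<longleftrightarrow>
     (AE p in lebesgue_on halfplane. v p \<ge> 0) \<and>
     (AE t in lebesgue_on {0..}. ess_decreasing (\<lambda>x. w (x, t)) \<and> ess_decreasing (\<lambda>x. z (x, t))) \<and>
     w \<in> Linf halfplane \<and> z \<in> Linf halfplane \<and>
     w \<in> W11_loc halfplane \<and> z \<in> W11_loc halfplane \<and>
     (AE t in lebesgue_on {0..}.
        L1_norm (\<lambda>x. weak_dx w (x, t)) + L1_norm (\<lambda>x. weak_dx z (x, t))
        \<le> L1_norm (weak_deriv 1 UNIV w0) + L1_norm (weak_deriv 1 UNIV z0)) \<and>
     (\<exists>C::real. C \<ge> 0 \<and> (AE t in lebesgue_on {0..}.
        L1_norm (\<lambda>x. weak_dt w (x, t)) + L1_norm (\<lambda>x. weak_dt z (x, t))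
        \<le> ennreal C * (L1_norm (weak_deriv 1 UNIV w0) + L1_norm (weak_deriv 1 UNIV z0))))"

definition integrable_time_deriv :: "(real \<times> real \<Rightarrow> real) \<Rightarrow> bool" where
  "integrable_time_deriv v \<longleftrightarrow>
     weakly_differentiable (0, 1) halfplane v \<and>
     (AE t in lebesgue_on {0..}. integrable lebesgue (\<lambda>x. weak_dt v (x, t)))"

end

theory Submission
  imports Defs
begin

text \<open>Monotonicity of \<open>w\<close> and \<open>z\<close> in \<open>x\<close> gives \<open>v\<^sub>t \<le> - |\<partial>\<^sub>x(v\<^sup>\<theta>)|\<close>. By the chain rule for Sobolev
  functions \<open>c (v\<^sup>s)\<^sub>x = \<lambda> (v\<^sup>\<theta>)\<^sub>x\<close> and \<open>(v\<^sup>\<theta>)\<^sub>t = \<lambda> v\<^sub>t\<close> with the same characteristic speed \<open>\<lambda> = \<theta> v\<^sup>\<theta>\<^sup>-\<^sup>1 \<ge> 0\<close>, so that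
  \<open>|c (v\<^sup>s)\<^sub>x| \<le> - (v\<^sup>\<theta>)\<^sub>t\<close>; this is the statement that \<open>w\<close> increases and \<open>z\<close> decreases in time.
  Hence on an interval \<open>[a, b]\<close> the difference \<open>u(a, t) - u(b, t) \<ge> w(a, t) - z(b, t)\<close> stays above the
  positive constant \<open>w\<^sub>0(a) - z\<^sub>0(b)\<close>. But it is the rate at which \<open>\<integral> v dx\<close> over \<open>[a, b]\<close> decreases, and
  this integral stays nonnegative, a contradiction for large times. In part (II) the two equations of
  the system are replaced by the wave equation tested with a time primitive, which eliminates \<open>u\<close>.\<close>

section \<open>Smooth functions\<close>

text \<open>The delicate point is t = 0. The solution concept attaches the initial data only weakly,
  and only to \<open>v\<close> and \<open>u\<close>, whereas the estimate in time concerns the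
  nonlinear quantity v^\<theta>, for which no initial trace is given. The wave equation, tested with
  a time primitive of a function supported in a layer of width 2/n, shows in the limit that
  \<open>v\<close> starts weakly from \<open>v0\<close>; as \<open>v\<close> decreases in time, v
  \<le> v0 almost everywhere. This one-sided bound suffices: the boundary term near t = 0 carries a
  nonnegative weight, so that \<open>v\<close> may be replaced there by \<open>v0\<close> in the
  direction needed. The two speeds agree by the choice of the constants: c s / \<theta> = \<theta>
  and s - \<theta> = \<theta> - 1. In x, monotonicity controls v^\<theta> rather than v, so v^s is
  treated as the power s / \<theta> > 1 of v^\<theta>. All testing is done with products \<alpha>(x)
  \<beta>(t). They are enough to detect signs almost everywhere, and by Fubini they reduce the
  Sobolev chain rule to integration by parts for absolutely continuous functions of one
  variable.\<close>

lemma dir_deriv_eqI: "(f has_derivative f') (at x) \<Longrightarrow> dir_deriv b f x = f' b"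
  unfolding dir_deriv_def using frechet_derivative_at by metis

lemma C_k_differentiable: "C_k (Suc k) f \<Longrightarrow> (f has_derivative (\<lambda>b. dir_deriv b f x)) (at x)"
  unfolding dir_deriv_def by (auto simp: frechet_derivative_works)

lemma C_k_lower: "C_k (Suc k) f \<Longrightarrow> C_k k f"
proof (induction k arbitrary: f)
  case 0
  then show ?case
    by (auto intro!: continuous_at_imp_continuous_on differentiable_imp_continuous_within)
next
  case (Suc k)
  then show ?case by (subst C_k.simps) (auto simp del: C_k.simps(1) dest: C_k.simps(2)[THEN iffD1])
qed

lemma C_k_const: "C_k k (\<lambda>x::'a::euclidean_space. c)"
proof (induction k arbitrary: c)
  case (Suc k)
  have "dir_deriv b (\<lambda>x::'a. c) = (\<lambda>x. 0)" for b
    by (rule ext, rule dir_deriv_eqI[of _ "\<lambda>_. 0"]) auto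
  then show ?case using Suc by simp
qed simp

lemma C_k_add: "C_k k f \<Longrightarrow> C_k k g \<Longrightarrow> C_k k (\<lambda>x. f x + g x)"
proof (induction k arbitrary: f g)
  case 0
  then show ?case by (auto intro: continuous_on_add)
next
  case (Suc k)
  have "dir_deriv b (\<lambda>x. f x + g x) = (\<lambda>x. dir_deriv b f x + dir_deriv b g x)" for b
    by (rule ext, rule dir_deriv_eqI) (intro has_derivative_add C_k_differentiable[OF Suc.prems(1)] C_k_differentiable[OF Suc.prems(2)])
  then show ?case using Suc by (auto intro: differentiable_add)
qed

lemma C_k_mult: "C_k k f \<Longrightarrow> C_k k g \<Longrightarrow> C_k k (\<lambda>x. f x * g x)"
proof (induction k arbitrary: f g)
  case 0
  then show ?case by (auto intro: continuous_on_mult)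
next
  case (Suc k)
  have "dir_deriv b (\<lambda>x. f x * g x) = (\<lambda>x. f x * dir_deriv b g x + dir_deriv b f x * g x)" for b
    by (rule ext, rule dir_deriv_eqI) (intro has_derivative_mult C_k_differentiable[OF Suc.prems(1)] C_k_differentiable[OF Suc.prems(2)])
  then show ?case using Suc C_k_lower[of k f] C_k_lower[of k g]
    by (auto intro!: differentiable_mult C_k_add)
qed

text \<open>The basis of the real line is the single vector 1, so one ordinary derivative settles
  the recursion.\<close>

lemma C_k_SucI:
  fixes f :: "real \<Rightarrow> real"
  assumes "\<And>x. (f has_real_derivative f' x) (at x)" "C_k k f'"
  shows "C_k (Suc k) f"
proof -
  have "dir_deriv 1 f = f'"
    by (rule ext, subst dir_deriv_eqI[OF has_field_derivative_imp_has_derivative[OF assms(1)]]) simp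
  then show ?thesis using assms
    by (auto simp: real_differentiable_def)
qed

lemma C_k_DERIV:
  fixes f :: "real \<Rightarrow> real"
  assumes "C_k (Suc k) f"
  shows "(f has_real_derivative dir_deriv 1 f x) (at x)"
proof -
  obtain y where y: "(f has_real_derivative y) (at x)"
    using assms by (auto simp: real_differentiable_def)
  show ?thesis
    using y dir_deriv_eqI[OF has_field_derivative_imp_has_derivative[OF y], of 1] by simp
qed

lemma C_k_affine:
  fixes f :: "real \<Rightarrow> real"
  shows "C_k k f \<Longrightarrow> C_k k (\<lambda>x. f (c * x + d))"
proof (induction k arbitrary: f)
  case 0
  then show ?case by (auto intro!: continuous_on_compose2[of UNIV f] continuous_intros)
next
  case (Suc k)
  have D: "(f has_real_derivative dir_deriv 1 f x) (at x)" for x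
    using Suc.prems C_k_DERIV by blast
  have "((\<lambda>x. f (c * x + d)) has_real_derivative dir_deriv 1 f (c * x + d) * c) (at x)" for x
    by (rule DERIV_chain2[OF D]) (auto intro!: derivative_eq_intros)
  then show ?case
    by (rule C_k_SucI) (use Suc in \<open>auto intro!: C_k_mult C_k_const\<close>)
qed

lemma smoothI: "(\<And>k. C_k k f) \<Longrightarrow> smooth f"
  by (simp add: smooth_def)

lemma smooth_add: "smooth f \<Longrightarrow> smooth g \<Longrightarrow> smooth (\<lambda>x. f x + g x)"
  and smooth_mult: "smooth f \<Longrightarrow> smooth g \<Longrightarrow> smooth (\<lambda>x. f x * g x)"
  and smooth_const: "smooth (\<lambda>x. c)"
  by (auto simp: smooth_def C_k_add C_k_mult C_k_const)

lemma smooth_minus: "smooth f \<Longrightarrow> smooth (\<lambda>x. - f x)"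
  using smooth_mult[OF smooth_const[of "-1"], of f] by simp

lemma smooth_diff: "smooth f \<Longrightarrow> smooth g \<Longrightarrow> smooth (\<lambda>x. f x - g x)"
  using smooth_add[OF _ smooth_minus, of f g] by simp

lemma smooth_power: "smooth f \<Longrightarrow> smooth (\<lambda>x. f x ^ n)"
  by (induction n) (auto intro: smooth_mult smooth_const)

lemma smooth_affine: "smooth f \<Longrightarrow> smooth (\<lambda>x::real. f (c * x + d))"
  by (simp add: smooth_def C_k_affine)

lemma smooth_continuous: "smooth f \<Longrightarrow> continuous_on UNIV f"
  by (metis C_k.simps(1) smooth_def)

lemma smooth_DERIV:
  fixes f :: "real \<Rightarrow> real"
  shows "smooth f \<Longrightarrow> (f has_real_derivative deriv f x) (at x)"
  using C_k_DERIV[of 0 f x] DERIV_imp_deriv by (force simp: smooth_def simp del: C_k.simps)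

lemma dir_deriv_1: 
  fixes f :: "real \<Rightarrow> real"
  assumes "smooth f" shows "dir_deriv 1 f = deriv f"
  by (rule ext, subst dir_deriv_eqI[OF has_field_derivative_imp_has_derivative[OF smooth_DERIV[OF assms]]]) simp

lemma smooth_deriv:
  fixes f :: "real \<Rightarrow> real"
  assumes "smooth f" shows "smooth (deriv f)"
proof (rule smoothI)
  fix k have "C_k (Suc k) f" using assms by (simp add: smooth_def)
  then show "C_k k (deriv f)" using dir_deriv_1[OF assms] by simp
qed

lemma smooth_antideriv:
  fixes f :: "real \<Rightarrow> real"
  assumes "\<And>x. (f has_real_derivative f' x) (at x)" "smooth f'"
  shows "smooth f"
proof (rule smoothI)
  fix k
  have "C_k (Suc k) f" using assms by (intro C_k_SucI[of f f']) (auto simp: smooth_def)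
  then show "C_k k f" by (rule C_k_lower)
qed

text \<open>The functions \<open>q (1/x) exp (-1/x)\<close> on \<open>x > 0\<close>, extended by zero, are closed under
  differentiation.\<close>

definition flat :: "real poly \<Rightarrow> real \<Rightarrow> real" where
  "flat q x = (if x > 0 then poly q (1 / x) * exp (- (1 / x)) else 0)"

text \<open>The behaviour of \<open>flat\<close> at 0 from the right, read in the variable y =
  1/x.\<close>

lemma poly_exp_tendsto: "((\<lambda>y. poly q y * exp (- y)) \<longlongrightarrow> (0::real)) at_top"
proof -
  have "((\<lambda>y. \<Sum>i\<le>degree q. coeff q i * (y ^ i / exp y)) \<longlongrightarrow> (\<Sum>i\<le>degree q. coeff q i * 0)) at_top"
    by (intro tendsto_intros tendsto_power_div_exp_0)
  then show ?thesis
    by (simp add: poly_altdef sum_distrib_right exp_minus divide_inverse mult.assoc)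
qed

lemma flat_tendsto: "(flat q \<longlongrightarrow> 0) (at 0)"
proof -
  have "((\<lambda>x. poly q (inverse x) * exp (- (inverse x))) \<longlongrightarrow> 0) (at_right 0)"
    by (rule filterlim_compose[OF poly_exp_tendsto filterlim_inverse_at_top_right])
  then have "(flat q \<longlongrightarrow> 0) (at_right 0)"
    by (rule Lim_transform_eventually)
      (auto simp: eventually_at_right_field flat_def inverse_eq_divide intro!: exI[of _ 1])
  moreover have "(flat q \<longlongrightarrow> 0) (at_left 0)"
    by (rule tendsto_eventually) (auto simp: eventually_at_left_field flat_def intro!: exI[of _ "-1"])
  ultimately show ?thesis by (simp add: filterlim_split_at)
qed

text \<open>The factor \<open>[:0, 0, 1:]\<close> is y^2 with y = 1/x: it comes from dy/dx = -y^2,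
  while differentiating q(y) exp(-y) in y gives (q' - q)(y) exp(-y). One recursion on polynomials
  thus covers all higher derivatives.\<close>

lemma flat_DERIV:
  "(flat q has_real_derivative flat ([:0, 0, 1:] * (q - pderiv q)) x) (at x)"
proof -
  consider "x > 0" | "x < 0" | "x = 0" by linarith
  then show ?thesis
  proof cases
    case 1
    have "((\<lambda>x. poly q (1 / x) * exp (- (1 / x))) has_real_derivative
        flat ([:0, 0, 1:] * (q - pderiv q)) x) (at x)"
    proof -
      have "((\<lambda>x. 1 / x) has_real_derivative - (1 / x * (1 / x))) (at x)"
        using 1 by (auto intro!: derivative_eq_intros)
      then have "((\<lambda>x. poly q (1 / x) * exp (- (1 / x))) has_real_derivative
          poly (pderiv q) (1 / x) * (- (1 / x * (1 / x))) * exp (- (1 / x))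
          + exp (- (1 / x)) * (- (- (1 / x * (1 / x)))) * poly q (1 / x)) (at x)"
        by (intro DERIV_mult DERIV_chain2[OF poly_DERIV] DERIV_chain2[OF DERIV_exp] DERIV_minus)
      moreover have "poly (pderiv q) (1 / x) * (- (1 / x * (1 / x))) * exp (- (1 / x))
          + exp (- (1 / x)) * (- (- (1 / x * (1 / x)))) * poly q (1 / x)
          = flat ([:0, 0, 1:] * (q - pderiv q)) x"
        using 1 by (simp add: flat_def algebra_simps)
      ultimately show ?thesis by simp
    qed
    then show ?thesis
      by (rule has_field_derivative_transform_within_open[of _ _ _ "{0<..}"]) (use 1 in \<open>auto simp: flat_def\<close>)
  next
    case 2
    have "((\<lambda>x. 0) has_real_derivative 0) (at x)" by simp
    then have "(flat q has_real_derivative 0) (at x)"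
      by (rule has_field_derivative_transform_within_open[of _ _ _ "{..<0}"]) (use 2 in \<open>auto simp: flat_def\<close>)
    then show ?thesis using 2 by (simp add: flat_def)
  next
    case 3
    \<comment> \<open>Dividing by h multiplies the polynomial by y = 1/h, hence
      \<open>pCons 0 q\<close>: the difference quotient at 0 is again a function of this family and
      tends to 0.\<close>
    have "((\<lambda>h. flat (pCons 0 q) h) \<longlongrightarrow> 0) (at 0)" by (rule flat_tendsto)
    then have "((\<lambda>h. (flat q (0 + h) - flat q 0) / h) \<longlongrightarrow> 0) (at 0)"
      by (rule Lim_transform_eventually) (auto simp: eventually_at flat_def intro!: exI[of _ 1])
    then show ?thesis using 3 by (simp add: DERIV_def flat_def)
  qed
qed

lemma smooth_flat: "smooth (flat q)"
proof (rule smoothI)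
  fix k show "C_k k (flat q)"
  proof (induction k arbitrary: q)
    case 0
    then show ?case
      by (auto intro!: continuous_at_imp_continuous_on DERIV_isCont[OF flat_DERIV])
  next
    case (Suc k)
    show ?case by (rule C_k_SucI[OF flat_DERIV Suc])
  qed
qed

text \<open>The standard product exp(-1/(x - a)) exp(-1/(b - x)). The arguments are written in the
  form \<open>c * x + d\<close> so that \<open>smooth_affine\<close> matches them.\<close>

definition bump :: "real \<Rightarrow> real \<Rightarrow> real \<Rightarrow> real" where
  "bump a b x = flat [:1:] (1 * x + (- a)) * flat [:1:] ((- 1) * x + b)"

lemma smooth_bump: "smooth (bump a b)"
  unfolding bump_def[abs_def] by (intro smooth_mult smooth_affine smooth_flat)

lemma bump_pos: "a < x \<Longrightarrow> x < b \<Longrightarrow> bump a b x > 0"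
  and bump_zero: "x \<notin> {a<..<b} \<Longrightarrow> bump a b x = 0"
  by (auto simp: bump_def flat_def)

lemma bump_nonneg: "bump a b x \<ge> 0"
  by (auto simp: bump_def flat_def)

lemma flat_1_less: "flat [:1:] x < 1"
  by (auto simp: flat_def)

text \<open>Keeps 1 - \<open>bump\<close> nonnegative, so that its powers stay in [0, 1].\<close>

lemma bump_less_1: "bump a b x < 1"
proof -
  have "0 \<le> flat [:1:] y" for y by (simp add: flat_def)
  then show ?thesis
    unfolding bump_def using flat_1_less
    by (metis less_eq_real_def mult.right_neutral mult_strict_mono' zero_less_one)
qed

section \<open>Test functions of one variable\<close>

lemma compact_closure_subset:
  fixes K :: "'a::metric_space set"
  shows "compact K \<Longrightarrow> closure A \<subseteq> K \<Longrightarrow> compact (closure A)"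
  using compact_Int_closed[of K "closure A"] by (simp add: Int_absorb1)

lemma test_functionI:
  fixes f :: "real \<Rightarrow> real"
  assumes "smooth f" "{a..b} \<subseteq> S" "\<And>x. x \<notin> {a..b} \<Longrightarrow> f x = 0"
  shows "test_function S f"
proof -
  have "closure {x. f x \<noteq> 0} \<subseteq> {a..b}"
    using assms(3) by (intro closure_minimal) (fastforce simp del: atLeastAtMost_iff)+
  then show ?thesis using assms(1,2) unfolding test_function_def
    using compact_closure_subset[of "{a..b}"] by blast
qed

lemma test_functionE:
  fixes f :: "real \<Rightarrow> real"
  assumes "test_function S f" "is_interval S" "S \<noteq> {}"
  obtains a b where "a \<le> b" "{a..b} \<subseteq> S" "\<And>x. x \<notin> {a..b} \<Longrightarrow> f x = 0"
proof (cases "closure {x. f x \<noteq> 0} = {}")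
  case True
  then have "f x = 0" for x by auto
  moreover obtain y where "y \<in> S" using assms by auto
  ultimately show ?thesis using that[of y y] by auto
next
  case False
  let ?K = "closure {x. f x \<noteq> 0}"
  have K: "compact ?K" "?K \<subseteq> S" using assms(1) by (auto simp: test_function_def)
  obtain a where a: "a \<in> ?K" "\<And>y. y \<in> ?K \<Longrightarrow> a \<le> y" using compact_attains_inf[OF K(1) False] by auto
  obtain b where b: "b \<in> ?K" "\<And>y. y \<in> ?K \<Longrightarrow> y \<le> b" using compact_attains_sup[OF K(1) False] by auto
  have "{a..b} \<subseteq> S"
    using mem_is_interval_1_I[OF assms(2) subsetD[OF K(2) a(1)] subsetD[OF K(2) b(1)]] by auto
  moreover have "f x = 0" if "x \<notin> {a..b}" for x
    using that a(2)[of x] b(2)[of x] closure_subset[of "{x. f x \<noteq> 0}"] by auto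
  ultimately show ?thesis using that a b by blast
qed

lemma test_smooth: "test_function S f \<Longrightarrow> smooth f"
  by (simp add: test_function_def)

lemma test_continuous: "test_function S f \<Longrightarrow> continuous_on UNIV f"
  by (simp add: test_function_def smooth_continuous)

lemma test_DERIV: 
  fixes f :: "real \<Rightarrow> real"
  shows "test_function S f \<Longrightarrow> (f has_real_derivative deriv f x) (at x)"
  by (simp add: test_function_def smooth_DERIV)

lemma test_mono: "test_function S f \<Longrightarrow> S \<subseteq> T \<Longrightarrow> test_function T f"
  by (auto simp: test_function_def)

text \<open>A function vanishes on the open complement of its closed support, and so does its
  derivative.\<close>

lemma test_deriv:
  fixes f :: "real \<Rightarrow> real"
  assumes "test_function S f" shows "test_function S (deriv f)"
proof -
  have "deriv f x = 0" if "x \<notin> closure {x. f x \<noteq> 0}" for x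
  proof -
    have "((\<lambda>x. 0) has_real_derivative 0) (at x)" by simp
    then have "(f has_real_derivative 0) (at x)"
      by (rule has_field_derivative_transform_within_open[of _ _ _ "- closure {x. f x \<noteq> 0}"])
        (use that closure_subset[of "{x. f x \<noteq> 0}"] in auto)
    then show ?thesis by (rule DERIV_imp_deriv)
  qed
  then have "closure {x. deriv f x \<noteq> 0} \<subseteq> closure {x. f x \<noteq> 0}"
    by (intro closure_minimal) auto
  then show ?thesis using assms unfolding test_function_def
    using compact_closure_subset smooth_deriv by blast
qed

lemma test_mult_smooth:
  assumes "test_function S f" "smooth g" shows "test_function S (\<lambda>x. f x * g x)"
proof -
  have "closure {x. f x * g x \<noteq> 0} \<subseteq> closure {x. f x \<noteq> 0}"
    by (rule closure_mono) auto
  then show ?thesis using assms unfolding test_function_def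
    using compact_closure_subset smooth_mult by blast
qed

lemma test_minus: "test_function S f \<Longrightarrow> test_function S (\<lambda>x. - f x)"
  by (auto simp: test_function_def smooth_minus)

lemma test_diff:
  assumes "test_function S f" "test_function S g" shows "test_function S (\<lambda>x. f x - g x)"
proof -
  have "closure {x. f x - g x \<noteq> 0} \<subseteq> closure ({x. f x \<noteq> 0} \<union> {x. g x \<noteq> 0})"
    by (rule closure_mono) auto
  then have *: "closure {x. f x - g x \<noteq> 0} \<subseteq> closure {x. f x \<noteq> 0} \<union> closure {x. g x \<noteq> 0}" by simp
  have "compact (closure {x. f x \<noteq> 0} \<union> closure {x. g x \<noteq> 0})"
    using assms by (auto simp: test_function_def)
  then have "compact (closure {x. f x - g x \<noteq> 0})"
    using * by (rule compact_closure_subset)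
  with * show ?thesis using assms unfolding test_function_def
    by (auto intro: smooth_diff)
qed

lemma test_bump: "{a..b} \<subseteq> S \<Longrightarrow> test_function S (bump a b)"
  by (rule test_functionI[OF smooth_bump]) (auto simp: bump_zero)

section \<open>Tensor products of test functions on the plane\<close>

definition tens :: "(real \<Rightarrow> real) \<Rightarrow> (real \<Rightarrow> real) \<Rightarrow> real \<times> real \<Rightarrow> real" where
  "tens \<alpha> \<beta> p = \<alpha> (fst p) * \<beta> (snd p)"

lemma dir_deriv_tens:
  assumes "smooth \<alpha>" "smooth \<beta>"
  shows "dir_deriv (1, 0) (tens \<alpha> \<beta>) = tens (deriv \<alpha>) \<beta>"
    and "dir_deriv (0, 1) (tens \<alpha> \<beta>) = tens \<alpha> (deriv \<beta>)"
    and "tens \<alpha> \<beta> differentiable (at p)"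
proof -
  have "(tens \<alpha> \<beta> has_derivative (\<lambda>h. \<alpha> (fst p) * (deriv \<beta> (snd p) * snd h) + deriv \<alpha> (fst p) * fst h * \<beta> (snd p))) (at p)" for p
    unfolding tens_def[abs_def]
    by (intro has_derivative_mult has_derivative_compose[OF has_derivative_fst[OF has_derivative_ident] has_field_derivative_imp_has_derivative[OF smooth_DERIV]]
      has_derivative_compose[OF has_derivative_snd[OF has_derivative_ident] has_field_derivative_imp_has_derivative[OF smooth_DERIV]] assms)
  note D = this
  show "dir_deriv (1, 0) (tens \<alpha> \<beta>) = tens (deriv \<alpha>) \<beta>" "dir_deriv (0, 1) (tens \<alpha> \<beta>) = tens \<alpha> (deriv \<beta>)"
    by (auto simp: dir_deriv_eqI[OF D] tens_def)
  show "tens \<alpha> \<beta> differentiable (at p)" using D differentiableI by blast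
qed

text \<open>Both partial derivatives of a tensor product are again tensor products of smooth
  functions, so the induction runs with arbitrary factors.\<close>

lemma smooth_tens: "smooth \<alpha> \<Longrightarrow> smooth \<beta> \<Longrightarrow> smooth (tens \<alpha> \<beta>)"
proof (rule smoothI)
  fix k show "smooth \<alpha> \<Longrightarrow> smooth \<beta> \<Longrightarrow> C_k k (tens \<alpha> \<beta>)"
  proof (induction k arbitrary: \<alpha> \<beta>)
    case 0
    then have "continuous_on UNIV \<alpha>" "continuous_on UNIV \<beta>" by (auto intro: smooth_continuous)
    then have "continuous_on UNIV (\<lambda>p. \<alpha> (fst p))" "continuous_on UNIV (\<lambda>p. \<beta> (snd p))"
      by (auto intro!: continuous_on_compose2[of UNIV \<alpha> UNIV fst] continuous_on_compose2[of UNIV \<beta> UNIV snd]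
          continuous_on_fst[OF continuous_on_id, unfolded id_def] continuous_on_snd[OF continuous_on_id, unfolded id_def])
    then show ?case unfolding C_k.simps tens_def[abs_def] by (rule continuous_on_mult)
  next
    case (Suc k)
    then show ?case
      by (auto simp: Basis_prod_def dir_deriv_tens smooth_deriv)
  qed
qed

lemma test_tens:
  assumes "test_function S \<alpha>" "test_function T \<beta>" "S \<times> T \<subseteq> W"
  shows "test_function W (tens \<alpha> \<beta>)"
proof -
  let ?K = "closure {x. \<alpha> x \<noteq> 0} \<times> closure {x. \<beta> x \<noteq> 0}"
  have "{p. tens \<alpha> \<beta> p \<noteq> 0} \<subseteq> {x. \<alpha> x \<noteq> 0} \<times> {x. \<beta> x \<noteq> 0}" by (auto simp: tens_def)
  also have "\<dots> \<subseteq> ?K" by (intro Sigma_mono closure_subset)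
  finally have K: "closure {p. tens \<alpha> \<beta> p \<noteq> 0} \<subseteq> ?K"
    by (rule closure_minimal) (auto intro: closed_Times)
  have "compact ?K" using assms by (auto simp: test_function_def intro: compact_Times)
  then have "compact (closure {p. tens \<alpha> \<beta> p \<noteq> 0})"
    using K by (rule compact_closure_subset)
  moreover have "?K \<subseteq> W" using assms by (auto simp: test_function_def)
  ultimately show ?thesis using K assms by (auto simp: test_function_def smooth_tens)
qed

lemma borel_measurable_tens [measurable]:
  assumes [measurable]: "\<alpha> \<in> borel_measurable borel" "\<beta> \<in> borel_measurable borel"
  shows "tens \<alpha> \<beta> \<in> borel_measurable borel"
proof -
  have [measurable]: "fst \<in> borel \<rightarrow>\<^sub>M (borel :: real measure)" "snd \<in> borel \<rightarrow>\<^sub>M (borel :: real measure)"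
    by (auto intro!: borel_measurable_continuous_onI continuous_intros)
  show ?thesis unfolding tens_def[abs_def] by measurable
qed

section \<open>Signs detected by nonnegative tensor products\<close>

lemma mem_box_pair:
  "p \<in> box (a, c) (b, d) \<longleftrightarrow> fst p \<in> {a<..<b} \<and> snd p \<in> {c<..<d}" for a b c d :: real
  by (cases p) (auto simp: mem_box Basis_prod_def)

text \<open>Indicators of open boxes are limits of admissible tensor products: 1 - (1 -
  \<open>bump\<close>)^n is smooth, lies in [0, 1], keeps the support of the bump and tends to 1
  wherever the bump is positive. Dominated convergence with the majorant |f| passes the sign to the
  limit.\<close>

lemma nonneg_box:
  fixes f :: "real \<times> real \<Rightarrow> real"
  assumes int: "integrable lborel f"
    and pos: "\<And>\<alpha> \<beta>. test_function {a<..<b} \<alpha> \<Longrightarrow> test_function {c<..<d} \<beta> \<Longrightarrow>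
        (\<forall>x. 0 \<le> \<alpha> x) \<Longrightarrow> (\<forall>t. 0 \<le> \<beta> t) \<Longrightarrow> 0 \<le> (LINT p|lborel. f p * tens \<alpha> \<beta> p)"
    and sub: "{u1..v1} \<subseteq> {a<..<b}" "{u2..v2} \<subseteq> {c<..<d}"
  shows "0 \<le> (LINT p|lborel. indicator (box (u1, u2) (v1, v2)) p * f p)"
proof -
  define h :: "real \<Rightarrow> real \<Rightarrow> nat \<Rightarrow> real \<Rightarrow> real" where "h u v n x = 1 - (1 - bump u v x) ^ n" for u v n x
  have h0: "h u v n x = 0" if "x \<notin> {u<..<v}" for u v n x
    using that by (simp add: h_def bump_zero)
  have h1: "0 \<le> h u v n x" "h u v n x \<le> 1" for u v n x
    using bump_nonneg[of u v x] bump_less_1[of u v x] by (auto simp: h_def power_le_one)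
  have htest: "{u..v} \<subseteq> S \<Longrightarrow> test_function S (h u v n)" for u v n S
    unfolding h_def[abs_def]
    by (rule test_functionI[where a=u and b=v], intro smooth_diff smooth_const smooth_power smooth_bump)
      (auto simp: bump_zero)
  have hlim: "(\<lambda>n. h u v n x) \<longlonglongrightarrow> indicator {u<..<v} x" for u v x
  proof (cases "x \<in> {u<..<v}")
    case True
    then have "norm (1 - bump u v x) < 1" using bump_pos[of u x v] bump_less_1[of u v x] by (simp add: abs_if)
    then have "(\<lambda>n. (1 - bump u v x) ^ n) \<longlonglongrightarrow> 0" by (rule LIMSEQ_power_zero)
    then have "(\<lambda>n. 1 - (1 - bump u v x) ^ n) \<longlonglongrightarrow> 1 - 0" by (rule tendsto_diff[OF tendsto_const])
    then show ?thesis using True by (simp add: h_def)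
  next
    case False
    then show ?thesis using h0[OF False] by simp
  qed
  have [measurable]: "h u v n \<in> borel_measurable borel" for u v n
    using borel_measurable_continuous_onI[OF smooth_continuous[OF test_smooth[OF htest[of u v UNIV n]]]] by simp
  have [measurable]: "f \<in> borel_measurable borel" using int by auto
  have [measurable]: "(\<lambda>p. f p * tens (h u1 v1 n) (h u2 v2 n) p) \<in> borel_measurable borel" for n
    by measurable
  have "(\<lambda>n. LINT p|lborel. f p * tens (h u1 v1 n) (h u2 v2 n) p) \<longlonglongrightarrow>
      (LINT p|lborel. indicator (box (u1, u2) (v1, v2)) p * f p)"
  proof (rule integral_dominated_convergence[where w="\<lambda>p. norm (f p)"])
    show "AE p in lborel. (\<lambda>n. f p * tens (h u1 v1 n) (h u2 v2 n) p)
        \<longlonglongrightarrow> indicator (box (u1, u2) (v1, v2)) p * f p"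
    proof (rule AE_I2)
      fix p :: "real \<times> real"
      have "(\<lambda>n. f p * tens (h u1 v1 n) (h u2 v2 n) p) \<longlonglongrightarrow>
          f p * (indicator {u1<..<v1} (fst p) * indicator {u2<..<v2} (snd p))"
        unfolding tens_def by (intro tendsto_intros hlim)
      then show "(\<lambda>n. f p * tens (h u1 v1 n) (h u2 v2 n) p)
        \<longlonglongrightarrow> indicator (box (u1, u2) (v1, v2)) p * f p"
        by (rule subst[where P="\<lambda>L. _ \<longlonglongrightarrow> L", rotated]) (simp add: indicator_def mem_box_pair)
    qed
    show "AE p in lborel. norm (f p * tens (h u1 v1 n) (h u2 v2 n) p) \<le> norm (f p)" for n
    proof (rule AE_I2)
      fix p :: "real \<times> real"
      have "\<bar>tens (h u1 v1 n) (h u2 v2 n) p\<bar> \<le> 1"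
        unfolding tens_def using h1 by (simp add: abs_mult mult_le_one)
      then show "norm (f p * tens (h u1 v1 n) (h u2 v2 n) p) \<le> norm (f p)"
        by (simp add: abs_mult mult_left_le)
    qed
  qed (use int in auto)
  moreover have "0 \<le> (LINT p|lborel. f p * tens (h u1 v1 n) (h u2 v2 n) p)" for n
    by (intro pos htest sub allI h1)
  ultimately show ?thesis by (auto intro: LIMSEQ_le_const)
qed

text \<open>Compares the measures whose densities are the positive and the negative part of
  \<open>f\<close> on the rectangle. The negative one is dominated on boxes by
  \<open>nonneg_box\<close>, on open sets by splitting them into countably many boxes with disjoint
  interiors, and on Borel sets by outer regularity. On {f < 0} the positive one vanishes, hence so
  does the negative one.\<close>

lemma AE_nonneg_rectangle:
  fixes f :: "real \<times> real \<Rightarrow> real"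
  assumes int: "integrable lborel f"
    and pos: "\<And>\<alpha> \<beta>. test_function {a<..<b} \<alpha> \<Longrightarrow> test_function {c<..<d} \<beta> \<Longrightarrow>
        (\<forall>x. 0 \<le> \<alpha> x) \<Longrightarrow> (\<forall>t. 0 \<le> \<beta> t) \<Longrightarrow> 0 \<le> (LINT p|lborel. f p * tens \<alpha> \<beta> p)"
  shows "AE p in lborel. p \<in> box (a, c) (b, d) \<longrightarrow> 0 \<le> f p"
proof (cases "a < b \<and> c < d")
  case False
  then show ?thesis by (auto simp: mem_box Basis_prod_def)
next
  case True
  define Q where "Q = box (a, c) (b, d)"
  have ne: "box (a, c) (b, d) \<noteq> {}" using True by (auto simp: box_ne_empty Basis_prod_def)
  have [measurable]: "f \<in> borel_measurable borel" "Q \<in> sets borel" using int by (auto simp: Q_def)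
  \<comment> \<open>\<open>ennreal\<close> cuts negative values to 0, so \<open>P\<close> and
    \<open>N\<close> carry the positive and the negative part of \<open>f\<close>.\<close>
  define P where "P = density lborel (\<lambda>p. ennreal (indicator Q p * f p))"
  define N where "N = density lborel (\<lambda>p. ennreal (indicator Q p * (- f p)))"
  have sets[simp]: "sets P = sets borel" "sets N = sets borel" by (simp_all add: P_def N_def)
  have intQ: "integrable lborel (\<lambda>p. indicator A p * f p)" if "A \<in> sets borel" for A
    using integrable_mult_indicator[OF _ int, of A] that by simp
  have finite_density: "(\<integral>\<^sup>+ p. ennreal (k p) \<partial>lborel) \<noteq> \<infinity>" if "integrable lborel k" for k :: "real \<times> real \<Rightarrow> real"
  proof -
    have "(\<integral>\<^sup>+ p. ennreal (k p) \<partial>lborel) \<le> (\<integral>\<^sup>+ p. ennreal (norm (k p)) \<partial>lborel)"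
      by (intro nn_integral_mono ennreal_leI) auto
    also have "\<dots> < \<infinity>" using that by (simp add: integrable_iff_bounded)
    finally show ?thesis by simp
  qed
  have intQ': "integrable lborel (\<lambda>p. indicator Q p * (- f p))"
    using intQ[of Q] by simp
  have fin: "finite_measure P" "finite_measure N"
    unfolding P_def N_def
    using finite_density[OF intQ[of Q]] finite_density[OF intQ']
    by (auto intro!: finite_measureI simp: emeasure_density)
  have small: "emeasure N (box u v) \<le> emeasure P (box u v)" if uv: "cbox u v \<subseteq> Q" "box u v \<noteq> {}" for u v
  proof -
    obtain u1 u2 v1 v2 where [simp]: "u = (u1, u2)" "v = (v1, v2)" by (cases u, cases v)
    have "(u1, u2) \<in> Q" "(v1, v2) \<in> Q" "u1 < v1" "u2 < v2"
      using uv by (auto simp: box_ne_empty Basis_prod_def mem_box cbox_def subset_iff)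
    then have uvsub: "{u1..v1} \<subseteq> {a<..<b}" "{u2..v2} \<subseteq> {c<..<d}"
      by (auto simp: Q_def mem_box Basis_prod_def)
    have *: "0 \<le> (LINT p|lborel. indicator (box u v) p * f p)"
      using nonneg_box[OF int _ uvsub] pos by simp
    let ?g = "\<lambda>p. indicator (box u v) p * f p"
    have ig: "integrable lborel ?g" by (rule intQ) auto
    have inQ: "p \<in> box u v \<Longrightarrow> p \<in> Q" for p
      using uv(1) box_subset_cbox[of u v] by blast
    have im: "integrable lborel (\<lambda>p. max 0 (?g p))" "integrable lborel (\<lambda>p. max 0 (- ?g p))"
      by (intro integrable_max integrable_zero integrable_minus ig)+
    have "emeasure P (box u v) = (\<integral>\<^sup>+ p. ennreal (max 0 (?g p)) \<partial>lborel)"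
      unfolding P_def by (subst emeasure_density)
        (use inQ in \<open>auto intro!: nn_integral_cong simp: ennreal_neg max_def split: split_indicator\<close>)
    then have eP: "emeasure P (box u v) = ennreal (LINT p|lborel. max 0 (?g p))"
      using nn_integral_eq_integral[OF im(1)] by simp
    have "emeasure N (box u v) = (\<integral>\<^sup>+ p. ennreal (max 0 (- ?g p)) \<partial>lborel)"
      unfolding N_def by (subst emeasure_density)
        (use inQ in \<open>auto intro!: nn_integral_cong simp: ennreal_neg max_def split: split_indicator\<close>)
    then have eN: "emeasure N (box u v) = ennreal (LINT p|lborel. max 0 (- ?g p))"
      using nn_integral_eq_integral[OF im(2)] by simp
    have "(LINT p|lborel. ?g p) = (LINT p|lborel. max 0 (?g p) - max 0 (- ?g p))"
      by (rule Bochner_Integration.integral_cong) (simp_all add: max_def)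
    also have "\<dots> = (LINT p|lborel. max 0 (?g p)) - (LINT p|lborel. max 0 (- ?g p))"
      by (intro Bochner_Integration.integral_diff im)
    finally show ?thesis unfolding eP eN using * by (intro ennreal_leI) simp
  qed
  have open_le: "emeasure N U \<le> emeasure P U" if U: "open U" "U \<subseteq> Q" for U
  proof -
    \<comment> \<open>This gauge forces every box of the covering to stay inside
      \<open>U\<close>.\<close>
    define g where "g x = (if x \<in> U then SOME V. open V \<and> x \<in> V \<and> V \<subseteq> U else UNIV)" for x
    have g: "open (g x) \<and> x \<in> g x \<and> (x \<in> U \<longrightarrow> g x \<subseteq> U)" for x
    proof (cases "x \<in> U")
      case True
      then have "\<exists>V. open V \<and> x \<in> V \<and> V \<subseteq> U" using U(1) by blast
      from someI_ex[OF this] show ?thesis using True by (simp add: g_def)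
    qed (simp add: g_def)
    have gauge: "gauge g" using g by (simp add: gauge_def)
    have Ucb: "U \<subseteq> cbox (a, c) (b, d)" using U(2) box_subset_cbox unfolding Q_def by blast
    obtain D where D: "countable D" "\<And>K. K \<in> D \<Longrightarrow> interior K \<noteq> {} \<and> (\<exists>c d. K = cbox c d)"
      "pairwise (\<lambda>A B. interior A \<inter> interior B = {}) D"
      "\<And>K. K \<in> D \<Longrightarrow> \<exists>x \<in> U \<inter> K. K \<subseteq> g x" "U \<subseteq> \<Union>D"
      using covering_lemma[OF Ucb ne gauge] by metis
    have KU: "K \<subseteq> U" if "K \<in> D" for K using D(4)[OF that] g by blast
    let ?V = "\<Union>K\<in>D. interior K"
    have disj: "disjoint_family_on interior D"
      using D(3) by (auto simp: disjoint_family_on_def pairwise_def)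
    have eV: "emeasure M ?V = (\<integral>\<^sup>+K. emeasure M (interior K) \<partial>count_space D)"
      if "sets M = sets borel" for M :: "(real \<times> real) measure"
      by (rule emeasure_UN_countable) (use D(1) disj that in auto)
    \<comment> \<open>What the open boxes miss lies in countably many box boundaries.\<close>
    have null: "U - ?V \<in> null_sets lborel"
    proof (rule null_sets_subset[where B="\<Union>K\<in>D. K - interior K"])
      have "K - interior K \<in> null_sets lborel" if KD: "K \<in> D" for K
      proof -
        obtain u v where K: "K = cbox u v" using D(2)[OF KD] by blast
        have "negligible (cbox u v - box u v)" by (rule negligible_frontier_interval)
        then have "cbox u v - box u v \<in> null_sets (completion lborel)" by (simp add: negligible_iff_null_sets)
        then show ?thesis by (subst (asm) null_sets_completion_iff) (auto simp: K)
      qed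
      then show "(\<Union>K\<in>D. K - interior K) \<in> null_sets lborel" by (intro null_sets_UN' D(1))
    next
      have "open ?V" by auto
      then show "U - ?V \<in> sets lborel" using U(1) by (simp add: borel_open sets.Diff)
    next
      show "U - ?V \<subseteq> (\<Union>K\<in>D. K - interior K)" using D(5) by blast
    qed
    have eq: "emeasure M U = emeasure M ?V" if "M = density lborel k" "k \<in> borel_measurable borel" for M k
    proof -
      have "U - ?V \<in> null_sets M"
        using null AE_not_in[OF null] that
        by (subst that(1), subst null_sets_density_iff) (auto simp only: null_setsD2 measurable_lborel2 elim!: eventually_mono)
      moreover have "U - (U - ?V) = ?V" using KU interior_subset by blast
      moreover have "U \<in> sets M" using that U by simp
      ultimately show ?thesis using emeasure_Diff_null_set[of "U - ?V" M U] by simp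
    qed
    have "emeasure N ?V \<le> emeasure P ?V"
      unfolding eV[OF sets(1)] eV[OF sets(2)]
    proof (rule nn_integral_mono)
      fix K assume "K \<in> space (count_space D)"
      then have KD: "K \<in> D" by simp
      obtain u v where K: "K = cbox u v" using D(2)[OF KD] by blast
      show "emeasure N (interior K) \<le> emeasure P (interior K)"
        using small[of u v] KU[OF KD] U(2) D(2)[OF KD] by (auto simp: K)
    qed
    then show ?thesis using eq[OF P_def] eq[OF N_def] by simp
  qed
  have le: "emeasure N B \<le> emeasure P B" if B: "B \<in> sets borel" for B
  proof -
    have PU: "emeasure P (U \<inter> Q) = emeasure P U" "emeasure N (U \<inter> Q) = emeasure N U" if "open U" for U
      unfolding P_def N_def using that
      by (auto simp: emeasure_density intro!: nn_integral_cong split: split_indicator)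
    \<comment> \<open>Outer regularity applies because both measures are finite, \<open>f\<close>
      being integrable.\<close>
    have "emeasure N B = (INF U \<in> {U. B \<subseteq> U \<and> open U}. emeasure N U)"
      using outer_regular[of N, OF sets(2) _ B] finite_measure.emeasure_finite[OF fin(2)] by simp
    also have "\<dots> \<le> (INF U \<in> {U. B \<subseteq> U \<and> open U}. emeasure P U)"
    proof (rule INF_mono)
      fix U assume "U \<in> {U. B \<subseteq> U \<and> open U}"
      moreover from this have "emeasure N (U \<inter> Q) \<le> emeasure P (U \<inter> Q)"
        by (intro open_le) (auto simp: Q_def open_box)
      ultimately show "\<exists>U'\<in>{U. B \<subseteq> U \<and> open U}. emeasure N U' \<le> emeasure P U" using PU by auto
    qed
    also have "\<dots> = emeasure P B"
      using outer_regular[of P, OF sets(1) _ B] finite_measure.emeasure_finite[OF fin(1)] by simp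
    finally show ?thesis .
  qed
  define B where "B = {p. f p < 0}"
  have [measurable]: "B \<in> sets borel" by (simp add: B_def)
  have "(\<integral>\<^sup>+ p. ennreal (indicator Q p * f p) * indicator B p \<partial>lborel)
      = (\<integral>\<^sup>+ p. 0 \<partial>(lborel :: (real \<times> real) measure))"
    by (intro nn_integral_cong) (auto simp: B_def indicator_def ennreal_neg)
  then have "emeasure P B = 0"
    unfolding P_def by (subst emeasure_density) auto
  then have "emeasure N B = 0" using le[of B] by simp
  then have "AE p in lborel. ennreal (indicator Q p * (- f p)) * indicator B p = 0"
    unfolding N_def by (subst (asm) emeasure_density) (auto simp: nn_integral_0_iff_AE)
  then show ?thesis
    by eventually_elim (auto simp: B_def Q_def indicator_def ennreal_eq_0_iff split: if_splits)
qed

section \<open>Fubini on the plane and integrability against test functions\<close>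

lemma plane_Fubini:
  fixes f :: "real \<times> real \<Rightarrow> real"
  assumes "integrable lborel f"
  shows "(LINT p|lborel. f p) = (LINT x|lborel. LINT t|lborel. f (x, t))"
    and "integrable lborel (\<lambda>x. LINT t|lborel. f (x, t))"
    and "AE x in lborel. integrable lborel (\<lambda>t. f (x, t))"
  using lborel_pair.integral_fst'[of f] lborel_pair.integrable_fst'[of f]
    lborel_pair.AE_integrable_fst'[of f] assms
  by (simp_all add: lborel_prod)

lemma plane_AE:
  fixes Q :: "real \<times> real \<Rightarrow> bool"
  shows "(AE p in lborel. Q p) \<Longrightarrow> (AE x in lborel. AE t in lborel. Q (x, t))"
  using lborel_pair.AE_pair[of Q] unfolding lborel_prod .

lemma plane_measurable_Pair:
  fixes f :: "real \<times> real \<Rightarrow> 'b::topological_space"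
  assumes "f \<in> borel_measurable borel"
  shows "f \<in> borel_measurable (borel \<Otimes>\<^sub>M borel)"
  using assms by (simp add: borel_prod)

lemma borel_measurable_curry:
  fixes f :: "real \<times> real \<Rightarrow> real"
  assumes [measurable]: "f \<in> borel_measurable borel"
  shows "(\<lambda>t. f (x, t)) \<in> borel_measurable borel" "(\<lambda>x. f (x, t)) \<in> borel_measurable borel"
  using plane_measurable_Pair[OF assms] by measurable

lemma plane_swap:
  fixes f :: "real \<times> real \<Rightarrow> real"
  assumes "f \<in> borel_measurable borel"
  shows "(LINT p|lborel. f (prod.swap p)) = (LINT p|lborel. f p)"
    and "integrable lborel (\<lambda>p. f (prod.swap p)) \<longleftrightarrow> integrable lborel f"
  using lborel_pair.integral_product_swap[of f] lborel_pair.integrable_product_swap_iff[of f] assms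
  by (simp_all add: lborel_prod case_prod_unfold prod.swap_def)

lemma plane_swap_AE:
  fixes P :: "real \<times> real \<Rightarrow> bool"
  assumes "AE p in lborel. P p"
  shows "AE p in lborel. P (prod.swap p)"
proof -
  obtain N where N: "N \<in> null_sets lborel" "\<And>p. p \<notin> N \<Longrightarrow> P p"
    using assms by (auto elim!: AE_E3)
  have "lborel = distr (lborel :: (real \<times> real) measure) lborel prod.swap"
    using lborel_pair.distr_pair_swap[unfolded lborel_prod]
    by (subst distr_cong[where N="lborel :: (real \<times> real) measure" and g="\<lambda>(x, y). (y, x)", OF refl]) (auto simp: lborel_prod cong: distr_cong)
  then have "AE p in distr (lborel :: (real \<times> real) measure) lborel prod.swap. p \<notin> N"
    using AE_not_in[OF N(1)] by metis
  then have "AE p in lborel. prod.swap p \<notin> N"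
    by (rule AE_distrD[rotated]) (simp add: borel_measurable_continuous_onI continuous_on_swap)
  then show ?thesis using N(2) by auto
qed

lemma integrable_tens:
  assumes "integrable lborel \<alpha>" "integrable lborel \<beta>"
  shows "integrable lborel (tens \<alpha> \<beta>)"
    and "(LINT p|lborel. tens \<alpha> \<beta> p) = (LINT x|lborel. \<alpha> x) * (LINT t|lborel. \<beta> t)"
proof -
  have [measurable]: "\<alpha> \<in> borel_measurable borel" "\<beta> \<in> borel_measurable borel" using assms by auto
  have "integrable (lborel \<Otimes>\<^sub>M lborel) (tens \<alpha> \<beta>)"
  proof (rule lborel_pair.Fubini_integrable)
    show "tens \<alpha> \<beta> \<in> borel_measurable (lborel \<Otimes>\<^sub>M lborel)" by (simp add: lborel_prod)
    show "integrable lborel (\<lambda>x. LINT y|lborel. norm (tens \<alpha> \<beta> (x, y)))"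
      using assms by (simp add: tens_def abs_mult)
    show "AE x in lborel. integrable lborel (\<lambda>y. tens \<alpha> \<beta> (x, y))"
      using assms by (simp add: tens_def)
  qed
  then show i: "integrable lborel (tens \<alpha> \<beta>)" by (simp add: lborel_prod)
  show "(LINT p|lborel. tens \<alpha> \<beta> p) = (LINT x|lborel. \<alpha> x) * (LINT t|lborel. \<beta> t)"
    by (subst plane_Fubini(1)[OF i]) (simp add: tens_def)
qed

lemma integrable_mult_bounded:
  fixes f \<phi> :: "'a \<Rightarrow> real"
  assumes f: "integrable M f" and "\<phi> \<in> borel_measurable M" "\<And>x. \<bar>\<phi> x\<bar> \<le> B"
  shows "integrable M (\<lambda>x. f x * \<phi> x)"
proof (rule Bochner_Integration.integrable_bound)
  show "integrable M (\<lambda>x. B * f x)" using f by simp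
  show "(\<lambda>x. f x * \<phi> x) \<in> borel_measurable M" using assms by measurable
  show "AE x in M. norm (f x * \<phi> x) \<le> norm (B * f x)"
  proof (rule AE_I2)
    fix x
    have "\<bar>\<phi> x\<bar> \<le> \<bar>B\<bar>" using assms(3)[of x] by linarith
    then show "norm (f x * \<phi> x) \<le> norm (B * f x)"
      by (simp add: abs_mult mult.commute[of "\<bar>f x\<bar>"] mult_right_mono)
  qed
qed

lemma test_borel [measurable_dest]:
  "test_function S f \<Longrightarrow> f \<in> borel_measurable borel"
  by (rule borel_measurable_continuous_onI[OF test_continuous])

lemma test_bounded:
  fixes f :: "real \<Rightarrow> real"
  assumes "test_function S f"
  obtains B where "\<And>x. \<bar>f x\<bar> \<le> B"
proof -
  have "test_function UNIV f" using assms test_mono by blast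
  then obtain a b where ab: "a \<le> b" "\<And>x. x \<notin> {a..b} \<Longrightarrow> f x = 0"
    by (rule test_functionE) auto
  have "bounded (f ` {a..b})"
    by (intro compact_imp_bounded compact_continuous_image continuous_on_subset[OF test_continuous[OF assms]]) auto
  then obtain B where B: "\<And>x. x \<in> {a..b} \<Longrightarrow> \<bar>f x\<bar> \<le> B" by (fastforce simp: bounded_iff simp del: atLeastAtMost_iff)
  have "\<bar>f x\<bar> \<le> max 0 B" for x using B[of x] ab(2)[of x] by (cases "x \<in> {a..b}") auto
  then show ?thesis using that by blast
qed

lemma test_integrable:
  fixes f :: "real \<Rightarrow> real"
  assumes "test_function S f"
  shows "integrable lborel f"
proof -
  have "test_function UNIV f" using assms test_mono by blast
  then obtain a b where ab: "a \<le> b" "\<And>x. x \<notin> {a..b} \<Longrightarrow> f x = 0"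
    by (rule test_functionE) auto
  have "integrable lborel (\<lambda>x. indicator {a..b} x *\<^sub>R f x)"
    by (intro borel_integrable_compact continuous_on_subset[OF test_continuous[OF assms]]) auto
  moreover have "(\<lambda>x. indicator {a..b} x *\<^sub>R f x) = f"
    using ab(2) by (auto simp: indicator_def fun_eq_iff)
  ultimately show ?thesis by simp
qed

lemma tens_bounded:
  assumes "test_function S \<alpha>" "test_function T \<beta>"
  obtains B where "\<And>p. \<bar>tens \<alpha> \<beta> p\<bar> \<le> B"
proof -
  obtain A B where "\<And>x. \<bar>\<alpha> x\<bar> \<le> A" "\<And>x. \<bar>\<beta> x\<bar> \<le> B"
    using test_bounded assms by metis
  then have "\<bar>tens \<alpha> \<beta> p\<bar> \<le> A * B" for p
    unfolding tens_def abs_mult by (intro mult_mono) (auto intro: order_trans[OF abs_ge_zero])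
  then show ?thesis using that by blast
qed

lemma integrable_mult_tens:
  assumes "integrable lborel f" "test_function S \<alpha>" "test_function T \<beta>"
  shows "integrable lborel (\<lambda>p. f p * tens \<alpha> \<beta> p)"
proof -
  obtain B where "\<And>p. \<bar>tens \<alpha> \<beta> p\<bar> \<le> B" using tens_bounded assms by metis
  moreover have "tens \<alpha> \<beta> \<in> borel_measurable lborel"
    using borel_measurable_tens[OF test_borel[OF assms(2)] test_borel[OF assms(3)]] by simp
  ultimately show ?thesis using assms(1) by (intro integrable_mult_bounded)
qed

section \<open>The chain rule along a line\<close>

text \<open>Dominated convergence: the indicators converge at every point except the limiting
  endpoint, which is a null set.\<close>

lemma continuous_indefinite_integral:
  fixes g :: "real \<Rightarrow> real"
  assumes g: "integrable lborel g"
  shows "continuous_on UNIV (\<lambda>t. LINT \<tau>|lborel. indicator {..t} \<tau> * g \<tau>)"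
proof (intro continuous_at_imp_continuous_on ballI)
  fix x :: real
  have [measurable]: "g \<in> borel_measurable borel" using g by auto
  show "isCont (\<lambda>t. LINT \<tau>|lborel. indicator {..t} \<tau> * g \<tau>) x"
    unfolding continuous_at_sequentially comp_def
  proof (intro allI impI)
    fix X :: "nat \<Rightarrow> real" assume X: "X \<longlonglongrightarrow> x"
    show "(\<lambda>n. LINT \<tau>|lborel. indicator {..X n} \<tau> * g \<tau>) \<longlonglongrightarrow> (LINT \<tau>|lborel. indicator {..x} \<tau> * g \<tau>)"
    proof (rule integral_dominated_convergence[where w="\<lambda>\<tau>. norm (g \<tau>)"])
      have "AE \<tau> in lborel. \<tau> \<noteq> x" by (rule AE_lborel_singleton)
      then show "AE \<tau> in lborel. (\<lambda>n. indicator {..X n} \<tau> * g \<tau>) \<longlonglongrightarrow> indicator {..x} \<tau> * g \<tau>"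
      proof eventually_elim
        case (elim \<tau>)
        have "\<forall>\<^sub>F n in sequentially. indicator {..X n} \<tau> * g \<tau> = indicator {..x} \<tau> * g \<tau>"
        proof (cases "\<tau> < x")
          case True
          show ?thesis using order_tendstoD(1)[OF X True] by eventually_elim (use True in auto)
        next
          case False
          then have "x < \<tau>" using elim by auto
          from order_tendstoD(2)[OF X this] show ?thesis
            by eventually_elim (use False elim in auto)
        qed
        then show ?case by (rule tendsto_eventually)
      qed
    qed (use g in \<open>auto simp: indicator_def\<close>)
  qed
qed

lemma indefinite_integral_diff:
  fixes g :: "real \<Rightarrow> real"
  assumes g: "integrable lborel g" and "s \<le> t"
  shows "(LINT \<tau>|lborel. indicator {..t} \<tau> * g \<tau>) - (LINT \<tau>|lborel. indicator {..s} \<tau> * g \<tau>)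
    = (LINT \<tau>|lborel. indicator {s<..t} \<tau> * g \<tau>)"
proof -
  have "integrable lborel (\<lambda>\<tau>. indicator A \<tau> * g \<tau>)" if "A \<in> sets borel" for A
    using integrable_mult_indicator[OF _ g, of A] that by simp
  note ind = this
  show ?thesis
    by (subst Bochner_Integration.integral_diff[OF ind ind, symmetric])
      (use assms(2) in \<open>auto intro!: Bochner_Integration.integral_cong split: split_indicator\<close>)
qed

text \<open>Serves an outer function evaluated at F s and F t, whose order is unknown.\<close>

lemma MVT_unordered:
  fixes \<Phi> :: "real \<Rightarrow> real"
  assumes "\<And>y. (\<Phi> has_real_derivative \<phi> y) (at y)"
  obtains \<xi> where "\<xi> \<in> closed_segment x y" "\<Phi> y - \<Phi> x = \<phi> \<xi> * (y - x)"
proof (cases x y rule: linorder_cases)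
  case less
  obtain z where "x < z" "z < y" "\<Phi> y - \<Phi> x = (y - x) * \<phi> z" using MVT2[OF less assms] by blast
  then show ?thesis by (intro that[of z]) (auto simp: closed_segment_eq_real_ivl)
next
  case equal
  then show ?thesis by (intro that[of x]) auto
next
  case greater
  obtain z where "y < z" "z < x" "\<Phi> x - \<Phi> y = (x - y) * \<phi> z" using MVT2[OF greater assms] by blast
  then show ?thesis by (intro that[of z]) (auto simp: closed_segment_eq_real_ivl algebra_simps)
qed

text \<open>The two factors get separate arguments since the mean value points, the endpoints and
  the integration variable in \<open>chain_rule_line\<close> do not coincide.\<close>

lemma product_continuous_near:
  fixes f g :: "real \<Rightarrow> real"
  assumes "continuous_on UNIV f" "continuous_on UNIV g" "0 < e"
  obtains d where "0 < d" "\<And>\<sigma> \<tau>. \<bar>\<sigma> - x\<bar> < d \<Longrightarrow> \<bar>\<tau> - x\<bar> < d \<Longrightarrow> \<bar>f \<sigma> * g \<tau> - f x * g x\<bar> < e"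
proof -
  have "((\<lambda>p. f (fst p) * g (snd p)) \<longlongrightarrow> f x * g x) (nhds x \<times>\<^sub>F nhds x)"
    using assms by (intro tendsto_mult filterlim_compose[OF _ filterlim_fst] filterlim_compose[OF _ filterlim_snd])
      (auto simp: continuous_on_eq_continuous_at continuous_at tendsto_at_iff_tendsto_nhds)
  then have "\<forall>\<^sub>F p in nhds x \<times>\<^sub>F nhds x. dist (f (fst p) * g (snd p)) (f x * g x) < e"
    using assms(3) by (rule tendstoD)
  then obtain P Q where PQ: "eventually P (nhds x)" "eventually Q (nhds x)"
    "\<And>\<sigma> \<tau>. P \<sigma> \<Longrightarrow> Q \<tau> \<Longrightarrow> dist (f \<sigma> * g \<tau>) (f x * g x) < e"
    by (auto simp: eventually_prod_filter)
  obtain d1 d2 where "d1 > 0" "\<And>y. dist y x < d1 \<Longrightarrow> P y" "d2 > 0" "\<And>y. dist y x < d2 \<Longrightarrow> Q y"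
    using PQ(1,2) by (auto simp: eventually_nhds_metric)
  then show ?thesis using PQ(3) by (intro that[of "min d1 d2"]) (auto simp: dist_real_def)
qed

text \<open>Integration by parts for \<Phi>(F) \<beta> with F absolutely continuous, obtained
  without differentiating F almost everywhere. The error made on an interval is to be bounded by e
  times a quantity that is additive in the interval; by bisection it suffices to do this on short
  intervals around each point. There the mean value theorem and continuity make the two integrands
  differ by at most e (|g| + 1).\<close>

lemma chain_rule_line:
  fixes g \<Phi> \<phi> \<beta> \<beta>' :: "real \<Rightarrow> real" and k a b :: real
  assumes g: "integrable lborel g"
    and \<Phi>: "\<And>y. (\<Phi> has_real_derivative \<phi> y) (at y)" and \<phi>: "continuous_on UNIV \<phi>"
    and \<beta>: "\<And>t. (\<beta> has_real_derivative \<beta>' t) (at t)" and \<beta>': "continuous_on UNIV \<beta>'"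
    and ab: "a \<le> b"
  defines "F \<equiv> \<lambda>t. k + (LINT \<tau>|lborel. indicator {..t} \<tau> * g \<tau>)"
  shows "(LINT t|lborel. indicator {a<..b} t * (\<phi> (F t) * \<beta> t * g t + \<Phi> (F t) * \<beta>' t))
    = \<Phi> (F b) * \<beta> b - \<Phi> (F a) * \<beta> a"
proof -
  define K where "K t = \<phi> (F t) * \<beta> t * g t + \<Phi> (F t) * \<beta>' t" for t
  have [measurable]: "g \<in> borel_measurable borel" using g by auto
  have cF: "continuous_on UNIV F"
    unfolding F_def by (intro continuous_intros continuous_indefinite_integral g)
  have c\<Phi>: "continuous_on UNIV \<Phi>" and c\<beta>: "continuous_on UNIV \<beta>"
    using \<Phi> \<beta> by (auto intro!: continuous_at_imp_continuous_on DERIV_isCont)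
  have c1: "continuous_on UNIV (\<lambda>t. \<phi> (F t))" and c2: "continuous_on UNIV (\<lambda>t. \<Phi> (F t))"
    using continuous_on_compose2[OF \<phi> cF] continuous_on_compose2[OF c\<Phi> cF] by auto
  have [measurable]: "(\<lambda>t. \<phi> (F t)) \<in> borel_measurable borel" "(\<lambda>t. \<Phi> (F t)) \<in> borel_measurable borel"
    "\<beta> \<in> borel_measurable borel" "\<beta>' \<in> borel_measurable borel" "F \<in> borel_measurable borel"
    using c1 c2 c\<beta> \<beta>' cF by (auto intro: borel_measurable_continuous_onI)
  have cbd: "\<exists>B. \<forall>\<tau>. \<bar>indicator {s<..t} \<tau> * u \<tau>\<bar> \<le> B" if u: "continuous_on UNIV u" for u :: "real \<Rightarrow> real" and s t
  proof -
    have "bounded (u ` {s..t})"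
      by (intro compact_imp_bounded compact_continuous_image continuous_on_subset[OF u]) auto
    then obtain B where B: "\<forall>\<tau>\<in>{s..t}. \<bar>u \<tau>\<bar> \<le> B" by (auto simp: bounded_iff)
    have "\<bar>indicator {s<..t} \<tau> * u \<tau>\<bar> \<le> max 0 B" for \<tau>
      using bspec[OF B, of \<tau>] by (auto simp: indicator_def)
    then show ?thesis by blast
  qed
  have cg: "integrable lborel (\<lambda>\<tau>. indicator {s<..t} \<tau> * (u \<tau> * g \<tau>))" if u: "continuous_on UNIV u" for u s t
  proof -
    have [measurable]: "u \<in> borel_measurable borel" using u by (rule borel_measurable_continuous_onI)
    obtain B where "\<And>\<tau>. \<bar>indicator {s<..t} \<tau> * u \<tau>\<bar> \<le> B" using cbd[OF u] by blast
    then have "integrable lborel (\<lambda>\<tau>. g \<tau> * (indicator {s<..t} \<tau> * u \<tau>))"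
      by (intro integrable_mult_bounded g) auto
    then show ?thesis by (simp add: mult_ac)
  qed
  have c: "integrable lborel (\<lambda>\<tau>. indicator {s<..t} \<tau> * u \<tau>)" if u: "continuous_on UNIV u" for u :: "real \<Rightarrow> real" and s t
  proof -
    have [measurable]: "u \<in> borel_measurable borel" using u by (rule borel_measurable_continuous_onI)
    obtain B where B: "\<And>\<tau>. \<bar>indicator {s<..t} \<tau> * u \<tau>\<bar> \<le> B" using cbd[OF u] by blast
    have "emeasure lborel {s<..t} < \<infinity>" by (cases "s \<le> t") auto
    then have "integrable lborel (\<lambda>\<tau>. indicator {s<..t} \<tau> * (indicator {s<..t} \<tau> * u \<tau>))"
      by (intro integrable_mult_bounded[OF _ _ B] integrable_real_indicator)
        auto
    moreover have "(\<lambda>\<tau>. indicator {s<..t} \<tau> * (indicator {s<..t} \<tau> * u \<tau>)) = (\<lambda>\<tau>. indicator {s<..t} \<tau> * u \<tau>)"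
      by (auto simp: indicator_def)
    ultimately show ?thesis by simp
  qed
  have cK: "integrable lborel (\<lambda>\<tau>. indicator {s<..t} \<tau> * K \<tau>)" for s t
  proof -
    have "integrable lborel (\<lambda>\<tau>. indicator {s<..t} \<tau> * (\<phi> (F \<tau>) * \<beta> \<tau> * g \<tau>) + indicator {s<..t} \<tau> * (\<Phi> (F \<tau>) * \<beta>' \<tau>))"
      by (intro Bochner_Integration.integrable_add cg c continuous_on_mult c1 c2 c\<beta> \<beta>')
    then show ?thesis by (simp add: K_def ring_distribs)
  qed
  have split: "(LINT \<tau>|lborel. indicator {r<..t} \<tau> * f \<tau>) =
      (LINT \<tau>|lborel. indicator {r<..s} \<tau> * f \<tau>) + (LINT \<tau>|lborel. indicator {s<..t} \<tau> * f \<tau>)"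
    if "r \<le> s" "s \<le> t" "\<And>r s. integrable lborel (\<lambda>\<tau>. indicator {r<..s} \<tau> * f \<tau>)" for r s t and f :: "real \<Rightarrow> real"
    by (subst Bochner_Integration.integral_add[symmetric, OF that(3) that(3)],
        rule Bochner_Integration.integral_cong[OF refl])
      (use that(1,2) in \<open>auto split: split_indicator\<close>)
  define H where "H t = \<Phi> (F t) * \<beta> t" for t
  \<comment> \<open>The additive majorant of the error: the increment of F is weighted by |g|, that
    of \<beta> by length.\<close>
  define E where "E s t = (LINT \<tau>|lborel. indicator {s<..t} \<tau> * (\<bar>g \<tau>\<bar> + 1))" for s t
  have cE: "integrable lborel (\<lambda>\<tau>. indicator {s<..t} \<tau> * (\<bar>g \<tau>\<bar> + 1))" for s t
  proof -
    have "integrable lborel (\<lambda>\<tau>. norm (indicator {s<..t} \<tau> * (1 * g \<tau>)) + indicator {s<..t} \<tau> * 1)"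
      by (intro Bochner_Integration.integrable_add integrable_norm cg c continuous_on_const)
    then show ?thesis by (simp add: abs_mult ring_distribs)
  qed
  have main: "\<bar>H b - H a - (LINT \<tau>|lborel. indicator {a<..b} \<tau> * K \<tau>)\<bar> \<le> e * E a b" if e: "e > 0" for e
    using ab
  proof (induction rule: Bolzano)
    case (trans r s t)
    have "(LINT \<tau>|lborel. indicator {r<..t} \<tau> * K \<tau>) =
      (LINT \<tau>|lborel. indicator {r<..s} \<tau> * K \<tau>) + (LINT \<tau>|lborel. indicator {s<..t} \<tau> * K \<tau>)"
      using trans by (intro split cK) auto
    moreover have "E r t = E r s + E s t"
      unfolding E_def using trans by (intro split cE) auto
    ultimately show ?case using trans(1,2) by (simp add: ring_distribs)
  next
    case (local x)
    obtain d1 where d1: "0 < d1" "\<And>\<sigma> \<tau>. \<bar>\<sigma> - x\<bar> < d1 \<Longrightarrow> \<bar>\<tau> - x\<bar> < d1 \<Longrightarrow>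
        \<bar>\<phi> (F \<sigma>) * \<beta> \<tau> - \<phi> (F x) * \<beta> x\<bar> < e / 2"
      using product_continuous_near[OF c1 c\<beta>, of "e / 2" x] e by auto
    obtain d2 where d2: "0 < d2" "\<And>\<sigma> \<tau>. \<bar>\<sigma> - x\<bar> < d2 \<Longrightarrow> \<bar>\<tau> - x\<bar> < d2 \<Longrightarrow>
        \<bar>\<Phi> (F \<sigma>) * \<beta>' \<tau> - \<Phi> (F x) * \<beta>' x\<bar> < e / 2"
      using product_continuous_near[OF c2 \<beta>', of "e / 2" x] e by auto
    show ?case
    proof (intro exI[of _ "min d1 d2"] conjI allI impI)
      fix s t assume st: "s \<le> x \<and> x \<le> t \<and> t - s < min d1 d2"
      then have "s \<le> t" by simp
      obtain \<xi> where \<xi>: "\<xi> \<in> closed_segment (F s) (F t)" "\<Phi> (F t) - \<Phi> (F s) = \<phi> \<xi> * (F t - F s)"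
        using MVT_unordered[OF \<Phi>] by blast
      obtain \<zeta> where \<zeta>: "\<zeta> \<in> closed_segment s t" "\<beta> t - \<beta> s = \<beta>' \<zeta> * (t - s)"
        using MVT_unordered[OF \<beta>] by blast
      \<comment> \<open>The mean value point lies between F s and F t; the intermediate value
        theorem turns it into a value of F on [s, t], where continuity near x can be used.\<close>
      have "\<exists>\<sigma>\<in>{s..t}. F \<sigma> = \<xi>"
      proof -
        have "connected (F ` {s..t})"
          by (intro connected_continuous_image continuous_on_subset[OF cF]) auto
        then have "closed_segment (F s) (F t) \<subseteq> F ` {s..t}"
          using \<open>s \<le> t\<close> by (intro closed_segment_subset) (auto simp: is_interval_connected_1[symmetric] is_interval_convex_1)
        then show ?thesis using \<xi>(1) by auto
      qed
      then obtain \<sigma> where \<sigma>: "\<sigma> \<in> {s..t}" "F \<sigma> = \<xi>" by blast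
      have FF: "F t - F s = (LINT \<tau>|lborel. indicator {s<..t} \<tau> * g \<tau>)"
        using indefinite_integral_diff[OF g \<open>s \<le> t\<close>] by (simp add: F_def)
      have ts: "t - s = (LINT \<tau>|lborel. indicator {s<..t} \<tau> * 1)"
        using \<open>s \<le> t\<close> by simp
      have igs: "integrable lborel (\<lambda>\<tau>. indicator {s<..t} \<tau> * g \<tau>)" "integrable lborel (\<lambda>\<tau>. indicator {s<..t} \<tau> * 1 :: real)"
        using cg[of "\<lambda>_. 1" s t] c[of "\<lambda>_. 1" s t] by auto
      have "H t - H s = \<phi> (F \<sigma>) * \<beta> t * (F t - F s) + \<Phi> (F s) * \<beta>' \<zeta> * (t - s)"
      proof -
        have "H t - H s = (\<Phi> (F t) - \<Phi> (F s)) * \<beta> t + \<Phi> (F s) * (\<beta> t - \<beta> s)"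
          by (simp add: H_def algebra_simps)
        then show ?thesis using \<xi>(2) \<zeta>(2) \<sigma>(2) by (simp add: algebra_simps)
      qed
      also have "\<dots> = (LINT \<tau>|lborel. \<phi> (F \<sigma>) * \<beta> t * (indicator {s<..t} \<tau> * g \<tau>) + \<Phi> (F s) * \<beta>' \<zeta> * (indicator {s<..t} \<tau> * 1))"
        unfolding FF ts by (subst Bochner_Integration.integral_add) (use igs in auto)
      finally have eq: "H t - H s - (LINT \<tau>|lborel. indicator {s<..t} \<tau> * K \<tau>) =
        (LINT \<tau>|lborel. \<phi> (F \<sigma>) * \<beta> t * (indicator {s<..t} \<tau> * g \<tau>) + \<Phi> (F s) * \<beta>' \<zeta> * (indicator {s<..t} \<tau> * 1)
          - indicator {s<..t} \<tau> * K \<tau>)"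
        by (subst Bochner_Integration.integral_diff) (use igs cK in auto)
      have "\<bar>(LINT \<tau>|lborel. \<phi> (F \<sigma>) * \<beta> t * (indicator {s<..t} \<tau> * g \<tau>) + \<Phi> (F s) * \<beta>' \<zeta> * (indicator {s<..t} \<tau> * 1)
          - indicator {s<..t} \<tau> * K \<tau>)\<bar> \<le> (LINT \<tau>|lborel. \<bar>\<phi> (F \<sigma>) * \<beta> t * (indicator {s<..t} \<tau> * g \<tau>) + \<Phi> (F s) * \<beta>' \<zeta> * (indicator {s<..t} \<tau> * 1)
          - indicator {s<..t} \<tau> * K \<tau>\<bar>)"
        by (rule integral_abs_bound)
      also have "\<dots> \<le> (LINT \<tau>|lborel. e * (indicator {s<..t} \<tau> * (\<bar>g \<tau>\<bar> + 1)))"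
      proof (rule integral_mono)
        fix \<tau> :: real
        show "\<bar>\<phi> (F \<sigma>) * \<beta> t * (indicator {s<..t} \<tau> * g \<tau>) + \<Phi> (F s) * \<beta>' \<zeta> * (indicator {s<..t} \<tau> * 1)
          - indicator {s<..t} \<tau> * K \<tau>\<bar> \<le> e * (indicator {s<..t} \<tau> * (\<bar>g \<tau>\<bar> + 1))"
        proof (cases "\<tau> \<in> {s<..t}")
          case True
          have near: "\<bar>r - x\<bar> < d1" "\<bar>r - x\<bar> < d2" if "s \<le> r" "r \<le> t" for r
            using that st by auto
          have mem: "s \<le> \<sigma>" "\<sigma> \<le> t" "s \<le> \<zeta>" "\<zeta> \<le> t" "s \<le> \<tau>" "\<tau> \<le> t"
            using \<sigma> \<zeta>(1) True \<open>s \<le> t\<close> by (auto simp: closed_segment_eq_real_ivl)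
          have "\<bar>\<phi> (F \<sigma>) * \<beta> t - \<phi> (F x) * \<beta> x\<bar> < e / 2"
            by (intro d1(2) near mem \<open>s \<le> t\<close> order_refl)
          moreover have "\<bar>\<phi> (F \<tau>) * \<beta> \<tau> - \<phi> (F x) * \<beta> x\<bar> < e / 2"
            by (intro d1(2) near mem)
          ultimately have "\<bar>\<phi> (F \<sigma>) * \<beta> t - \<phi> (F \<tau>) * \<beta> \<tau>\<bar> \<le> e" by linarith
          moreover have "\<bar>\<Phi> (F s) * \<beta>' \<zeta> - \<Phi> (F \<tau>) * \<beta>' \<tau>\<bar> \<le> e"
          proof -
            have "\<bar>\<Phi> (F s) * \<beta>' \<zeta> - \<Phi> (F x) * \<beta>' x\<bar> < e / 2"
              by (intro d2(2) near mem \<open>s \<le> t\<close> order_refl)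
            moreover have "\<bar>\<Phi> (F \<tau>) * \<beta>' \<tau> - \<Phi> (F x) * \<beta>' x\<bar> < e / 2"
              by (intro d2(2) near mem)
            ultimately show ?thesis by linarith
          qed
          moreover have "\<phi> (F \<sigma>) * \<beta> t * g \<tau> + \<Phi> (F s) * \<beta>' \<zeta> - K \<tau>
              = (\<phi> (F \<sigma>) * \<beta> t - \<phi> (F \<tau>) * \<beta> \<tau>) * g \<tau> + (\<Phi> (F s) * \<beta>' \<zeta> - \<Phi> (F \<tau>) * \<beta>' \<tau>)"
            by (simp add: K_def algebra_simps)
          ultimately have "\<bar>\<phi> (F \<sigma>) * \<beta> t * g \<tau> + \<Phi> (F s) * \<beta>' \<zeta> - K \<tau>\<bar> \<le> e * \<bar>g \<tau>\<bar> + e"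
            by (simp only:) (intro order_trans[OF abs_triangle_ineq] add_mono order_refl,
                simp_all add: abs_mult mult_right_mono)
          then show ?thesis using True by (simp add: ring_distribs)
        qed simp
      qed (use igs cK cE in auto)
      also have "\<dots> = e * E s t" by (simp add: E_def)
      finally show "\<bar>H t - H s - (LINT \<tau>|lborel. indicator {s<..t} \<tau> * K \<tau>)\<bar> \<le> e * E s t"
        unfolding eq .
    qed (use d1 d2 in auto)
  qed
  have "E a b \<ge> 0" unfolding E_def by (intro integral_nonneg_AE AE_I2) (auto simp: indicator_def)
  have "\<bar>H b - H a - (LINT \<tau>|lborel. indicator {a<..b} \<tau> * K \<tau>)\<bar> \<le> 0"
  proof (rule field_le_epsilon)
    fix e :: real assume "e > 0"
    \<comment> \<open>Dividing by \<open>E a b + 1\<close> covers the case a = b, where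
      \<open>E a b\<close> is 0.\<close>
    then have "\<bar>H b - H a - (LINT \<tau>|lborel. indicator {a<..b} \<tau> * K \<tau>)\<bar> \<le> e / (E a b + 1) * E a b"
      using \<open>E a b \<ge> 0\<close> by (intro main) auto
    also have "\<dots> \<le> e" using \<open>e > 0\<close> \<open>E a b \<ge> 0\<close> by (simp add: field_simps)
    finally show "\<bar>H b - H a - (LINT \<tau>|lborel. indicator {a<..b} \<tau> * K \<tau>)\<bar> \<le> 0 + e" by simp
  qed
  then show ?thesis by (simp add: K_def H_def)
qed

section \<open>Antiderivatives and normalized bumps\<close>

lemma test_antiderivative:
  fixes \<gamma> :: "real \<Rightarrow> real"
  assumes "test_function S \<gamma>" "is_interval S" "S \<noteq> {}"
  obtains F a b where "a \<le> b" "{a..b} \<subseteq> S" "\<And>x. x \<notin> {a..b} \<Longrightarrow> \<gamma> x = 0" "smooth F"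
    "\<And>x. (F has_real_derivative \<gamma> x) (at x)"
    "\<And>x. x \<le> a \<Longrightarrow> F x = 0" "\<And>x. b \<le> x \<Longrightarrow> F x = (LINT x|lborel. \<gamma> x)"
proof -
  obtain a b where ab: "a \<le> b" "{a..b} \<subseteq> S" "\<And>x. x \<notin> {a..b} \<Longrightarrow> \<gamma> x = 0"
    using test_functionE[OF assms] by blast
  have cont: "isCont \<gamma> x" for x using test_DERIV[OF assms(1)] DERIV_isCont by blast
  have "\<exists>F. \<forall>x. - \<infinity> < ereal x \<longrightarrow> ereal x < \<infinity> \<longrightarrow> (F has_vector_derivative \<gamma> x) (at x)"
    by (rule einterval_antiderivative) (use cont in auto)
  then obtain F0 where "\<And>x. (F0 has_vector_derivative \<gamma> x) (at x)" by auto
  then have F0: "(F0 has_real_derivative \<gamma> x) (at x)" for x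
    by (simp add: has_real_derivative_iff_has_vector_derivative)
  define F where "F x = F0 x - F0 a" for x
  have F: "(F has_real_derivative \<gamma> x) (at x)" for x
    unfolding F_def using F0[of x] by (auto intro!: derivative_eq_intros)
  have smooth: "smooth F" by (rule smooth_antideriv[OF F test_smooth[OF assms(1)]])
  have left: "F x = 0" if "x \<le> a" for x
  proof (cases "x = a")
    case False
    then have "x < a" using that by simp
    obtain z where "x < z" "z < a" "F a - F x = (a - x) * \<gamma> z"
      using MVT2[OF \<open>x < a\<close> F] by blast
    then show ?thesis using ab(3)[of z] by (simp add: F_def)
  qed (simp add: F_def)
  have "(LINT x|lborel. indicator {a..b} x *\<^sub>R \<gamma> x) = F b - F a"
  proof (rule integral_FTC_atLeastAtMost[OF ab(1)])
    show "(F has_vector_derivative \<gamma> x) (at x within {a..b})" for x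
      using F[of x] has_vector_derivative_at_within
      by (auto simp: has_real_derivative_iff_has_vector_derivative)
    show "continuous_on {a..b} \<gamma>"
      by (rule continuous_at_imp_continuous_on) (use cont in auto)
  qed
  moreover have "(\<lambda>x. indicator {a..b} x *\<^sub>R \<gamma> x) = \<gamma>"
    using ab(3) by (auto simp: indicator_def fun_eq_iff)
  ultimately have Fb: "F b = (LINT x|lborel. \<gamma> x)" by (simp add: F_def)
  have right: "F x = (LINT x|lborel. \<gamma> x)" if "b \<le> x" for x
  proof (cases "x = b")
    case False
    then have "b < x" using that by simp
    obtain z where "b < z" "z < x" "F x - F b = (x - b) * \<gamma> z"
      using MVT2[OF \<open>b < x\<close> F] by blast
    then show ?thesis using ab(3)[of z] Fb by simp
  qed (simp add: Fb)
  show ?thesis by (rule that[OF ab smooth F left right])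
qed

text \<open>The antiderivative that vanishes left of the support equals the total integral to the
  right of it, so zero mean is what makes its support compact.\<close>

lemma test_antiderivative_zero_mean:
  fixes \<gamma> :: "real \<Rightarrow> real"
  assumes "test_function S \<gamma>" "is_interval S" "S \<noteq> {}" "(LINT x|lborel. \<gamma> x) = 0"
  obtains B where "test_function S B" "deriv B = \<gamma>"
proof -
  obtain F a b where F: "a \<le> b" "{a..b} \<subseteq> S" "smooth F" "\<And>x. (F has_real_derivative \<gamma> x) (at x)"
    "\<And>x. x \<le> a \<Longrightarrow> F x = 0" "\<And>x. b \<le> x \<Longrightarrow> F x = (LINT x|lborel. \<gamma> x)"
    using test_antiderivative[OF assms(1-3)] by metis
  have "test_function S F"
    by (rule test_functionI[OF F(3,2)]) (use F(5,6) assms(4) in force)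
  moreover have "deriv F = \<gamma>" using DERIV_imp_deriv[OF F(4)] by blast
  ultimately show ?thesis by (rule that)
qed

lemma unit_bump:
  assumes "a < (b::real)"
  obtains \<rho> where "test_function {a..b} \<rho>" "\<And>x. 0 \<le> \<rho> x" "\<And>x. x \<notin> {a<..<b} \<Longrightarrow> \<rho> x = 0" "(LINT x|lborel. \<rho> x) = 1"
proof -
  let ?I = "LINT x|lborel. bump a b x"
  have t: "test_function {a..b} (bump a b)" by (rule test_bump) auto
  have int: "integrable lborel (bump a b)" by (rule test_integrable[OF t])
  have "?I \<noteq> 0"
  proof
    assume "?I = 0"
    then have "AE x in lborel. bump a b x = 0"
      using integral_nonneg_eq_0_iff_AE[OF int] bump_nonneg by auto
    then have "AE x in lborel. x \<notin> {a<..<b}"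
      by eventually_elim (use bump_pos[of a _ b] in force)
    then have "emeasure lborel {a<..<b} = 0"
      using AE_iff_null_sets[of "{a<..<b}" lborel] by auto
    then show False using assms by simp
  qed
  moreover have "?I \<ge> 0" by (intro integral_nonneg_AE AE_I2 bump_nonneg)
  ultimately have pos: "?I > 0" by simp
  show ?thesis
  proof (rule that[of "\<lambda>x. bump a b x * (1 / ?I)"])
    show "test_function {a..b} (\<lambda>x. bump a b x * (1 / ?I))" by (intro test_mult_smooth t smooth_const)
    show "0 \<le> bump a b x * (1 / ?I)" for x using pos bump_nonneg[of a b x] by simp
    show "bump a b x * (1 / ?I) = 0" if "x \<notin> {a<..<b}" for x using bump_zero[OF that] by simp
    show "(LINT x|lborel. bump a b x * (1 / ?I)) = 1"
      using pos by (subst integral_mult_left_zero) simp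
  qed
qed

lemma test_Ioo_zero:
  fixes \<beta> :: "real \<Rightarrow> real"
  assumes "test_function {c<..<d} \<beta>" "t \<notin> {c<..<d}"
  shows "\<beta> t = 0" "deriv \<beta> t = 0"
proof -
  have *: "f t = 0" if "test_function {c<..<d} f" for f :: "real \<Rightarrow> real"
    using that assms(2) closure_subset[of "{x. f x \<noteq> 0}"] unfolding test_function_def by blast
  show "\<beta> t = 0" "deriv \<beta> t = 0" using *[OF assms(1)] *[OF test_deriv[OF assms(1)]] by auto
qed

section \<open>Weak derivatives on a rectangle\<close>

text \<open>A function with an integrable weak derivative in the second variable is, on almost every line,
  an indefinite integral: subtracting the integral of \<open>g\<close> leaves a function \<open>e\<close> annihilated by all
  \<open>\<alpha>(x) \<beta>'(t)\<close>, and \<open>\<beta> - (\<integral>\<beta>) \<beta>\<^sub>0\<close> is such a \<open>\<beta>'\<close>, so \<open>e\<close> equals its mean against \<open>\<beta>\<^sub>0\<close>.\<close>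

lemma weak_deriv_absolutely_continuous:
  fixes f g :: "real \<times> real \<Rightarrow> real"
  assumes f: "integrable lborel f" and g: "integrable lborel g" and cd: "c < d"
    and g0: "\<And>p. snd p \<notin> {c<..<d} \<Longrightarrow> g p = 0"
    and weak: "\<And>\<alpha> \<beta>. test_function {a<..<b} \<alpha> \<Longrightarrow> test_function {c<..<d} \<beta> \<Longrightarrow>
      (LINT p|lborel. f p * tens \<alpha> (deriv \<beta>) p) = - (LINT p|lborel. g p * tens \<alpha> \<beta> p)"
  obtains k where "AE x in lborel. integrable lborel (\<lambda>\<tau>. g (x, \<tau>)) \<and> (x \<in> {a<..<b} \<longrightarrow>
    (AE t in lborel. t \<in> {c<..<d} \<longrightarrow> f (x, t) = k x + (LINT \<tau>|lborel. indicator {..t} \<tau> * g (x, \<tau>))))"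
proof -
  have [measurable]: "f \<in> borel_measurable borel" "g \<in> borel_measurable borel" using f g by auto
  have [measurable]: "g \<in> borel_measurable (borel \<Otimes>\<^sub>M borel)" by (rule plane_measurable_Pair) simp
  \<comment> \<open>Since \<open>g\<close> vanishes below the strip, the integral effectively starts
    at c. The conditional under the integral sign gives joint measurability in both
    variables.\<close>
  define G where "G p = (LINT \<tau>|lborel. (if \<tau> \<le> snd p then g (fst p, \<tau>) else 0))" for p
  have G_eq: "G (x, t) = (LINT \<tau>|lborel. indicator {..t} \<tau> * g (x, \<tau>))" for x t
    unfolding G_def by (rule Bochner_Integration.integral_cong) auto
  have [measurable]: "G \<in> borel_measurable (borel \<Otimes>\<^sub>M borel)"
    unfolding G_def[abs_def] by measurable
  then have [measurable]: "G \<in> borel_measurable borel" by (simp add: borel_prod)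
  define n where "n x = (LINT \<tau>|lborel. \<bar>g (x, \<tau>)\<bar>)" for x
  have n: "integrable lborel n"
    unfolding n_def using plane_Fubini(2)[OF integrable_abs[OF g]] .
  then have [measurable]: "n \<in> borel_measurable borel" by auto
  have gx: "AE x in lborel. integrable lborel (\<lambda>\<tau>. g (x, \<tau>))" by (rule plane_Fubini(3)[OF g])
  have bound: "AE p in lborel \<Otimes>\<^sub>M lborel. \<bar>G p\<bar> \<le> n (fst p)"
  proof (rule lborel_pair.AE_pair_measure)
    show "{p \<in> space (lborel \<Otimes>\<^sub>M lborel). \<bar>G p\<bar> \<le> n (fst p)} \<in> sets (lborel \<Otimes>\<^sub>M lborel)" by measurable
    show "AE x in lborel. AE t in lborel. \<bar>G (x, t)\<bar> \<le> n (fst (x, t))"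
      using gx
    proof eventually_elim
      case (elim x)
      have "\<bar>G (x, t)\<bar> \<le> n x" for t
      proof -
        have "\<bar>G (x, t)\<bar> \<le> (LINT \<tau>|lborel. \<bar>indicator {..t} \<tau> * g (x, \<tau>)\<bar>)"
          unfolding G_eq by (rule integral_abs_bound)
        also have "\<dots> \<le> n x"
          unfolding n_def using integrable_abs[OF elim] integrable_mult_indicator[OF _ elim, of "{..t}"]
          by (intro integral_mono) (auto simp: indicator_def)
        finally show ?thesis .
      qed
      then show ?case by simp
    qed
  qed
  \<comment> \<open>The primitive \<open>G\<close> need not decay in t, so it is cut off to the
    strip; test functions supported there do not see the difference.\<close>
  define I where "I = (indicator {c<..<d} :: real \<Rightarrow> real)"
  have I: "integrable lborel I" unfolding I_def using cd by (intro integrable_real_indicator) auto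
  have [measurable]: "I \<in> borel_measurable borel" by (simp add: I_def)
  define GI where "GI p = I (snd p) * G p" for p
  have [measurable]: "(\<lambda>p. I (snd p)) \<in> borel_measurable (borel \<Otimes>\<^sub>M borel)" by measurable
  have "GI \<in> borel_measurable (borel \<Otimes>\<^sub>M borel)" unfolding GI_def[abs_def] by measurable
  then have [measurable]: "GI \<in> borel_measurable borel" by (simp add: borel_prod)
  have GI: "integrable lborel GI"
  proof (rule Bochner_Integration.integrable_bound[OF integrable_tens(1)[OF n I]])
    show "AE p in lborel. norm (GI p) \<le> norm (tens n I p)"
      using bound unfolding lborel_prod
      by eventually_elim (auto simp: GI_def tens_def I_def indicator_def)
  qed simp
  have weakG: "(LINT p|lborel. GI p * tens \<alpha> (deriv \<beta>) p) = - (LINT p|lborel. g p * tens \<alpha> \<beta> p)"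
    if \<alpha>: "test_function {a<..<b} \<alpha>" and \<beta>: "test_function {c<..<d} \<beta>" for \<alpha> \<beta>
  proof -
    have i1: "integrable lborel (\<lambda>p. GI p * tens \<alpha> (deriv \<beta>) p)"
      by (rule integrable_mult_tens[OF GI \<alpha> test_deriv[OF \<beta>]])
    have i2: "integrable lborel (\<lambda>p. g p * tens \<alpha> \<beta> p)"
      by (rule integrable_mult_tens[OF g \<alpha> \<beta>])
    have "(LINT p|lborel. GI p * tens \<alpha> (deriv \<beta>) p) + (LINT p|lborel. g p * tens \<alpha> \<beta> p)
      = (LINT p|lborel. GI p * tens \<alpha> (deriv \<beta>) p + g p * tens \<alpha> \<beta> p)"
      by (rule Bochner_Integration.integral_add[OF i1 i2, symmetric])
    also have "\<dots> = (LINT x|lborel. LINT t|lborel. GI (x, t) * tens \<alpha> (deriv \<beta>) (x, t) + g (x, t) * tens \<alpha> \<beta> (x, t))"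
      by (rule plane_Fubini(1)[OF Bochner_Integration.integrable_add[OF i1 i2]])
    also have "\<dots> = (LINT x|(lborel :: real measure). 0)"
    proof (rule integral_cong_AE)
      show "(\<lambda>x. LINT t|lborel. GI (x, t) * tens \<alpha> (deriv \<beta>) (x, t) + g (x, t) * tens \<alpha> \<beta> (x, t)) \<in> borel_measurable lborel"
        using plane_Fubini(2)[OF Bochner_Integration.integrable_add[OF i1 i2]] by auto
      show "AE x in lborel. (LINT t|lborel. GI (x, t) * tens \<alpha> (deriv \<beta>) (x, t) + g (x, t) * tens \<alpha> \<beta> (x, t)) = 0"
        using gx
      proof eventually_elim
        case (elim x)
        \<comment> \<open>Integration by parts on a single line, with the identity as outer
          function; the boundary terms vanish because \<beta> does at c and d.\<close>
        have "(LINT t|lborel. indicator {c<..d} t * (1 * \<beta> t * g (x, t) + (0 + (LINT \<tau>|lborel. indicator {..t} \<tau> * g (x, \<tau>))) * deriv \<beta> t))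
          = (0 + (LINT \<tau>|lborel. indicator {..d} \<tau> * g (x, \<tau>))) * \<beta> d - (0 + (LINT \<tau>|lborel. indicator {..c} \<tau> * g (x, \<tau>))) * \<beta> c"
          by (rule chain_rule_line[where \<Phi>="\<lambda>y. y" and \<phi>="\<lambda>_. 1"])
            (use elim cd test_DERIV[OF \<beta>] test_continuous[OF test_deriv[OF \<beta>]] in \<open>auto intro!: derivative_eq_intros\<close>)
        also have "\<dots> = 0" using test_Ioo_zero[OF \<beta>, of c] test_Ioo_zero[OF \<beta>, of d] by simp
        finally have 0: "(LINT t|lborel. \<alpha> x * (indicator {c<..d} t * (1 * \<beta> t * g (x, t) + (0 + (LINT \<tau>|lborel. indicator {..t} \<tau> * g (x, \<tau>))) * deriv \<beta> t))) = 0"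
          by (subst integral_mult_right_zero) simp
        have "GI (x, t) * tens \<alpha> (deriv \<beta>) (x, t) + g (x, t) * tens \<alpha> \<beta> (x, t)
          = \<alpha> x * (indicator {c<..d} t * (1 * \<beta> t * g (x, t) + (0 + (LINT \<tau>|lborel. indicator {..t} \<tau> * g (x, \<tau>))) * deriv \<beta> t))" for t
          using test_Ioo_zero[OF \<beta>, of t]
          by (auto simp: GI_def I_def tens_def G_eq algebra_simps indicator_def)
        then show ?case using 0 by simp
      qed
    qed simp
    finally show ?thesis by simp
  qed
  define e where "e p = f p - GI p" for p
  have e: "integrable lborel e" unfolding e_def using f GI by simp
  have [measurable]: "e \<in> borel_measurable borel" using e by auto
  have e_weak: "(LINT p|lborel. e p * tens \<alpha> (deriv \<beta>) p) = 0"
    if \<alpha>: "test_function {a<..<b} \<alpha>" and \<beta>: "test_function {c<..<d} \<beta>" for \<alpha> \<beta>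
  proof -
    have "(LINT p|lborel. e p * tens \<alpha> (deriv \<beta>) p)
        = (LINT p|lborel. f p * tens \<alpha> (deriv \<beta>) p - GI p * tens \<alpha> (deriv \<beta>) p)"
      by (simp only: e_def left_diff_distrib)
    also have "\<dots> = (LINT p|lborel. f p * tens \<alpha> (deriv \<beta>) p) - (LINT p|lborel. GI p * tens \<alpha> (deriv \<beta>) p)"
      by (rule Bochner_Integration.integral_diff[OF integrable_mult_tens[OF f \<alpha> test_deriv[OF \<beta>]]
        integrable_mult_tens[OF GI \<alpha> test_deriv[OF \<beta>]]])
    finally show ?thesis unfolding weakG[OF \<alpha> \<beta>] weak[OF \<alpha> \<beta>] by simp
  qed
  obtain \<beta>0 where \<beta>0: "test_function {c<..<d} \<beta>0" "(LINT t|lborel. \<beta>0 t) = 1"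
  proof -
    \<comment> \<open>The middle third of (c, d) keeps the support of \<open>\<beta>0\<close>
      compactly inside.\<close>
    have "(2 * c + d) / 3 < (c + 2 * d) / 3" using cd by simp
    then obtain \<rho> where \<rho>: "test_function {(2 * c + d) / 3..(c + 2 * d) / 3} \<rho>" "(LINT t|lborel. \<rho> t) = 1"
      using unit_bump by blast
    have "{(2 * c + d) / 3..(c + 2 * d) / 3} \<subseteq> {c<..<d}" using cd by auto
    from that[OF test_mono[OF \<rho>(1) this] \<rho>(2)] show ?thesis .
  qed
  define k where "k x = (LINT t|lborel. e (x, t) * \<beta>0 t)" for x
  obtain B0 where B0: "\<And>t. \<bar>\<beta>0 t\<bar> \<le> B0" using test_bounded[OF \<beta>0(1)] by blast
  have [measurable]: "\<beta>0 \<in> borel_measurable borel" using \<beta>0(1) by (rule test_borel)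
  have k: "integrable lborel k"
  proof -
    have "integrable lborel (\<lambda>p. e p * tens (\<lambda>_. 1) \<beta>0 p)"
    proof (rule integrable_mult_bounded[OF e])
      show "tens (\<lambda>_. 1) \<beta>0 \<in> borel_measurable lborel" by measurable
      show "\<bar>tens (\<lambda>_. 1) \<beta>0 p\<bar> \<le> B0" for p using B0 by (simp add: tens_def)
    qed
    from plane_Fubini(2)[OF this] show ?thesis by (simp add: k_def[abs_def] tens_def)
  qed
  \<comment> \<open>What remains of \<open>e\<close> after its mean \<open>k\<close> against
    \<open>\<beta>0\<close> has been subtracted on each line; the aim is that it vanishes on the
    rectangle.\<close>
  define r where "r p = e p - tens k I p" for p
  have r: "integrable lborel r" unfolding r_def by (intro Bochner_Integration.integrable_diff e integrable_tens k I)
  have r_weak: "(LINT p|lborel. r p * tens \<alpha> \<beta> p) = 0"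
    if \<alpha>: "test_function {a<..<b} \<alpha>" and \<beta>: "test_function {c<..<d} \<beta>" for \<alpha> \<beta>
  proof -
    define m where "m = (LINT t|lborel. \<beta> t)"
    have m\<beta>0: "test_function {c<..<d} (\<lambda>t. \<beta>0 t * m)" by (intro test_mult_smooth \<beta>0(1) smooth_const)
    have t: "test_function {c<..<d} (\<lambda>t. \<beta> t - \<beta>0 t * m)"
      by (intro test_diff \<beta> m\<beta>0)
    have "(LINT t|lborel. \<beta> t - \<beta>0 t * m) = 0"
      by (subst Bochner_Integration.integral_diff[OF test_integrable[OF \<beta>] test_integrable[OF m\<beta>0]])
        (simp add: \<beta>0(2) m_def)
    \<comment> \<open>Thus \<beta> = B' + m \<beta>0: the first summand is annihilated by
      \<open>e_weak\<close>, the second reproduces the mean \<open>k\<close>.\<close>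
    then obtain B where B: "test_function {c<..<d} B" "deriv B = (\<lambda>t. \<beta> t - \<beta>0 t * m)"
      using test_antiderivative_zero_mean[OF t] cd by auto
    have [measurable]: "\<alpha> \<in> borel_measurable borel" "\<beta> \<in> borel_measurable borel" using \<alpha> \<beta> by (auto intro: test_borel)
    have ia: "integrable lborel (\<lambda>x. k x * \<alpha> x)"
    proof -
      obtain A where "\<And>x. \<bar>\<alpha> x\<bar> \<le> A" using test_bounded[OF \<alpha>] by blast
      then show ?thesis by (intro integrable_mult_bounded k) auto
    qed
    have i1: "integrable lborel (\<lambda>p. e p * tens \<alpha> \<beta> p)" "integrable lborel (\<lambda>p. e p * tens \<alpha> (\<lambda>t. \<beta>0 t * m) p)"
      by (rule integrable_mult_tens[OF e \<alpha> \<beta>], rule integrable_mult_tens[OF e \<alpha> m\<beta>0])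
    have it: "integrable lborel (tens (\<lambda>x. k x * \<alpha> x) \<beta>)" by (intro integrable_tens ia test_integrable[OF \<beta>])
    have kI: "tens k I p * tens \<alpha> \<beta> p = tens (\<lambda>x. k x * \<alpha> x) \<beta> p" for p
      using test_Ioo_zero[OF \<beta>, of "snd p"] by (auto simp: tens_def I_def indicator_def)
    have "(LINT p|lborel. e p * tens \<alpha> (\<lambda>t. \<beta>0 t * m) p) = (LINT x|lborel. k x * \<alpha> x) * m"
    proof -
      have "(LINT p|lborel. e p * tens \<alpha> (\<lambda>t. \<beta>0 t * m) p)
          = (LINT x|lborel. LINT t|lborel. e (x, t) * tens \<alpha> (\<lambda>t. \<beta>0 t * m) (x, t))"
        by (rule plane_Fubini(1)[OF i1(2)])
      also have "\<dots> = (LINT x|lborel. k x * \<alpha> x * m)"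
        unfolding k_def by (simp add: tens_def flip: integral_mult_left_zero) (simp add: mult_ac)
      finally show ?thesis by simp
    qed
    then have "(LINT p|lborel. r p * tens \<alpha> \<beta> p)
        = (LINT p|lborel. e p * tens \<alpha> \<beta> p) - (LINT p|lborel. e p * tens \<alpha> (\<lambda>t. \<beta>0 t * m) p)"
      unfolding r_def left_diff_distrib kI
      by (subst Bochner_Integration.integral_diff[OF i1(1) it])
        (simp add: integrable_tens(2)[OF ia test_integrable[OF \<beta>]] m_def)
    also have "\<dots> = (LINT p|lborel. e p * tens \<alpha> (deriv B) p)"
      by (subst Bochner_Integration.integral_diff[OF i1, symmetric])
        (auto simp: B(2) tens_def algebra_simps)
    also have "\<dots> = 0" by (rule e_weak[OF \<alpha> B(1)])
    finally show ?thesis .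
  qed
  \<comment> \<open>A function orthogonal to all tensor products is nonnegative, and so is its
    negative.\<close>
  have "AE p in lborel. p \<in> box (a, c) (b, d) \<longrightarrow> 0 \<le> r p"
    by (rule AE_nonneg_rectangle[OF r]) (simp add: r_weak)
  moreover have "AE p in lborel. p \<in> box (a, c) (b, d) \<longrightarrow> 0 \<le> - r p"
    by (rule AE_nonneg_rectangle[OF integrable_minus[OF r]]) (simp add: r_weak)
  ultimately have "AE p in lborel. p \<in> box (a, c) (b, d) \<longrightarrow> r p = 0"
    by eventually_elim auto
  from plane_AE[OF this] gx
  have "AE x in lborel. integrable lborel (\<lambda>\<tau>. g (x, \<tau>)) \<and> (x \<in> {a<..<b} \<longrightarrow>
    (AE t in lborel. t \<in> {c<..<d} \<longrightarrow> f (x, t) = k x + (LINT \<tau>|lborel. indicator {..t} \<tau> * g (x, \<tau>))))"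
  proof eventually_elim
    case (elim x)
    have "AE t in lborel. t \<in> {c<..<d} \<longrightarrow> f (x, t) = k x + (LINT \<tau>|lborel. indicator {..t} \<tau> * g (x, \<tau>))" if "x \<in> {a<..<b}"
      using elim(1)
    proof eventually_elim
      case (elim t)
      then show ?case using that
        by (auto simp: mem_box_pair r_def e_def GI_def I_def tens_def G_eq)
    qed
    then show ?case using elim(2) by blast
  qed
  then show ?thesis by (rule that)
qed

text \<open>On almost every line \<open>f\<close> agrees with a primitive of \<open>g\<close>, so
  \<open>chain_rule_line\<close> applies there, and Fubini assembles the lines. Boundedness of
  \<open>f\<close> keeps \<Phi>(f) and \<phi>(f) bounded, hence all integrands integrable.\<close>

lemma chain_rule_rectangle:
  fixes f g :: "real \<times> real \<Rightarrow> real" and \<Phi> \<phi> :: "real \<Rightarrow> real"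
  assumes f: "integrable lborel f" and g: "integrable lborel g"
    and g0: "\<And>p. snd p \<notin> {c<..<d} \<Longrightarrow> g p = 0"
    and weak: "\<And>\<alpha> \<beta>. test_function {a<..<b} \<alpha> \<Longrightarrow> test_function {c<..<d} \<beta> \<Longrightarrow>
      (LINT p|lborel. f p * tens \<alpha> (deriv \<beta>) p) = - (LINT p|lborel. g p * tens \<alpha> \<beta> p)"
    and bounded: "\<And>p. \<bar>f p\<bar> \<le> M"
    and \<Phi>: "\<And>y. (\<Phi> has_real_derivative \<phi> y) (at y)" and \<phi>: "continuous_on UNIV \<phi>"
    and \<alpha>: "test_function {a<..<b} \<alpha>" and \<beta>: "test_function {c<..<d} \<beta>"
  shows "(LINT p|lborel. \<Phi> (f p) * tens \<alpha> (deriv \<beta>) p) = - (LINT p|lborel. \<phi> (f p) * g p * tens \<alpha> \<beta> p)"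
proof (cases "c < d")
  case False
  then have "\<beta> t = 0 \<and> deriv \<beta> t = 0" for t using test_Ioo_zero[OF \<beta>, of t] by auto
  then show ?thesis by (simp add: tens_def)
next
  case cd: True
  have [measurable]: "f \<in> borel_measurable borel" "g \<in> borel_measurable borel" using f g by auto
  have c\<Phi>: "continuous_on UNIV \<Phi>"
    using \<Phi> by (auto intro!: continuous_at_imp_continuous_on DERIV_isCont)
  have [measurable]: "\<Phi> \<in> borel_measurable borel" "\<phi> \<in> borel_measurable borel"
    using c\<Phi> \<phi> by (auto intro: borel_measurable_continuous_onI)
  have bd: "\<exists>B. \<forall>p. \<bar>u (f p)\<bar> \<le> B" if u: "continuous_on UNIV u" for u :: "real \<Rightarrow> real"
  proof -
    have "bounded (u ` {-M..M})"
      by (intro compact_imp_bounded compact_continuous_image continuous_on_subset[OF u]) auto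
    then obtain B where "\<forall>y\<in>{-M..M}. \<bar>u y\<bar> \<le> B" by (auto simp: bounded_iff)
    moreover have "f p \<in> {-M..M}" for p using bounded[of p] by auto
    ultimately show ?thesis by blast
  qed
  obtain B1 where B1: "\<And>p. \<bar>\<Phi> (f p)\<bar> \<le> B1" using bd[OF c\<Phi>] by blast
  obtain B2 where B2: "\<And>p. \<bar>\<phi> (f p)\<bar> \<le> B2" using bd[OF \<phi>] by blast
  have i1: "integrable lborel (\<lambda>p. \<Phi> (f p) * tens \<alpha> (deriv \<beta>) p)"
    using integrable_mult_bounded[OF integrable_tens(1)[OF test_integrable[OF \<alpha>] test_integrable[OF test_deriv[OF \<beta>]]] _ B1]
    by (simp add: mult.commute)
  have "integrable lborel (\<lambda>p. \<phi> (f p) * g p)"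
    using integrable_mult_bounded[OF g _ B2] by (simp add: mult.commute)
  then have i2: "integrable lborel (\<lambda>p. \<phi> (f p) * g p * tens \<alpha> \<beta> p)"
    by (rule integrable_mult_tens[OF _ \<alpha> \<beta>])
  obtain k where k: "AE x in lborel. integrable lborel (\<lambda>\<tau>. g (x, \<tau>)) \<and> (x \<in> {a<..<b} \<longrightarrow>
    (AE t in lborel. t \<in> {c<..<d} \<longrightarrow> f (x, t) = k x + (LINT \<tau>|lborel. indicator {..t} \<tau> * g (x, \<tau>))))"
    using weak_deriv_absolutely_continuous[OF f g cd g0 weak] by blast
  have "(LINT p|lborel. \<Phi> (f p) * tens \<alpha> (deriv \<beta>) p) + (LINT p|lborel. \<phi> (f p) * g p * tens \<alpha> \<beta> p)
      = (LINT p|lborel. \<Phi> (f p) * tens \<alpha> (deriv \<beta>) p + \<phi> (f p) * g p * tens \<alpha> \<beta> p)"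
    by (rule Bochner_Integration.integral_add[OF i1 i2, symmetric])
  also have "\<dots> = (LINT x|lborel. LINT t|lborel. \<Phi> (f (x, t)) * tens \<alpha> (deriv \<beta>) (x, t) + \<phi> (f (x, t)) * g (x, t) * tens \<alpha> \<beta> (x, t))"
    by (rule plane_Fubini(1)[OF Bochner_Integration.integrable_add[OF i1 i2]])
  also have "\<dots> = (LINT x|(lborel :: real measure). 0)"
  proof (rule integral_cong_AE)
    show "(\<lambda>x. LINT t|lborel. \<Phi> (f (x, t)) * tens \<alpha> (deriv \<beta>) (x, t) + \<phi> (f (x, t)) * g (x, t) * tens \<alpha> \<beta> (x, t)) \<in> borel_measurable lborel"
      using plane_Fubini(2)[OF Bochner_Integration.integrable_add[OF i1 i2]] by auto
    show "AE x in lborel. (LINT t|lborel. \<Phi> (f (x, t)) * tens \<alpha> (deriv \<beta>) (x, t) + \<phi> (f (x, t)) * g (x, t) * tens \<alpha> \<beta> (x, t)) = 0"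
      using k
    proof eventually_elim
      case (elim x)
      show ?case
      proof (cases "x \<in> {a<..<b}")
        case False
        then show ?thesis using test_Ioo_zero[OF \<alpha> False] by (simp add: tens_def)
      next
        case True
        define F where "F t = k x + (LINT \<tau>|lborel. indicator {..t} \<tau> * g (x, \<tau>))" for t
        have gx: "integrable lborel (\<lambda>\<tau>. g (x, \<tau>))"
          and fF: "AE t in lborel. t \<in> {c<..<d} \<longrightarrow> f (x, t) = F t" using elim True by (auto simp: F_def)
        have [measurable]: "F \<in> borel_measurable borel"
          unfolding F_def
          by (intro borel_measurable_continuous_onI continuous_intros continuous_indefinite_integral gx)
        have [measurable]: "(\<lambda>t. f (x, t)) \<in> borel_measurable borel" "(\<lambda>t. g (x, t)) \<in> borel_measurable borel"
          by (simp_all add: borel_measurable_curry)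
        have [measurable]: "\<beta> \<in> borel_measurable borel" "deriv \<beta> \<in> borel_measurable borel"
          using \<beta> test_deriv test_borel by blast+
        have "(LINT t|lborel. indicator {c<..d} t * (\<phi> (F t) * \<beta> t * g (x, t) + \<Phi> (F t) * deriv \<beta> t))
          = \<Phi> (F d) * \<beta> d - \<Phi> (F c) * \<beta> c"
          unfolding F_def
          by (rule chain_rule_line[OF gx \<Phi> \<phi> test_DERIV[OF \<beta>] test_continuous[OF test_deriv[OF \<beta>]]])
            (use cd in auto)
        also have "\<dots> = 0" using test_Ioo_zero[OF \<beta>, of c] test_Ioo_zero[OF \<beta>, of d] by simp
        finally have 0: "(LINT t|lborel. \<alpha> x * (indicator {c<..d} t * (\<phi> (F t) * \<beta> t * g (x, t) + \<Phi> (F t) * deriv \<beta> t))) = 0"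
          by (subst integral_mult_right_zero) simp
        have "(LINT t|lborel. \<Phi> (f (x, t)) * tens \<alpha> (deriv \<beta>) (x, t) + \<phi> (f (x, t)) * g (x, t) * tens \<alpha> \<beta> (x, t))
          = (LINT t|lborel. \<alpha> x * (indicator {c<..d} t * (\<phi> (F t) * \<beta> t * g (x, t) + \<Phi> (F t) * deriv \<beta> t)))"
        proof (rule integral_cong_AE)
          show "AE t in lborel. \<Phi> (f (x, t)) * tens \<alpha> (deriv \<beta>) (x, t) + \<phi> (f (x, t)) * g (x, t) * tens \<alpha> \<beta> (x, t)
            = \<alpha> x * (indicator {c<..d} t * (\<phi> (F t) * \<beta> t * g (x, t) + \<Phi> (F t) * deriv \<beta> t))"
            using fF
          proof eventually_elim
            case (elim t)
            then show ?case using test_Ioo_zero[OF \<beta>, of t]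
              by (cases "t \<in> {c<..<d}") (auto simp: tens_def algebra_simps)
          qed
        qed (simp_all add: tens_def)
        then show ?thesis using 0 by simp
      qed
    qed
  qed simp
  finally show ?thesis by simp
qed

section \<open>Weak derivatives on the half-plane\<close>

text \<open>Boxes at positive height have compact closure in the open half-plane, so nothing is
  asked near t = 0. A Borel function on the whole plane avoids restricted measure spaces.\<close>

definition loc_int :: "(real \<times> real \<Rightarrow> real) \<Rightarrow> bool" where
  "loc_int f \<longleftrightarrow> f \<in> borel_measurable borel \<and>
    (\<forall>a b c d. 0 < c \<longrightarrow> integrable lborel (\<lambda>p. indicator (box (a, c) (b, d)) p * f p))"

text \<open>Tensor products are all that later arguments test with; the integrals may run over the
  whole plane because \<beta> vanishes for t \<le> 0.\<close>

definition weak_t :: "(real \<times> real \<Rightarrow> real) \<Rightarrow> (real \<times> real \<Rightarrow> real) \<Rightarrow> bool" where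
  "weak_t f g \<longleftrightarrow> (\<forall>\<alpha> \<beta>. test_function UNIV \<alpha> \<longrightarrow> test_function {0<..} \<beta> \<longrightarrow>
    (LINT p|lborel. f p * tens \<alpha> (deriv \<beta>) p) = - (LINT p|lborel. g p * tens \<alpha> \<beta> p))"

definition weak_x :: "(real \<times> real \<Rightarrow> real) \<Rightarrow> (real \<times> real \<Rightarrow> real) \<Rightarrow> bool" where
  "weak_x f g \<longleftrightarrow> (\<forall>\<alpha> \<beta>. test_function UNIV \<alpha> \<longrightarrow> test_function {0<..} \<beta> \<longrightarrow>
    (LINT p|lborel. f p * tens (deriv \<alpha>) \<beta> p) = - (LINT p|lborel. g p * tens \<alpha> \<beta> p))"

lemma test_enlarge_UNIV:
  fixes \<alpha> :: "real \<Rightarrow> real"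
  assumes "test_function UNIV \<alpha>"
  obtains a b where "a < b" "test_function {a<..<b} \<alpha>"
proof -
  obtain a b where ab: "a \<le> b" "\<And>x. x \<notin> {a..b} \<Longrightarrow> \<alpha> x = 0"
    using test_functionE[OF assms] by auto
  have "test_function {a - 1<..<b + 1} \<alpha>"
    by (rule test_functionI[OF test_smooth[OF assms] _ ab(2)]) auto
  then show ?thesis using ab(1) by (intro that[of "a - 1" "b + 1"]) auto
qed

lemma test_enlarge_pos:
  fixes \<beta> :: "real \<Rightarrow> real"
  assumes "test_function {0<..} \<beta>"
  obtains c d where "0 < c" "c < d" "test_function {c<..<d} \<beta>"
proof -
  obtain a b where ab: "a \<le> b" "{a..b} \<subseteq> {0<..}" "\<And>x. x \<notin> {a..b} \<Longrightarrow> \<beta> x = 0"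
    using test_functionE[OF assms] by (auto simp: is_interval_1)
  have "a > 0" using ab(1,2) by auto
  have "test_function {a / 2<..<b + 1} \<beta>"
    by (rule test_functionI[OF test_smooth[OF assms] _ ab(3)]) (use \<open>a > 0\<close> in auto)
  then show ?thesis using ab(1) \<open>a > 0\<close> by (intro that[of "a / 2" "b + 1"]) auto
qed

lemma tens_outside:
  assumes "test_function {a<..<b} \<alpha>" "test_function {c<..<d} \<beta>" "p \<notin> box (a, c) (b, d)"
  shows "tens \<alpha> \<beta> p = 0"
  using assms test_Ioo_zero(1) by (auto simp: mem_box_pair tens_def)

lemma indicator_mult_tens:
  assumes "test_function {a<..<b} \<alpha>" "test_function {c<..<d} \<beta>"
  shows "indicator (box (a, c) (b, d)) p * f p * tens \<alpha> \<beta> p = f p * tens \<alpha> \<beta> p"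
  using tens_outside[OF assms] by (cases "p \<in> box (a, c) (b, d)") auto

lemma loc_int_mult_tens:
  assumes "loc_int f" "test_function UNIV \<alpha>" "test_function {0<..} \<beta>"
  shows "integrable lborel (\<lambda>p. f p * tens \<alpha> \<beta> p)"
proof -
  obtain a b where ab: "test_function {a<..<b} \<alpha>" using test_enlarge_UNIV[OF assms(2)] by blast
  obtain c d where cd: "0 < c" "test_function {c<..<d} \<beta>" using test_enlarge_pos[OF assms(3)] by blast
  have "integrable lborel (\<lambda>p. indicator (box (a, c) (b, d)) p * f p)"
    using assms(1) cd(1) by (auto simp: loc_int_def)
  from integrable_mult_tens[OF this ab cd(2)] show ?thesis
    by (simp only: indicator_mult_tens[OF ab cd(2)])
qed

lemma bounded_mult_tens:
  assumes "u \<in> borel_measurable borel" "\<And>p. \<bar>u p\<bar> \<le> B" "test_function S \<alpha>" "test_function T \<beta>"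
  shows "integrable lborel (\<lambda>p. u p * tens \<alpha> \<beta> p)"
  using integrable_mult_bounded[OF integrable_tens(1)[OF test_integrable[OF assms(3)] test_integrable[OF assms(4)]], of u B]
    assms(1,2) by (simp add: mult.commute)

lemma loc_int_bounded_mult:
  assumes "loc_int f" "u \<in> borel_measurable borel" "\<And>p. \<bar>u p\<bar> \<le> B"
  shows "loc_int (\<lambda>p. u p * f p)"
  unfolding loc_int_def
proof (intro conjI allI impI)
  have [measurable]: "f \<in> borel_measurable borel" "u \<in> borel_measurable borel" using assms by (auto simp: loc_int_def)
  show "(\<lambda>p. u p * f p) \<in> borel_measurable borel" by measurable
  fix a b c d :: real assume "0 < c"
  then have "integrable lborel (\<lambda>p. indicator (box (a, c) (b, d)) p * f p)"
    using assms(1) by (auto simp: loc_int_def)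
  then have "integrable lborel (\<lambda>p. indicator (box (a, c) (b, d)) p * f p * u p)"
    by (rule integrable_mult_bounded) (use assms in auto)
  then show "integrable lborel (\<lambda>p. indicator (box (a, c) (b, d)) p * (u p * f p))"
    by (simp add: mult_ac)
qed

lemma loc_int_add: "loc_int f \<Longrightarrow> loc_int g \<Longrightarrow> loc_int (\<lambda>p. f p + g p)"
  by (auto simp: loc_int_def ring_distribs)

lemma loc_int_scale: "loc_int f \<Longrightarrow> loc_int (\<lambda>p. k * f p)"
  using loc_int_bounded_mult[of f "\<lambda>_. k" "\<bar>k\<bar>"] by simp

lemma loc_int_diff: "loc_int f \<Longrightarrow> loc_int g \<Longrightarrow> loc_int (\<lambda>p. f p - g p)"
  using loc_int_add[OF _ loc_int_scale[of g "-1"], of f] by simp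

lemma loc_int_const: "loc_int (\<lambda>p. k)"
  unfolding loc_int_def
proof (intro conjI allI impI)
  fix a b c d :: real
  have "emeasure lborel (box (a, c) (b, d)) < \<infinity>" by (simp add: emeasure_lborel_box_eq)
  then have "integrable lborel (indicator (box (a, c) (b, d)) :: real \<times> real \<Rightarrow> real)"
    by (intro integrable_real_indicator) auto
  then show "integrable lborel (\<lambda>p. indicator (box (a, c) (b, d)) p * k)" by simp
qed simp

lemma loc_int_bounded:
  assumes "u \<in> borel_measurable borel" "\<And>p. \<bar>u p\<bar> \<le> B" shows "loc_int u"
  using loc_int_bounded_mult[OF loc_int_const[of 1] assms] by simp

text \<open>The half-plane is exhausted by countably many boxes on which \<open>f\<close> is
  integrable.\<close>

lemma AE_nonneg_halfplane:
  assumes f: "loc_int f"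
    and pos: "\<And>\<alpha> \<beta>. test_function UNIV \<alpha> \<Longrightarrow> test_function {0<..} \<beta> \<Longrightarrow>
        (\<forall>x. 0 \<le> \<alpha> x) \<Longrightarrow> (\<forall>t. 0 \<le> \<beta> t) \<Longrightarrow> 0 \<le> (LINT p|lborel. f p * tens \<alpha> \<beta> p)"
  shows "AE p in lborel. 0 < snd p \<longrightarrow> 0 \<le> f p"
proof -
  let ?Q = "\<lambda>n::nat. box (- real n, 1 / (real n + 1)) (real n, real n)"
  have "AE p in lborel. p \<in> ?Q n \<longrightarrow> 0 \<le> indicator (?Q n) p * f p" for n
  proof (rule AE_nonneg_rectangle)
    show "integrable lborel (\<lambda>p. indicator (?Q n) p * f p)" using f by (auto simp: loc_int_def)
    fix \<alpha> \<beta> assume t: "test_function {- real n<..<real n} \<alpha>" "test_function {1 / (real n + 1)<..<real n} \<beta>"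
      and nonneg: "\<forall>x. 0 \<le> \<alpha> x" "\<forall>t. 0 \<le> \<beta> t"
    have "{1 / (real n + 1)<..<real n} \<subseteq> {0<..}"
      by (auto intro: less_trans[of 0 "1 / (real n + 1)"])
    then show "0 \<le> (LINT p|lborel. indicator (?Q n) p * f p * tens \<alpha> \<beta> p)"
      unfolding indicator_mult_tens[OF t]
      using t nonneg by (intro pos) (auto intro: test_mono)
  qed
  then have "AE p in lborel. \<forall>n. p \<in> ?Q n \<longrightarrow> 0 \<le> indicator (?Q n) p * f p"
    by (simp only: AE_all_countable) blast
  then show ?thesis
  proof eventually_elim
    case (elim p)
    show ?case
    proof
      assume "0 < snd p"
      obtain n1 :: nat where n1: "1 / snd p < real n1" using reals_Archimedean2 by blast
      obtain n2 :: nat where n2: "\<bar>fst p\<bar> + \<bar>snd p\<bar> < real n2" using reals_Archimedean2 by blast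
      define n where "n = max n1 n2"
      have "1 / snd p < real n + 1" "\<bar>fst p\<bar> + \<bar>snd p\<bar> < real n" using n1 n2 by (auto simp: n_def)
      then have "p \<in> ?Q n" using \<open>0 < snd p\<close>
        by (auto simp: mem_box_pair field_simps)
      with elim show "0 \<le> f p" by (auto dest: spec[of _ n])
    qed
  qed
qed

text \<open>Cutting \<open>f\<close> and \<open>g\<close> off outside a box that contains the
  support of the test function makes them integrable over the plane. The jumps so created are
  harmless, since the rectangle version tests only inside that box.\<close>

lemma chain_rule_t:
  fixes \<Phi> \<phi> :: "real \<Rightarrow> real"
  assumes fg: "weak_t f g" and f: "f \<in> borel_measurable borel" "\<And>p. \<bar>f p\<bar> \<le> M" and g: "loc_int g"
    and \<Phi>: "\<And>y. (\<Phi> has_real_derivative \<phi> y) (at y)" and \<phi>: "continuous_on UNIV \<phi>"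
  shows "weak_t (\<lambda>p. \<Phi> (f p)) (\<lambda>p. \<phi> (f p) * g p)"
  unfolding weak_t_def
proof (intro allI impI)
  fix \<alpha> \<beta> :: "real \<Rightarrow> real" assume \<alpha>: "test_function UNIV \<alpha>" and \<beta>: "test_function {0<..} \<beta>"
  obtain a b where a: "test_function {a<..<b} \<alpha>" using test_enlarge_UNIV[OF \<alpha>] by blast
  obtain c d where c: "0 < c" "c < d" and b: "test_function {c<..<d} \<beta>" using test_enlarge_pos[OF \<beta>] by blast
  have cpos: "{c<..<d} \<subseteq> {0<..}" using c(1) by auto
  let ?Q = "box (a, c) (b, d)"
  have "M \<ge> 0" using order_trans[OF abs_ge_zero f(2)] .
  have *: "(LINT p|lborel. \<Phi> (indicator ?Q p * f p) * tens \<alpha> (deriv \<beta>) p)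
      = - (LINT p|lborel. \<phi> (indicator ?Q p * f p) * (indicator ?Q p * g p) * tens \<alpha> \<beta> p)"
  proof (rule chain_rule_rectangle[OF _ _ _ _ _ \<Phi> \<phi> a b])
    show "integrable lborel (\<lambda>p. indicator ?Q p * f p)" "integrable lborel (\<lambda>p. indicator ?Q p * g p)"
      using loc_int_bounded[OF f] g c(1) by (auto simp: loc_int_def)
    show "indicator ?Q p * g p = 0" if "snd p \<notin> {c<..<d}" for p
      using that by (auto simp: indicator_def mem_box_pair)
    show "\<bar>indicator ?Q p * f p\<bar> \<le> M" for p
      using f(2)[of p] \<open>M \<ge> 0\<close> by (auto simp: indicator_def)
    fix \<alpha>' \<beta>' assume t: "test_function {a<..<b} \<alpha>'" "test_function {c<..<d} \<beta>'"
    have "test_function UNIV \<alpha>'" "test_function {0<..} \<beta>'"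
      using test_mono[OF t(1), of UNIV] test_mono[OF t(2) cpos] by auto
    then show "(LINT p|lborel. indicator ?Q p * f p * tens \<alpha>' (deriv \<beta>') p)
        = - (LINT p|lborel. indicator ?Q p * g p * tens \<alpha>' \<beta>' p)"
      using fg unfolding indicator_mult_tens[OF t] indicator_mult_tens[OF t(1) test_deriv[OF t(2)]]
      by (auto simp: weak_t_def)
  qed
  \<comment> \<open>Outside the box the argument of \<Phi> is 0, and \<Phi> 0 need not vanish; the
    test function does.\<close>
  have 1: "\<Phi> (indicator ?Q p * f p) * tens \<alpha> (deriv \<beta>) p = \<Phi> (f p) * tens \<alpha> (deriv \<beta>) p" for p
    using tens_outside[OF a test_deriv[OF b], of p] by (cases "p \<in> ?Q") auto
  have 2: "\<phi> (indicator ?Q p * f p) * (indicator ?Q p * g p) * tens \<alpha> \<beta> p = \<phi> (f p) * g p * tens \<alpha> \<beta> p" for p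
    using tens_outside[OF a b, of p] by (cases "p \<in> ?Q") auto
  show "(LINT p|lborel. \<Phi> (f p) * tens \<alpha> (deriv \<beta>) p) = - (LINT p|lborel. \<phi> (f p) * g p * tens \<alpha> \<beta> p)"
    using * by (simp only: 1 2)
qed

lemma tens_swap: "tens \<alpha> \<beta> (prod.swap p) = tens \<beta> \<alpha> p"
  by (simp add: tens_def mult.commute)

text \<open>The rectangle version differentiates in the second variable, so the coordinates are
  interchanged before and after its use.\<close>

lemma chain_rule_x:
  fixes \<Phi> \<phi> :: "real \<Rightarrow> real"
  assumes fg: "weak_x f g" and f: "f \<in> borel_measurable borel" "\<And>p. \<bar>f p\<bar> \<le> M" and g: "loc_int g"
    and \<Phi>: "\<And>y. (\<Phi> has_real_derivative \<phi> y) (at y)" and \<phi>: "continuous_on UNIV \<phi>"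
  shows "weak_x (\<lambda>p. \<Phi> (f p)) (\<lambda>p. \<phi> (f p) * g p)"
  unfolding weak_x_def
proof (intro allI impI)
  fix \<alpha> \<beta> :: "real \<Rightarrow> real" assume \<alpha>: "test_function UNIV \<alpha>" and \<beta>: "test_function {0<..} \<beta>"
  obtain a b where a: "test_function {a<..<b} \<alpha>" using test_enlarge_UNIV[OF \<alpha>] by blast
  obtain c d where c: "0 < c" "c < d" and b: "test_function {c<..<d} \<beta>" using test_enlarge_pos[OF \<beta>] by blast
  have cpos: "{c<..<d} \<subseteq> {0<..}" using c(1) by auto
  let ?Q = "box (a, c) (b, d)"
  have "M \<ge> 0" using order_trans[OF abs_ge_zero f(2)] .
  have [measurable]: "f \<in> borel_measurable borel" "g \<in> borel_measurable borel"
    "tens \<alpha> \<beta> \<in> borel_measurable borel" "tens (deriv \<alpha>) \<beta> \<in> borel_measurable borel"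
    using f(1) g test_borel[OF \<alpha>] test_borel[OF \<beta>] test_borel[OF test_deriv[OF \<alpha>]]
    by (auto simp: loc_int_def)
  have [measurable]: "\<Phi> \<in> borel_measurable borel" "\<phi> \<in> borel_measurable borel"
    using \<Phi> \<phi> by (auto intro!: borel_measurable_continuous_onI continuous_at_imp_continuous_on DERIV_isCont)
  define f' g' where "f' p = indicator ?Q p * f p" and "g' p = indicator ?Q p * g p" for p
  have [measurable]: "f' \<in> borel_measurable borel" "g' \<in> borel_measurable borel"
    unfolding f'_def[abs_def] g'_def[abs_def] by measurable
  have *: "(LINT p|lborel. \<Phi> (f' (prod.swap p)) * tens \<beta> (deriv \<alpha>) p)
      = - (LINT p|lborel. \<phi> (f' (prod.swap p)) * g' (prod.swap p) * tens \<beta> \<alpha> p)"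
  proof (rule chain_rule_rectangle[OF _ _ _ _ _ \<Phi> \<phi> b a])
    have "integrable lborel f'" "integrable lborel g'"
      using loc_int_bounded[OF f] g c(1) by (auto simp: loc_int_def f'_def[abs_def] g'_def[abs_def])
    then show "integrable lborel (\<lambda>p. f' (prod.swap p))" "integrable lborel (\<lambda>p. g' (prod.swap p))"
      by (simp_all only: plane_swap(2)[of f'] plane_swap(2)[of g'] \<open>f' \<in> _\<close> \<open>g' \<in> _\<close>)
    show "g' (prod.swap p) = 0" if "snd p \<notin> {a<..<b}" for p
      using that by (auto simp: g'_def indicator_def mem_box_pair)
    show "\<bar>f' (prod.swap p)\<bar> \<le> M" for p
      using f(2)[of "prod.swap p"] \<open>M \<ge> 0\<close> by (auto simp: f'_def indicator_def)
    fix \<beta>' \<alpha>' assume t: "test_function {c<..<d} \<beta>'" "test_function {a<..<b} \<alpha>'"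
    have u: "test_function UNIV \<alpha>'" "test_function {0<..} \<beta>'"
      using test_mono[OF t(2), of UNIV] test_mono[OF t(1) cpos] by auto
    have m: "tens \<alpha>' \<beta>' \<in> borel_measurable borel" "tens (deriv \<alpha>') \<beta>' \<in> borel_measurable borel"
      using test_borel[OF u(1)] test_borel[OF u(2)] test_borel[OF test_deriv[OF u(1)]] by auto
    have "(LINT p|lborel. f' (prod.swap p) * tens \<beta>' (deriv \<alpha>') p) = (LINT p|lborel. f' p * tens (deriv \<alpha>') \<beta>' p)"
      using plane_swap(1)[of "\<lambda>p. f' p * tens (deriv \<alpha>') \<beta>' p"] m by (simp add: tens_swap)
    also have "\<dots> = (LINT p|lborel. f p * tens (deriv \<alpha>') \<beta>' p)"
      unfolding f'_def indicator_mult_tens[OF test_deriv[OF t(2)] t(1)] ..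
    also have "\<dots> = - (LINT p|lborel. g p * tens \<alpha>' \<beta>' p)"
      using fg u by (auto simp: weak_x_def)
    also have "\<dots> = - (LINT p|lborel. g' p * tens \<alpha>' \<beta>' p)"
      unfolding g'_def indicator_mult_tens[OF t(2) t(1)] ..
    also have "\<dots> = - (LINT p|lborel. g' (prod.swap p) * tens \<beta>' \<alpha>' p)"
      using plane_swap(1)[of "\<lambda>p. g' p * tens \<alpha>' \<beta>' p"] m by (simp add: tens_swap)
    finally show "(LINT p|lborel. f' (prod.swap p) * tens \<beta>' (deriv \<alpha>') p)
        = - (LINT p|lborel. g' (prod.swap p) * tens \<beta>' \<alpha>' p)" .
  qed
  have 1: "\<Phi> (f' p) * tens (deriv \<alpha>) \<beta> p = \<Phi> (f p) * tens (deriv \<alpha>) \<beta> p" for p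
    using tens_outside[OF test_deriv[OF a] b, of p] by (cases "p \<in> ?Q") (auto simp: f'_def)
  have 2: "\<phi> (f' p) * g' p * tens \<alpha> \<beta> p = \<phi> (f p) * g p * tens \<alpha> \<beta> p" for p
    using tens_outside[OF a b, of p] by (cases "p \<in> ?Q") (auto simp: f'_def g'_def)
  have "(LINT p|lborel. \<Phi> (f p) * tens (deriv \<alpha>) \<beta> p) = (LINT p|lborel. \<Phi> (f' p) * tens (deriv \<alpha>) \<beta> p)"
    by (simp only: 1)
  also have "\<dots> = (LINT p|lborel. \<Phi> (f' (prod.swap p)) * tens \<beta> (deriv \<alpha>) p)"
    using plane_swap(1)[of "\<lambda>p. \<Phi> (f' p) * tens (deriv \<alpha>) \<beta> p"] by (simp add: tens_swap)
  also note *
  also have "(LINT p|lborel. \<phi> (f' (prod.swap p)) * g' (prod.swap p) * tens \<beta> \<alpha> p)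
      = (LINT p|lborel. \<phi> (f' p) * g' p * tens \<alpha> \<beta> p)"
    using plane_swap(1)[of "\<lambda>p. \<phi> (f' p) * g' p * tens \<alpha> \<beta> p"] by (simp add: tens_swap)
  finally show "(LINT p|lborel. \<Phi> (f p) * tens (deriv \<alpha>) \<beta> p) = - (LINT p|lborel. \<phi> (f p) * g p * tens \<alpha> \<beta> p)"
    by (simp only: 2)
qed

section \<open>Auxiliary functions of time\<close>

text \<open>The chain rule asks for a C^1 function on the whole line, so y^r is extended by 0 to
  negative y; r > 1 keeps the extension C^1.\<close>

lemma max_powr_DERIV:
  assumes "1 < (r::real)"
  shows "((\<lambda>y. max 0 y powr r) has_real_derivative r * max 0 y powr (r - 1)) (at y)"
    and "continuous_on UNIV (\<lambda>y::real. r * max 0 y powr (r - 1))"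
proof -
  show cont: "continuous_on UNIV (\<lambda>y::real. r * max 0 y powr (r - 1))"
    using assms by (intro continuous_intros continuous_on_powr') auto
  show "((\<lambda>y. max 0 y powr r) has_real_derivative r * max 0 y powr (r - 1)) (at y)"
  proof (cases y "0 :: real" rule: linorder_cases)
    case less
    have "((\<lambda>y. 0) has_real_derivative 0) (at y)" by simp
    then have "((\<lambda>y. max 0 y powr r) has_real_derivative 0) (at y)"
      by (rule has_field_derivative_transform_within_open[of _ _ _ "{..<0}"]) (use less in \<open>auto simp: max_def\<close>)
    then show ?thesis using less by (simp add: max_def)
  next
    case greater
    have "((\<lambda>y. y powr r) has_real_derivative r * y powr (r - 1)) (at y)"
      using greater by (rule has_real_derivative_powr)
    then have "((\<lambda>y. max 0 y powr r) has_real_derivative r * y powr (r - 1)) (at y)"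
      by (rule has_field_derivative_transform_within_open[of _ _ _ "{0<..}"]) (use greater in \<open>auto simp: max_def\<close>)
    then show ?thesis using greater by (simp add: max_def)
  next
    case equal
    have "isCont (\<lambda>h::real. r * max 0 h powr (r - 1)) 0"
      using cont by (simp add: continuous_on_eq_continuous_at)
    then have "((\<lambda>h. r * max 0 h powr (r - 1)) \<longlongrightarrow> 0) (at 0)" by (simp add: isCont_def)
    then have "((\<lambda>h. (1 / r) * (r * max 0 h powr (r - 1))) \<longlongrightarrow> 0) (at 0)"
      by (rule tendsto_mult_right_zero)
    \<comment> \<open>At 0 the difference quotient is the claimed derivative divided by r, so its
      limit follows from the continuity already shown.\<close>
    moreover have "(1 / r) * (r * max 0 h powr (r - 1)) = (max 0 (0 + h) powr r - max 0 0 powr r) / h" for h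
      using assms by (cases "h > 0") (auto simp: powr_diff max_def)
    ultimately have "((\<lambda>h. (max 0 (0 + h) powr r - max 0 0 powr r) / h) \<longlongrightarrow> 0) (at 0)"
      by simp
    then show ?thesis using equal by (simp add: DERIV_def)
  qed
qed

text \<open>Rescalings of one smooth step that rises within [1, 2]. Its monotonicity later gives the
  boundary term at t = 0 a sign.\<close>

lemma cutoff_sequence:
  obtains \<eta> :: "nat \<Rightarrow> real \<Rightarrow> real" where "\<And>n. smooth (\<eta> n)" "\<And>n t. 0 \<le> \<eta> n t" "\<And>n t. \<eta> n t \<le> 1"
    "\<And>n t. 0 \<le> deriv (\<eta> n) t" "\<And>n t. t \<le> 1 / real (Suc n) \<Longrightarrow> \<eta> n t = 0" "\<And>n t. 2 / real (Suc n) \<le> t \<Longrightarrow> \<eta> n t = 1"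
proof -
  obtain \<rho> :: "real \<Rightarrow> real" where \<rho>: "test_function {1..2} \<rho>" "\<And>x. 0 \<le> \<rho> x" "(LINT x|lborel. \<rho> x) = 1"
    by (rule unit_bump[of 1 2]) auto
  obtain F a b where F: "a \<le> b" "{a..b} \<subseteq> {1..2}" "smooth F" "\<And>x. (F has_real_derivative \<rho> x) (at x)"
    "\<And>x. x \<le> a \<Longrightarrow> F x = 0" "\<And>x. b \<le> x \<Longrightarrow> F x = 1"
    by (rule test_antiderivative[OF \<rho>(1)]) (auto simp: \<rho>(3) is_interval_cc)
  have ab: "1 \<le> a" "b \<le> 2" using F(1,2) by auto
  have mono: "x \<le> y \<Longrightarrow> F x \<le> F y" for x y
    by (rule DERIV_nonneg_imp_nondecreasing) (use F(4) \<rho>(2) in blast)+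
  define \<eta> where "\<eta> n t = F (real (Suc n) * t + 0)" for n t
  have D: "(\<eta> n has_real_derivative \<rho> (real (Suc n) * t + 0) * real (Suc n)) (at t)" for n t
    unfolding \<eta>_def by (rule DERIV_chain2[OF F(4)]) (auto intro!: derivative_eq_intros)
  show ?thesis
  proof (rule that[of \<eta>])
    show "smooth (\<eta> n)" for n unfolding \<eta>_def[abs_def] by (rule smooth_affine[OF F(3)])
    show "0 \<le> \<eta> n t" for n t
      using mono[of "min a (real (Suc n) * t + 0)" "real (Suc n) * t + 0"] F(5)[of "min a (real (Suc n) * t + 0)"]
      by (simp add: \<eta>_def)
    show "\<eta> n t \<le> 1" for n t
      using mono[of "real (Suc n) * t + 0" "max b (real (Suc n) * t + 0)"] F(6)[of "max b (real (Suc n) * t + 0)"]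
      by (simp add: \<eta>_def)
    show "0 \<le> deriv (\<eta> n) t" for n t
      unfolding DERIV_imp_deriv[OF D] using \<rho>(2) by simp
    show "\<eta> n t = 0" if "t \<le> 1 / real (Suc n)" for n t
    proof -
      have "real (Suc n) * t \<le> 1" using that by (simp add: field_simps)
      then show ?thesis unfolding \<eta>_def by (intro F(5)) (use ab in linarith)
    qed
    show "\<eta> n t = 1" if "2 / real (Suc n) \<le> t" for n t
    proof -
      have "2 \<le> real (Suc n) * t" using that by (simp add: field_simps)
      then show ?thesis unfolding \<eta>_def by (intro F(6)) (use ab in linarith)
    qed
  qed
qed

text \<open>A compactly supported primitive requires zero mean, so the mass of \<gamma> is
  compensated by a bump in (-2, -1), where solutions do not see it. For t \<ge> 0 the result is
  minus the integral of \<gamma> from t to infinity. This is the time primitive with which the wave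
  equation is tested.\<close>

lemma half_line_antiderivative:
  assumes \<gamma>: "test_function UNIV \<gamma>"
  obtains \<beta> where "test_function UNIV \<beta>" "\<And>t. 0 \<le> t \<Longrightarrow> deriv \<beta> t = \<gamma> t"
    "\<And>t. 0 \<le> t \<Longrightarrow> deriv (deriv \<beta>) t = deriv \<gamma> t"
proof -
  obtain \<rho> :: "real \<Rightarrow> real" where \<rho>: "test_function {-2..-1} \<rho>" "\<And>x. x \<notin> {-2<..<-1} \<Longrightarrow> \<rho> x = 0" "(LINT x|lborel. \<rho> x) = (1::real)"
    by (rule unit_bump[of "-2" "-1"]) auto
  have \<rho>': "test_function UNIV \<rho>" by (rule test_mono[OF \<rho>(1)]) simp
  define m where "m = (LINT t|lborel. \<gamma> t)"
  have \<rho>m: "test_function UNIV (\<lambda>t. \<rho> t * m)" by (intro test_mult_smooth \<rho>' smooth_const)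
  have t: "test_function UNIV (\<lambda>t. \<gamma> t - \<rho> t * m)" by (intro test_diff \<gamma> \<rho>m)
  have "(LINT t|lborel. \<gamma> t - \<rho> t * m) = 0"
    by (subst Bochner_Integration.integral_diff[OF test_integrable[OF \<gamma>] test_integrable[OF \<rho>m]])
      (simp add: m_def \<rho>(3))
  then obtain B where B: "test_function UNIV B" "deriv B = (\<lambda>t. \<gamma> t - \<rho> t * m)"
    using test_antiderivative_zero_mean[OF t] by auto
  have "deriv (\<lambda>t. \<gamma> t - \<rho> t * m) t = deriv \<gamma> t" if "0 \<le> t" for t
  proof (rule DERIV_imp_deriv)
    show "((\<lambda>t. \<gamma> t - \<rho> t * m) has_real_derivative deriv \<gamma> t) (at t)"
      by (rule has_field_derivative_transform_within_open[OF test_DERIV[OF \<gamma>], of "{-1<..}"])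
        (use that \<rho>(2) in auto)
  qed
  moreover have "\<gamma> t - \<rho> t * m = \<gamma> t" if "0 \<le> t" for t using that \<rho>(2)[of t] by simp
  ultimately show ?thesis using B by (intro that[of B]) auto
qed

lemma test_vanishes_eventually:
  fixes \<beta> :: "real \<Rightarrow> real"
  assumes "test_function S \<beta>"
  obtains T where "a \<le> T" "\<And>t. T \<le> t \<Longrightarrow> \<beta> t = 0"
proof -
  have "test_function UNIV \<beta>" using test_mono[OF assms] by simp
  then obtain a' b' where "\<And>x. x \<notin> {a'..b'} \<Longrightarrow> \<beta> x = 0" by (rule test_functionE) auto
  then show ?thesis by (intro that[of "max a (b' + 1)"]) auto
qed

text \<open>Compact support makes the value at late times 0.\<close>

lemma test_nonneg_of_decreasing:
  fixes \<beta> :: "real \<Rightarrow> real"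
  assumes "test_function S \<beta>" "\<And>t. a \<le> t \<Longrightarrow> deriv \<beta> t \<le> 0"
  shows "0 \<le> \<beta> a"
proof -
  obtain T where T: "a \<le> T" "\<And>t. T \<le> t \<Longrightarrow> \<beta> t = 0" using test_vanishes_eventually[OF assms(1)] by blast
  have "\<beta> T \<le> \<beta> a"
    by (rule DERIV_nonpos_imp_nonincreasing[OF T(1)]) (use test_DERIV[OF assms(1)] assms(2) in blast)
  then show ?thesis using T(2) by simp
qed

lemma test_integral_half_line:
  fixes \<beta> :: "real \<Rightarrow> real"
  assumes "test_function S \<beta>"
  shows "(LINT t|lborel. indicator {a<..} t * deriv \<beta> t) = - \<beta> a"
proof -
  obtain T where T: "a \<le> T" "\<And>t. T \<le> t \<Longrightarrow> \<beta> t = 0" using test_vanishes_eventually[OF assms] by blast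
  obtain T' where T': "T \<le> T'" "\<And>t. T' \<le> t \<Longrightarrow> deriv \<beta> t = 0" using test_vanishes_eventually[OF test_deriv[OF assms]] by blast
  have [measurable]: "deriv \<beta> \<in> borel_measurable borel" by (rule test_borel[OF test_deriv[OF assms]])
  have "(LINT t|lborel. indicator {a<..} t * deriv \<beta> t) = (LINT t|lborel. indicator {a..T'} t *\<^sub>R deriv \<beta> t)"
  proof (rule integral_cong_AE)
    have "AE t in lborel. t \<noteq> a" by (rule AE_lborel_singleton)
    then show "AE t in lborel. indicator {a<..} t * deriv \<beta> t = indicator {a..T'} t *\<^sub>R deriv \<beta> t"
      by eventually_elim (use T' in \<open>auto simp: indicator_def\<close>)
  qed simp_all
  also have "\<dots> = \<beta> T' - \<beta> a"
  proof (rule integral_FTC_atLeastAtMost)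
    show "a \<le> T'" using T T' by simp
    show "(\<beta> has_vector_derivative deriv \<beta> x) (at x within {a..T'})" for x
      using test_DERIV[OF assms, of x] has_vector_derivative_at_within
      by (auto simp: has_real_derivative_iff_has_vector_derivative)
    show "continuous_on {a..T'} (deriv \<beta>)"
      using test_continuous[OF test_deriv[OF assms]] continuous_on_subset by blast
  qed
  finally show ?thesis using T T' by simp
qed

lemma test_integral_deriv:
  fixes \<beta> :: "real \<Rightarrow> real"
  assumes "test_function S \<beta>"
  shows "(LINT t|lborel. deriv \<beta> t) = 0"
proof -
  have "test_function UNIV \<beta>" using test_mono[OF assms] by simp
  then obtain a b where ab: "\<And>x. x \<notin> {a..b} \<Longrightarrow> \<beta> x = 0" by (rule test_functionE) auto
  have "test_function UNIV (deriv \<beta>)" using test_mono[OF test_deriv[OF assms]] by simp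
  then obtain a' b' where ab': "\<And>x. x \<notin> {a'..b'} \<Longrightarrow> deriv \<beta> x = 0" by (rule test_functionE) auto
  let ?a = "min a a' - 1"
  have "(LINT t|lborel. deriv \<beta> t) = (LINT t|lborel. indicator {?a<..} t * deriv \<beta> t)"
    by (rule Bochner_Integration.integral_cong) (auto simp: indicator_def intro!: ab')
  also have "\<dots> = 0"
  proof -
    have "\<beta> ?a = 0" by (rule ab) auto
    then show ?thesis unfolding test_integral_half_line[OF assms] by (simp only: minus_zero)
  qed
  finally show ?thesis .
qed

lemma tens_deriv_mult:
  assumes "smooth \<beta>" "smooth \<eta>"
  shows "tens \<alpha> (deriv (\<lambda>t. \<beta> t * \<eta> t)) p = tens \<alpha> (\<lambda>t. deriv \<beta> t * \<eta> t) p + tens \<alpha> (\<lambda>t. \<beta> t * deriv \<eta> t) p"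
proof -
  have "deriv (\<lambda>t. \<beta> t * \<eta> t) t = deriv \<beta> t * \<eta> t + deriv \<eta> t * \<beta> t" for t
    by (intro DERIV_imp_deriv DERIV_mult smooth_DERIV assms)
  then show ?thesis by (simp add: tens_def algebra_simps)
qed

lemma weak_tD: "weak_t f g \<Longrightarrow> test_function UNIV \<alpha> \<Longrightarrow> test_function {0<..} \<beta> \<Longrightarrow>
    (LINT p|lborel. f p * tens \<alpha> (deriv \<beta>) p) = - (LINT p|lborel. g p * tens \<alpha> \<beta> p)"
  and weak_xD: "weak_x f g \<Longrightarrow> test_function UNIV \<alpha> \<Longrightarrow> test_function {0<..} \<beta> \<Longrightarrow>
    (LINT p|lborel. f p * tens (deriv \<alpha>) \<beta> p) = - (LINT p|lborel. g p * tens \<alpha> \<beta> p)"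
  by (auto simp: weak_t_def weak_x_def)

lemma tens_nonneg: "(\<And>x. 0 \<le> \<alpha> x) \<Longrightarrow> (\<And>t. 0 \<le> \<beta> t) \<Longrightarrow> 0 \<le> tens \<alpha> \<beta> p"
  by (simp add: tens_def)

text \<open>In this locale \<open>v\<close> is a bounded Borel representative that is set to \<open>0\<close> for \<open>t \<le> 0\<close>, so that
  integrals over the plane are integrals over the half-plane. The functions \<open>h\<^sub>1\<close> and \<open>h\<^sub>2\<close> both stand
  for \<open>\<partial>\<^sub>x(v\<^sup>\<theta>)\<close>: monotonicity of \<open>w\<close> gives \<open>v\<^sub>t \<le> h\<^sub>1\<close>, that of \<open>z\<close> gives \<open>v\<^sub>t \<le> - h\<^sub>2\<close>.
  The number \<open>L \<alpha>\<close> is \<open>\<integral> v\<^sub>1 \<alpha>\<close>, or \<open>- \<integral> u\<^sub>0 \<alpha>'\<close> for the first-order system.\<close>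

locale degenerate_wave =
  fixes s \<theta> c M :: real and v g h1 h2 :: "real \<times> real \<Rightarrow> real" and v0 :: "real \<Rightarrow> real"
    and L :: "(real \<Rightarrow> real) \<Rightarrow> real"
  assumes s: "1 < s" and \<theta>: "\<theta> = (s + 1) / 2" and c: "c = \<theta>\<^sup>2 / s"
    and v_borel [measurable]: "v \<in> borel_measurable borel"
    and v_bounds: "0 \<le> v p" "v p \<le> M" and v_neg: "snd p \<le> 0 \<Longrightarrow> v p = 0"
    and v0_borel [measurable]: "v0 \<in> borel_measurable borel"
    and v0_bounds: "0 \<le> v0 x" "v0 x \<le> M"
    and loc: "loc_int g" "loc_int h1" "loc_int h2"
    and v_t: "weak_t v g"
    and v_x: "weak_x (\<lambda>p. v p powr \<theta>) h1" "weak_x (\<lambda>p. v p powr \<theta>) h2"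
    and g_le: "AE p in lborel. 0 < snd p \<longrightarrow> g p \<le> 0"
      "AE p in lborel. 0 < snd p \<longrightarrow> g p \<le> h1 p" "AE p in lborel. 0 < snd p \<longrightarrow> g p \<le> - h2 p"
    and wave: "test_function UNIV \<alpha> \<Longrightarrow> test_function UNIV \<beta> \<Longrightarrow>
      (LINT p|lborel. v p * tens \<alpha> (deriv (deriv \<beta>)) p) - c * (LINT p|lborel. v p powr s * tens (deriv (deriv \<alpha>)) \<beta> p)
        + deriv \<beta> 0 * (LINT x|lborel. v0 x * \<alpha> x) - \<beta> 0 * L \<alpha> = 0"
begin

text \<open>All from s = 2 \<theta> - 1 and c = \<theta>^2 / s. They make the flux c v^s, viewed as
  a function of v^\<theta>, differentiate with the factor \<theta> v^(\<theta> - 1).\<close>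

lemma exponents: "1 < \<theta>" "1 < s / \<theta>" "0 < c" "c * (s / \<theta>) = \<theta>" "\<theta> * (s / \<theta>) = s" "\<theta> * (s / \<theta> - 1) = \<theta> - 1"
proof -
  show "1 < \<theta>" using s by (simp add: \<theta>)
  show "1 < s / \<theta>" using s by (simp add: \<theta> field_simps)
  show "0 < c" using s by (simp add: c \<theta>)
  have "s \<noteq> 0" "\<theta> \<noteq> 0" using s by (auto simp: \<theta>)
  then show "c * (s / \<theta>) = \<theta>" by (simp add: c power2_eq_square)
  show "\<theta> * (s / \<theta>) = s" using s by (simp add: \<theta>)
  show "\<theta> * (s / \<theta> - 1) = \<theta> - 1" using s by (simp add: \<theta> field_simps)
qed

lemma v_powr_bound: "0 \<le> r \<Longrightarrow> \<bar>v p powr r\<bar> \<le> M powr r"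
  using v_bounds[of p] by (simp add: powr_mono2)

lemma v_abs: "\<bar>v p\<bar> \<le> M"
  using v_bounds[of p] by simp

lemma v_powr_borel [measurable]: "(\<lambda>p. v p powr r) \<in> borel_measurable borel"
  by measurable

lemma v_mult_tens:
  assumes "test_function S \<alpha>" "test_function T \<beta>"
  shows "integrable lborel (\<lambda>p. v p * tens \<alpha> \<beta> p)"
  by (rule bounded_mult_tens[OF _ v_abs assms]) simp

lemma v_powr_mult_tens:
  assumes "test_function S \<alpha>" "test_function T \<beta>" "0 \<le> r"
  shows "integrable lborel (\<lambda>p. v p powr r * tens \<alpha> \<beta> p)"
  by (rule bounded_mult_tens[OF _ v_powr_bound[OF assms(3)] assms(1,2)]) simp

lemma v0_mult_test:
  assumes "test_function S \<alpha>"
  shows "integrable lborel (\<lambda>x. v0 x * \<alpha> x)"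
  using integrable_mult_bounded[OF test_integrable[OF assms], of v0 M] v0_bounds by (simp add: mult.commute)

lemma v0_powr_bound: "\<bar>v0 x powr \<theta>\<bar> \<le> M powr \<theta>"
  using v0_bounds[of x] exponents(1) by (simp add: powr_mono2)

lemma v0_powr_mult_test:
  assumes "test_function S \<alpha>"
  shows "integrable lborel (\<lambda>x. v0 x powr \<theta> * \<alpha> x)"
  using integrable_mult_bounded[OF test_integrable[OF assms], of "\<lambda>x. v0 x powr \<theta>" "M powr \<theta>"] v0_powr_bound
  by (simp add: mult.commute)

text \<open>The characteristic speed \<lambda>: its square is c s v^(s - 1), the derivative of c v^s
  with respect to v.\<close>

definition speed :: "real \<times> real \<Rightarrow> real" where
  "speed p = \<theta> * v p powr (\<theta> - 1)"

lemma speed: "0 \<le> speed p" "speed \<in> borel_measurable borel" "\<bar>speed p\<bar> \<le> \<theta> * M powr (\<theta> - 1)"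
  using v_powr_bound[of "\<theta> - 1" p] exponents(1) by (auto simp: speed_def[abs_def] abs_mult)

lemma weak_t_v_powr: "weak_t (\<lambda>p. v p powr \<theta>) (\<lambda>p. speed p * g p)"
  using chain_rule_t[OF v_t v_borel v_abs loc(1) max_powr_DERIV[OF exponents(1)]] v_bounds(1)
  by (simp add: speed_def max_absorb2)

text \<open>The x-derivative at hand is that of v^\<theta>, so v^s is taken as its power s /
  \<theta> > 1.\<close>

lemma weak_x_v_powr:
  assumes "weak_x (\<lambda>p. v p powr \<theta>) h" "loc_int h"
  shows "weak_x (\<lambda>p. v p powr s) (\<lambda>p. (s / \<theta>) * v p powr (\<theta> - 1) * h p)"
  using chain_rule_x[OF assms(1) v_powr_borel v_powr_bound assms(2) max_powr_DERIV[OF exponents(2)]]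
    exponents v_bounds(1)
  by (simp add: powr_powr max_absorb2)

text \<open>Multiplying g \<le> \<sigma> h by the nonnegative speed compares the time derivative of
  v^\<theta> with \<sigma> times the x-derivative of c v^s, and testing moves both derivatives onto
  the test functions. Here \<beta> still vanishes near t = 0.\<close>

lemma flux_le_interior:
  assumes \<alpha>: "test_function UNIV \<alpha>" "\<And>x. 0 \<le> \<alpha> x" and \<beta>: "test_function {0<..} \<beta>" "\<And>t. 0 \<le> \<beta> t"
    and \<sigma>: "\<bar>\<sigma>\<bar> = 1"
  shows "\<sigma> * (c * (LINT p|lborel. v p powr s * tens (deriv \<alpha>) \<beta> p)) \<le> (LINT p|lborel. v p powr \<theta> * tens \<alpha> (deriv \<beta>) p)"
proof -
  \<comment> \<open>The sign \<sigma> selects the monotonicity bound: \<open>h1\<close> comes from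
    w, \<open>h2\<close> from z.\<close>
  obtain h where h: "loc_int h" "weak_x (\<lambda>p. v p powr \<theta>) h" "AE p in lborel. 0 < snd p \<longrightarrow> g p \<le> \<sigma> * h p"
  proof (cases "\<sigma> = 1")
    case True
    then show ?thesis using loc v_x g_le by (intro that[of h1]) auto
  next
    case False
    then have "\<sigma> = - 1" using \<sigma> by linarith
    then show ?thesis using loc v_x g_le by (intro that[of h2]) auto
  qed
  have [measurable]: "speed \<in> borel_measurable borel" by (rule speed(2))
  have i1: "integrable lborel (\<lambda>p. speed p * g p * tens \<alpha> \<beta> p)"
    by (intro loc_int_mult_tens loc_int_bounded_mult[OF loc(1) speed(2,3)] \<alpha> \<beta>)
  have i2: "integrable lborel (\<lambda>p. speed p * h p * tens \<alpha> \<beta> p)"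
    by (intro loc_int_mult_tens loc_int_bounded_mult[OF h(1) speed(2,3)] \<alpha> \<beta>)
  have "c * (LINT p|lborel. v p powr s * tens (deriv \<alpha>) \<beta> p)
      = - (LINT p|lborel. c * ((s / \<theta>) * v p powr (\<theta> - 1) * h p * tens \<alpha> \<beta> p))"
    unfolding weak_xD[OF weak_x_v_powr[OF h(2,1)] \<alpha>(1) \<beta>(1)] by simp
  also have "(\<lambda>p. c * ((s / \<theta>) * v p powr (\<theta> - 1) * h p * tens \<alpha> \<beta> p)) = (\<lambda>p. speed p * h p * tens \<alpha> \<beta> p)"
  proof
    fix p
    have "c * ((s / \<theta>) * v p powr (\<theta> - 1) * h p * tens \<alpha> \<beta> p) = (c * (s / \<theta>)) * v p powr (\<theta> - 1) * h p * tens \<alpha> \<beta> p"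
      by (simp only: mult.assoc)
    then show "c * ((s / \<theta>) * v p powr (\<theta> - 1) * h p * tens \<alpha> \<beta> p) = speed p * h p * tens \<alpha> \<beta> p"
      by (simp only: exponents(4) speed_def)
  qed
  finally have "\<sigma> * (c * (LINT p|lborel. v p powr s * tens (deriv \<alpha>) \<beta> p))
      = - (LINT p|lborel. \<sigma> * (speed p * h p * tens \<alpha> \<beta> p))" by simp
  also have "\<dots> \<le> - (LINT p|lborel. speed p * g p * tens \<alpha> \<beta> p)"
  proof -
    have "(LINT p|lborel. speed p * g p * tens \<alpha> \<beta> p) \<le> (LINT p|lborel. \<sigma> * (speed p * h p * tens \<alpha> \<beta> p))"
    proof (rule integral_mono_AE[OF i1])
      show "integrable lborel (\<lambda>p. \<sigma> * (speed p * h p * tens \<alpha> \<beta> p))" using i2 by simp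
      show "AE p in lborel. speed p * g p * tens \<alpha> \<beta> p \<le> \<sigma> * (speed p * h p * tens \<alpha> \<beta> p)"
        using h(3)
      proof eventually_elim
        case (elim p)
        show ?case
        proof (cases "0 < snd p")
          case True
          have "(speed p * tens \<alpha> \<beta> p) * g p \<le> (speed p * tens \<alpha> \<beta> p) * (\<sigma> * h p)"
            using elim True speed(1)[of p] tens_nonneg[of \<alpha> \<beta> p, OF \<alpha>(2) \<beta>(2)] by (intro mult_left_mono) auto
          then show ?thesis by (simp add: mult_ac)
        next
          case False
          then have "\<beta> (snd p) = 0"
            using \<beta>(1) closure_subset[of "{x. \<beta> x \<noteq> 0}"] unfolding test_function_def by (auto simp: subset_iff)
          then show ?thesis by (simp add: tens_def)
        qed
      qed
    qed
    then show ?thesis by simp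
  qed
  also have "\<dots> = (LINT p|lborel. v p powr \<theta> * tens \<alpha> (deriv \<beta>) p)"
    by (rule weak_tD[OF weak_t_v_powr \<alpha>(1) \<beta>(1), symmetric])
  finally show ?thesis .
qed

section \<open>The initial values of v and of its power \<theta>\<close>

lemma test_cutoff:
  fixes \<beta> \<eta> :: "real \<Rightarrow> real"
  assumes \<beta>: "test_function UNIV \<beta>" and \<eta>: "smooth \<eta>" "\<And>t. t \<le> a \<Longrightarrow> \<eta> t = 0" and a: "0 < a"
  shows "test_function {0<..} (\<lambda>t. \<beta> t * \<eta> t :: real)"
proof -
  obtain b1 b2 where b: "\<And>x. x \<notin> {b1..b2} \<Longrightarrow> \<beta> x = 0" by (rule test_functionE[OF \<beta>]) auto
  show ?thesis
  proof (rule test_functionI[where a=a and b=b2])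
    show "smooth (\<lambda>t. \<beta> t * \<eta> t)" by (intro smooth_mult test_smooth[OF \<beta>] \<eta>(1))
    show "\<beta> t * \<eta> t = 0" if "t \<notin> {a..b2}" for t
      using that b[of t] \<eta>(2)[of t] by auto
  qed (use a in auto)
qed

text \<open>Weak form of v_t \<le> 0 that includes the initial value. The test function is split by
  a cutoff in time. Away from t = 0 the sign of \<open>g\<close> decides. Near t = 0 the wave
  equation is tested with a time primitive of \<gamma> (1 - \<eta>_n); this primitive is of size
  1/n, so the flux and the velocity term disappear in the limit and only the datum \<open>v0\<close>
  is left.\<close>

lemma v_decreasing_weak:
  assumes \<alpha>: "test_function UNIV \<alpha>" "\<And>x. 0 \<le> \<alpha> x" and \<gamma>: "test_function UNIV \<gamma>" "\<And>t. 0 \<le> t \<Longrightarrow> 0 \<le> \<gamma> t"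
  shows "0 \<le> (LINT p|lborel. v p * tens \<alpha> (deriv \<gamma>) p) + \<gamma> 0 * (LINT x|lborel. v0 x * \<alpha> x)"
proof -
  obtain \<eta> :: "nat \<Rightarrow> real \<Rightarrow> real" where \<eta>: "\<And>n. smooth (\<eta> n)" "\<And>n t. 0 \<le> \<eta> n t" "\<And>n t. \<eta> n t \<le> 1"
    "\<And>n t. 0 \<le> deriv (\<eta> n) t" "\<And>n t. t \<le> 1 / real (Suc n) \<Longrightarrow> \<eta> n t = 0" "\<And>n t. 2 / real (Suc n) \<le> t \<Longrightarrow> \<eta> n t = 1"
    using cutoff_sequence by blast
  obtain K where K: "\<And>t. \<bar>\<gamma> t\<bar> \<le> K" using test_bounded[OF \<gamma>(1)] by blast
  have "K \<ge> 0" using order_trans[OF abs_ge_zero K] .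
  define \<gamma>1 where "\<gamma>1 n t = \<gamma> t * \<eta> n t" for n t
  define \<gamma>2 where "\<gamma>2 n t = \<gamma> t * (1 - \<eta> n t)" for n t
  have \<gamma>1: "test_function {0<..} (\<gamma>1 n)" for n
    unfolding \<gamma>1_def[abs_def] by (rule test_cutoff[OF \<gamma>(1) \<eta>(1,5)]) auto
  have \<gamma>2: "test_function UNIV (\<gamma>2 n)" for n
    unfolding \<gamma>2_def[abs_def] by (intro test_mult_smooth \<gamma>(1) smooth_diff smooth_const \<eta>(1))
  have \<gamma>1_UNIV: "test_function UNIV (\<gamma>1 n)" for n by (rule test_mono[OF \<gamma>1]) simp
  have "\<exists>\<beta>. test_function UNIV \<beta> \<and> (\<forall>t\<ge>0. deriv \<beta> t = \<gamma>2 n t) \<and> (\<forall>t\<ge>0. deriv (deriv \<beta>) t = deriv (\<gamma>2 n) t)" for n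
    using half_line_antiderivative[OF \<gamma>2[of n]] by metis
  then obtain \<beta> where \<beta>: "\<And>n. test_function UNIV (\<beta> n)" "\<And>n t. 0 \<le> t \<Longrightarrow> deriv (\<beta> n) t = \<gamma>2 n t"
    "\<And>n t. 0 \<le> t \<Longrightarrow> deriv (deriv (\<beta> n)) t = deriv (\<gamma>2 n) t" by metis
  have \<gamma>2_bd: "\<bar>\<gamma>2 n t\<bar> \<le> K" for n t
    unfolding \<gamma>2_def using K[of t] \<eta>(2,3)[of n t] \<open>K \<ge> 0\<close>
    by (auto simp: abs_mult intro: order_trans[OF mult_right_le_one_le])
  \<comment> \<open>Beyond the layer the primitive is constant, hence 0 by compact support; the
    monotonicity lemma is applied to both signs.\<close>
  have \<beta>_zero: "\<beta> n t = 0" if t: "2 / real (Suc n) \<le> t" for n t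
  proof -
    have d0: "deriv (\<beta> n) r = 0" if "t \<le> r" for r
    proof -
      have "0 \<le> 2 / real (Suc n)" by simp
      then have "0 \<le> r" "2 / real (Suc n) \<le> r" using that t by linarith+
      then show ?thesis using \<beta>(2)[of r n] \<eta>(6)[of n r] by (simp add: \<gamma>2_def)
    qed
    have "0 \<le> \<beta> n t" by (rule test_nonneg_of_decreasing[OF \<beta>(1)]) (simp add: d0)
    moreover have "0 \<le> - \<beta> n t"
    proof (rule test_nonneg_of_decreasing[OF test_minus[OF \<beta>(1)]])
      fix r assume "t \<le> r"
      have "((\<lambda>t. - \<beta> n t) has_real_derivative - deriv (\<beta> n) r) (at r)"
        by (intro DERIV_minus test_DERIV[OF \<beta>(1)])
      then show "deriv (\<lambda>t. - \<beta> n t) r \<le> 0" using d0[OF \<open>t \<le> r\<close>] by (simp add: DERIV_imp_deriv)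
    qed
    ultimately show ?thesis by simp
  qed
  have \<beta>_bd: "\<bar>\<beta> n t\<bar> \<le> K * (2 / real (Suc n))" if "0 \<le> t" for n t
  proof (cases "t < 2 / real (Suc n)")
    case True
    obtain z where z: "t < z" "z < 2 / real (Suc n)"
      "\<beta> n (2 / real (Suc n)) - \<beta> n t = (2 / real (Suc n) - t) * deriv (\<beta> n) z"
      using MVT2[OF True test_DERIV[OF \<beta>(1)]] by blast
    have "\<bar>\<beta> n t\<bar> = (2 / real (Suc n) - t) * \<bar>\<gamma>2 n z\<bar>"
      using z \<beta>_zero[of n "2 / real (Suc n)"] \<beta>(2)[of z n] that by (simp add: abs_mult flip: abs_minus_cancel[of "\<beta> n t"])
    also have "\<dots> \<le> (2 / real (Suc n)) * K"
      using \<gamma>2_bd[of n z] that z by (intro mult_mono) auto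
    finally show ?thesis by (simp add: mult.commute)
  next
    case False
    then show ?thesis using \<beta>_zero[of n t] \<open>K \<ge> 0\<close> by simp
  qed
  \<comment> \<open>The flux and velocity terms of the wave equation tested with \<alpha> \<beta>_n;
    they tend to 0 along with \<beta>_n.\<close>
  define R where "R n = c * (LINT p|lborel. v p powr s * tens (deriv (deriv \<alpha>)) (\<beta> n) p) + \<beta> n 0 * L \<alpha>" for n
  have \<alpha>'': "test_function UNIV (deriv (deriv \<alpha>))" by (intro test_deriv \<alpha>(1))
  have "(\<lambda>n. K * (2 / real (Suc n))) \<longlonglongrightarrow> K * 0"
    by (intro tendsto_mult_left LIMSEQ_Suc lim_const_over_n)
  then have K0: "(\<lambda>n. K * (2 / real (Suc n))) \<longlonglongrightarrow> 0" by simp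
  have \<beta>_lim: "(\<lambda>n. \<beta> n t) \<longlonglongrightarrow> 0" if "0 \<le> t" for t
    by (rule Lim_null_comparison[OF _ K0]) (use \<beta>_bd[OF that] in auto)
  have [measurable]: "\<beta> n \<in> borel_measurable borel" "deriv (deriv \<alpha>) \<in> borel_measurable borel" for n
    using test_borel[OF \<beta>(1)[of n]] test_borel[OF \<alpha>''] by auto
  have "(\<lambda>n. LINT p|lborel. v p powr s * tens (deriv (deriv \<alpha>)) (\<beta> n) p) \<longlonglongrightarrow> (LINT p|(lborel :: (real \<times> real) measure). 0)"
  proof (rule integral_dominated_convergence)
    \<comment> \<open>The factor 2 and the interval [0, 2] come from the layer width 2 / (n + 1),
      bounded uniformly in n.\<close>
    let ?w = "\<lambda>p. M powr s * K * 2 * tens (\<lambda>x. \<bar>deriv (deriv \<alpha>) x\<bar>) (indicator {0..2}) p"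
    show "integrable lborel ?w"
      by (intro integrable_mult_right integrable_tens integrable_abs test_integrable[OF \<alpha>''] integrable_real_indicator) auto
    show "AE p in lborel. (\<lambda>n. v p powr s * tens (deriv (deriv \<alpha>)) (\<beta> n) p) \<longlonglongrightarrow> 0"
    proof (rule AE_I2)
      fix p :: "real \<times> real"
      show "(\<lambda>n. v p powr s * tens (deriv (deriv \<alpha>)) (\<beta> n) p) \<longlonglongrightarrow> 0"
      proof (cases "snd p \<le> 0")
        case False
        have "(\<lambda>n. v p powr s * (deriv (deriv \<alpha>) (fst p) * \<beta> n (snd p))) \<longlonglongrightarrow> v p powr s * (deriv (deriv \<alpha>) (fst p) * 0)"
          using False by (intro tendsto_mult_left \<beta>_lim) auto
        then show ?thesis by (simp add: tens_def)
      qed (simp add: v_neg)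
    qed
    show "AE p in lborel. norm (v p powr s * tens (deriv (deriv \<alpha>)) (\<beta> n) p) \<le> ?w p" for n
    proof (rule AE_I2)
      fix p :: "real \<times> real"
      show "norm (v p powr s * tens (deriv (deriv \<alpha>)) (\<beta> n) p) \<le> ?w p"
      proof (cases "0 < snd p \<and> snd p < 2 / real (Suc n)")
        case True
        have "2 / real (Suc n) \<le> 2" by (simp add: field_simps)
        then have i: "snd p \<in> {0..2}" using True by auto
        have "K * (2 / real (Suc n)) \<le> K * 2"
          by (rule mult_left_mono[OF \<open>2 / real (Suc n) \<le> 2\<close> \<open>K \<ge> 0\<close>])
        then have b: "\<bar>\<beta> n (snd p)\<bar> \<le> K * 2"
          using \<beta>_bd[of "snd p" n] True by linarith
        have "\<bar>v p powr s\<bar> * (\<bar>deriv (deriv \<alpha>) (fst p)\<bar> * \<bar>\<beta> n (snd p)\<bar>) \<le> M powr s * (\<bar>deriv (deriv \<alpha>) (fst p)\<bar> * (K * 2))"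
          using v_powr_bound[of s p] s b by (intro mult_mono) auto
        then show ?thesis using i by (simp add: tens_def abs_mult mult_ac)
      next
        case False
        then have "v p powr s * \<beta> n (snd p) = 0" using v_neg[of p] \<beta>_zero[of n "snd p"] by (cases "snd p \<le> 0") auto
        then have "v p powr s * tens (deriv (deriv \<alpha>)) (\<beta> n) p = 0" by (auto simp: tens_def)
        moreover have "0 \<le> ?w p" using \<open>K \<ge> 0\<close> by (auto simp: tens_def intro!: mult_nonneg_nonneg)
        ultimately show ?thesis by (simp only: norm_zero)
      qed
    qed
  qed simp_all
  then have "R \<longlonglongrightarrow> c * 0 + 0 * L \<alpha>"
    unfolding R_def by (intro tendsto_intros \<beta>_lim) auto
  then have R: "R \<longlonglongrightarrow> 0" by simp
  have "R n \<le> (LINT p|lborel. v p * tens \<alpha> (deriv \<gamma>) p) + \<gamma> 0 * (LINT x|lborel. v0 x * \<alpha> x)" for n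
  proof -
    have "(LINT p|lborel. v p * tens \<alpha> (deriv (deriv (\<beta> n))) p) = (LINT p|lborel. v p * tens \<alpha> (deriv (\<gamma>2 n)) p)"
    proof (rule Bochner_Integration.integral_cong[OF refl])
      fix p show "v p * tens \<alpha> (deriv (deriv (\<beta> n))) p = v p * tens \<alpha> (deriv (\<gamma>2 n)) p"
        by (cases "snd p \<le> 0") (simp_all add: v_neg tens_def \<beta>(3))
    qed
    then have R_eq: "R n = (LINT p|lborel. v p * tens \<alpha> (deriv (\<gamma>2 n)) p) + \<gamma> 0 * (LINT x|lborel. v0 x * \<alpha> x)"
      using wave[OF \<alpha>(1) \<beta>(1)[of n]] \<beta>(2)[of 0 n] \<eta>(5)[of 0 n] by (simp add: R_def \<gamma>2_def)
    have "0 \<le> (LINT p|lborel. v p * tens \<alpha> (deriv (\<gamma>1 n)) p)"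
    proof -
      have "(LINT p|lborel. g p * tens \<alpha> (\<gamma>1 n) p) \<le> (LINT p|(lborel :: (real \<times> real) measure). 0)"
      proof (rule integral_mono_AE)
        show "integrable lborel (\<lambda>p. g p * tens \<alpha> (\<gamma>1 n) p)" by (rule loc_int_mult_tens[OF loc(1) \<alpha>(1) \<gamma>1])
        show "AE p in lborel. g p * tens \<alpha> (\<gamma>1 n) p \<le> 0"
          using g_le(1)
        proof eventually_elim
          case (elim p)
          show ?case
          proof (cases "0 < snd p")
            case True
            then have "0 \<le> tens \<alpha> (\<gamma>1 n) p" using \<alpha>(2) \<gamma>(2) \<eta>(2) by (simp add: tens_def \<gamma>1_def)
            then show ?thesis using elim True by (simp add: mult_nonpos_nonneg)
          next
            case False
            have "0 \<le> 1 / real (Suc n)" by simp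
            then have "\<eta> n (snd p) = 0" using False by (intro \<eta>(5)) linarith
            then show ?thesis by (simp add: tens_def \<gamma>1_def)
          qed
        qed
      qed simp
      then show ?thesis unfolding weak_tD[OF v_t \<alpha>(1) \<gamma>1] by simp
    qed
    moreover have "(LINT p|lborel. v p * tens \<alpha> (deriv \<gamma>) p)
        = (LINT p|lborel. v p * tens \<alpha> (deriv (\<gamma>1 n)) p) + (LINT p|lborel. v p * tens \<alpha> (deriv (\<gamma>2 n)) p)"
    proof -
      have "deriv \<gamma> t = deriv (\<gamma>1 n) t + deriv (\<gamma>2 n) t" for t
      proof (rule DERIV_imp_deriv)
        have "((\<lambda>t. \<gamma>1 n t + \<gamma>2 n t) has_real_derivative deriv (\<gamma>1 n) t + deriv (\<gamma>2 n) t) (at t)"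
          by (intro DERIV_add test_DERIV[OF \<gamma>1] test_DERIV[OF \<gamma>2])
        then show "(\<gamma> has_real_derivative deriv (\<gamma>1 n) t + deriv (\<gamma>2 n) t) (at t)"
          by (simp add: \<gamma>1_def \<gamma>2_def algebra_simps)
      qed
      then have "v p * tens \<alpha> (deriv \<gamma>) p = v p * tens \<alpha> (deriv (\<gamma>1 n)) p + v p * tens \<alpha> (deriv (\<gamma>2 n)) p" for p
        by (simp add: tens_def algebra_simps)
      then show ?thesis
        by (simp add: Bochner_Integration.integral_add[OF v_mult_tens[OF \<alpha>(1) test_deriv[OF \<gamma>1]] v_mult_tens[OF \<alpha>(1) test_deriv[OF \<gamma>2]]])
    qed
    ultimately show ?thesis using R_eq by linarith
  qed
  then show ?thesis using LIMSEQ_le_const2[OF R] by blast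
qed

text \<open>Take \<Gamma> with \<Gamma>' = - b for t \<ge> 0, so that \<Gamma>(0) is the integral of
  b. Then \<open>v_decreasing_weak\<close> says that v0 - v is nonnegative when tested with \<alpha>
  b.\<close>

lemma v_le_v0: "AE p in lborel. v p \<le> v0 (fst p)"
proof -
  have [measurable]: "fst \<in> borel \<rightarrow>\<^sub>M (borel :: real measure)"
    by (intro borel_measurable_continuous_onI continuous_intros)
  have l: "loc_int (\<lambda>p. v0 (fst p))"
    by (rule loc_int_bounded[of _ M]) (use v0_bounds in auto)
  have "AE p in lborel. 0 < snd p \<longrightarrow> 0 \<le> v0 (fst p) - v p"
  proof (rule AE_nonneg_halfplane)
    show "loc_int (\<lambda>p. v0 (fst p) - v p)" by (intro loc_int_diff l loc_int_bounded[OF v_borel v_abs])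
    fix \<alpha> b :: "real \<Rightarrow> real"
    assume \<alpha>: "test_function UNIV \<alpha>" and b: "test_function {0<..} b" and nonneg: "\<forall>x. 0 \<le> \<alpha> x" "\<forall>t. 0 \<le> b t"
    have bU: "test_function UNIV b" by (rule test_mono[OF b]) simp
    obtain \<Gamma> where \<Gamma>: "test_function UNIV \<Gamma>" "\<And>t. 0 \<le> t \<Longrightarrow> deriv \<Gamma> t = - b t"
      using half_line_antiderivative[OF test_minus[OF bU]] by metis
    have "0 \<le> \<Gamma> a" if "0 \<le> a" for a
      by (rule test_nonneg_of_decreasing[OF \<Gamma>(1)]) (use \<Gamma>(2) that nonneg in auto)
    then have J: "0 \<le> (LINT p|lborel. v p * tens \<alpha> (deriv \<Gamma>) p) + \<Gamma> 0 * (LINT x|lborel. v0 x * \<alpha> x)"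
      using nonneg by (intro v_decreasing_weak \<alpha> \<Gamma>) auto
    \<comment> \<open>For t \<le> 0, where \<Gamma>' is not controlled, \<open>v\<close>
      vanishes.\<close>
    have 1: "v p * tens \<alpha> (deriv \<Gamma>) p = - (v p * tens \<alpha> b p)" for p
      by (cases "snd p \<le> 0") (simp_all add: v_neg tens_def \<Gamma>(2))
    have b0: "b t = 0" if "t \<le> 0" for t
      using b closure_subset[of "{x. b x \<noteq> 0}"] that unfolding test_function_def by (auto simp: subset_iff)
    have "- \<Gamma> 0 = (LINT t|lborel. indicator {0<..} t * deriv \<Gamma> t)"
      by (rule test_integral_half_line[OF \<Gamma>(1), symmetric])
    also have "\<dots> = (LINT t|lborel. - b t)"
      by (rule Bochner_Integration.integral_cong[OF refl]) (use b0 \<Gamma>(2) in \<open>auto simp: indicator_def\<close>)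
    finally have 2: "\<Gamma> 0 = (LINT t|lborel. b t)" by simp
    have "(LINT p|lborel. (v0 (fst p) - v p) * tens \<alpha> b p)
        = (LINT p|lborel. tens (\<lambda>x. v0 x * \<alpha> x) b p - v p * tens \<alpha> b p)"
      by (rule Bochner_Integration.integral_cong[OF refl]) (simp add: tens_def algebra_simps)
    also have "\<dots> = (LINT x|lborel. v0 x * \<alpha> x) * (LINT t|lborel. b t) - (LINT p|lborel. v p * tens \<alpha> b p)"
      using integrable_tens[OF v0_mult_test[OF \<alpha>] test_integrable[OF b]] v_mult_tens[OF \<alpha> b]
      by (subst Bochner_Integration.integral_diff) auto
    also have "\<dots> \<ge> 0" using J by (simp add: 1 2 mult.commute)
    finally show "0 \<le> (LINT p|lborel. (v0 (fst p) - v p) * tens \<alpha> b p)" .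
  qed
  then show ?thesis
  proof eventually_elim
    case (elim p)
    then show ?case using v_neg[of p] v0_bounds(1)[of "fst p"] by (cases "0 < snd p") auto
  qed
qed

text \<open>Replacing \<beta> by \<beta> \<eta>_n reduces to the interior estimate at the cost of
  the term v^\<theta> \<alpha> \<beta> \<eta>_n'. Since \<beta> \<eta>_n' \<ge> 0, the bound v \<le>
  v0 estimates this term by the datum, and the integral of \<beta> \<eta>_n' tends to
  \<beta>(0).\<close>

lemma flux_le:
  assumes \<alpha>: "test_function UNIV \<alpha>" "\<And>x. 0 \<le> \<alpha> x" and \<beta>: "test_function UNIV \<beta>" "\<And>t. 0 \<le> t \<Longrightarrow> 0 \<le> \<beta> t"
    and \<sigma>: "\<bar>\<sigma>\<bar> = 1"
  shows "\<sigma> * (c * (LINT p|lborel. v p powr s * tens (deriv \<alpha>) \<beta> p))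
    \<le> (LINT p|lborel. v p powr \<theta> * tens \<alpha> (deriv \<beta>) p) + \<beta> 0 * (LINT x|lborel. v0 x powr \<theta> * \<alpha> x)"
proof -
  obtain \<eta> :: "nat \<Rightarrow> real \<Rightarrow> real" where \<eta>: "\<And>n. smooth (\<eta> n)" "\<And>n t. 0 \<le> \<eta> n t" "\<And>n t. \<eta> n t \<le> 1"
    "\<And>n t. 0 \<le> deriv (\<eta> n) t" "\<And>n t. t \<le> 1 / real (Suc n) \<Longrightarrow> \<eta> n t = 0" "\<And>n t. 2 / real (Suc n) \<le> t \<Longrightarrow> \<eta> n t = 1"
    using cutoff_sequence by blast
  have [measurable]: "\<eta> n \<in> borel_measurable borel" for n
    by (intro borel_measurable_continuous_onI smooth_continuous \<eta>(1))
  have [measurable]: "\<alpha> \<in> borel_measurable borel" "\<beta> \<in> borel_measurable borel" "deriv \<alpha> \<in> borel_measurable borel" "deriv \<beta> \<in> borel_measurable borel"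
    using test_borel[OF \<alpha>(1)] test_borel[OF \<beta>(1)] test_borel[OF test_deriv[OF \<alpha>(1)]] test_borel[OF test_deriv[OF \<beta>(1)]] by auto
  have \<theta>0: "0 \<le> \<theta>" "0 \<le> s" using exponents(1) s by auto
  have \<eta>0: "\<eta> n t = 0" if "t \<le> 0" for n t
  proof -
    have "0 \<le> 1 / real (Suc n)" by simp
    then show ?thesis using that by (intro \<eta>(5)) linarith
  qed
  have \<eta>_lim: "(\<lambda>n. \<eta> n t) \<longlonglongrightarrow> indicator {0<..} t" for t
  proof (cases "0 < t")
    case True
    have "(\<lambda>n. 2 / real (Suc n)) \<longlonglongrightarrow> 0" by (intro LIMSEQ_Suc lim_const_over_n)
    from order_tendstoD(2)[OF this True] have "\<forall>\<^sub>F n in sequentially. \<eta> n t = indicator {0<..} t"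
      by eventually_elim (use True \<eta>(6) in \<open>auto simp del: of_nat_Suc\<close>)
    then show ?thesis by (rule tendsto_eventually)
  qed (simp add: \<eta>0)
  have tails: "test_function {0<..} (\<lambda>t. \<beta> t * \<eta> n t)" "test_function UNIV (\<lambda>t. deriv \<beta> t * \<eta> n t)"
    "test_function UNIV (\<lambda>t. \<beta> t * deriv (\<eta> n) t)" for n
    using test_cutoff[OF \<beta>(1) \<eta>(1,5)]
    by (auto intro: test_mult_smooth test_deriv \<beta>(1) smooth_deriv \<eta>(1))
  define P where "P = (LINT x|lborel. v0 x powr \<theta> * \<alpha> x)"
  define A where "A n = \<sigma> * (c * (LINT p|lborel. v p powr s * tens (deriv \<alpha>) (\<lambda>t. \<beta> t * \<eta> n t) p))" for n
  define B where "B n = (LINT p|lborel. v p powr \<theta> * tens \<alpha> (\<lambda>t. deriv \<beta> t * \<eta> n t) p) - P * (LINT t|lborel. deriv \<beta> t * \<eta> n t)" for n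
  have "A n \<le> B n" for n
  proof -
    have nonneg: "0 \<le> \<beta> t * \<eta> n t" for t
      using \<beta>(2)[of t] \<eta>(2)[of n t] \<eta>0[of t n] by (cases "0 \<le> t") auto
    \<comment> \<open>\<beta> has a sign only for t \<ge> 0, but \<open>\<eta> n\<close> is constant
      for t < 0.\<close>
    have nonneg': "0 \<le> \<beta> t * deriv (\<eta> n) t" for t
    proof (cases "0 \<le> t")
      case False
      have "((\<lambda>t. 0) has_real_derivative 0) (at t)" by simp
      then have "(\<eta> n has_real_derivative 0) (at t)"
        by (rule has_field_derivative_transform_within_open[of _ _ _ "{..<0}"]) (use False \<eta>0 in auto)
      then show ?thesis by (simp add: DERIV_imp_deriv)
    qed (use \<beta>(2) \<eta>(4) in auto)
    have i: "integrable lborel (\<lambda>p. v p powr \<theta> * tens \<alpha> (\<lambda>t. deriv \<beta> t * \<eta> n t) p)"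
      "integrable lborel (\<lambda>p. v p powr \<theta> * tens \<alpha> (\<lambda>t. \<beta> t * deriv (\<eta> n) t) p)"
      by (intro v_powr_mult_tens[OF \<alpha>(1) tails(2) \<theta>0(1)] v_powr_mult_tens[OF \<alpha>(1) tails(3) \<theta>0(1)])+
    have "A n \<le> (LINT p|lborel. v p powr \<theta> * tens \<alpha> (deriv (\<lambda>t. \<beta> t * \<eta> n t)) p)"
      unfolding A_def by (intro flux_le_interior \<alpha> tails nonneg \<sigma>)
    also have "\<dots> = (LINT p|lborel. v p powr \<theta> * tens \<alpha> (\<lambda>t. deriv \<beta> t * \<eta> n t) p)
        + (LINT p|lborel. v p powr \<theta> * tens \<alpha> (\<lambda>t. \<beta> t * deriv (\<eta> n) t) p)"
      unfolding tens_deriv_mult[OF test_smooth[OF \<beta>(1)] \<eta>(1)] distrib_left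
      by (rule Bochner_Integration.integral_add[OF i])
    also have "(LINT p|lborel. v p powr \<theta> * tens \<alpha> (\<lambda>t. \<beta> t * deriv (\<eta> n) t) p)
        \<le> (LINT p|lborel. tens (\<lambda>x. v0 x powr \<theta> * \<alpha> x) (\<lambda>t. \<beta> t * deriv (\<eta> n) t) p)"
    proof (rule integral_mono_AE[OF i(2) integrable_tens(1)[OF v0_powr_mult_test[OF \<alpha>(1)] test_integrable[OF tails(3)]]])
      show "AE p in lborel. v p powr \<theta> * tens \<alpha> (\<lambda>t. \<beta> t * deriv (\<eta> n) t) p
          \<le> tens (\<lambda>x. v0 x powr \<theta> * \<alpha> x) (\<lambda>t. \<beta> t * deriv (\<eta> n) t) p"
        using v_le_v0
      proof eventually_elim
        case (elim p)
        have "v p powr \<theta> * tens \<alpha> (\<lambda>t. \<beta> t * deriv (\<eta> n) t) p \<le> v0 (fst p) powr \<theta> * tens \<alpha> (\<lambda>t. \<beta> t * deriv (\<eta> n) t) p"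
          using elim v_bounds(1) \<theta>0 by (intro mult_right_mono powr_mono2 tens_nonneg \<alpha>(2) nonneg') auto
        then show ?case by (simp add: tens_def mult.assoc)
      qed
    qed
    also have "\<dots> = P * (LINT t|lborel. \<beta> t * deriv (\<eta> n) t)"
      unfolding P_def by (rule integrable_tens(2)[OF v0_powr_mult_test[OF \<alpha>(1)] test_integrable[OF tails(3)]])
    \<comment> \<open>With the derivative moved onto \<beta>, pointwise limits of
      \<open>\<eta> n\<close> are enough; its derivative blows up as n grows.\<close>
    also have "(LINT t|lborel. \<beta> t * deriv (\<eta> n) t) = - (LINT t|lborel. deriv \<beta> t * \<eta> n t)"
    proof -
      have "deriv (\<lambda>t. \<beta> t * \<eta> n t) t = deriv \<beta> t * \<eta> n t + \<beta> t * deriv (\<eta> n) t" for t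
      proof (rule DERIV_imp_deriv)
        have "((\<lambda>t. \<beta> t * \<eta> n t) has_real_derivative deriv \<beta> t * \<eta> n t + deriv (\<eta> n) t * \<beta> t) (at t)"
          by (intro DERIV_mult test_DERIV[OF \<beta>(1)] smooth_DERIV \<eta>(1))
        then show "((\<lambda>t. \<beta> t * \<eta> n t) has_real_derivative deriv \<beta> t * \<eta> n t + \<beta> t * deriv (\<eta> n) t) (at t)"
          by (simp add: mult.commute)
      qed
      then have "0 = (LINT t|lborel. deriv \<beta> t * \<eta> n t + \<beta> t * deriv (\<eta> n) t)"
        using test_integral_deriv[OF tails(1)[of n]] by simp
      also have "\<dots> = (LINT t|lborel. deriv \<beta> t * \<eta> n t) + (LINT t|lborel. \<beta> t * deriv (\<eta> n) t)"
        by (rule Bochner_Integration.integral_add[OF test_integrable[OF tails(2)] test_integrable[OF tails(3)]])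
      finally show ?thesis by simp
    qed
    finally show ?thesis by (simp add: B_def)
  qed
  moreover have "A \<longlonglongrightarrow> \<sigma> * (c * (LINT p|lborel. v p powr s * tens (deriv \<alpha>) \<beta> p))"
    unfolding A_def
  proof (intro tendsto_mult_left)
    have i: "integrable lborel (\<lambda>p. v p powr s * tens (deriv \<alpha>) \<beta> p)"
      by (rule v_powr_mult_tens[OF test_deriv[OF \<alpha>(1)] \<beta>(1) \<theta>0(2)])
    show "(\<lambda>n. LINT p|lborel. v p powr s * tens (deriv \<alpha>) (\<lambda>t. \<beta> t * \<eta> n t) p)
        \<longlonglongrightarrow> (LINT p|lborel. v p powr s * tens (deriv \<alpha>) \<beta> p)"
    proof (rule integral_dominated_convergence[OF _ _ integrable_norm[OF i]])
      show "AE p in lborel. (\<lambda>n. v p powr s * tens (deriv \<alpha>) (\<lambda>t. \<beta> t * \<eta> n t) p)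
          \<longlonglongrightarrow> v p powr s * tens (deriv \<alpha>) \<beta> p"
      proof (rule AE_I2)
        fix p :: "real \<times> real"
        have "(\<lambda>n. v p powr s * (deriv \<alpha> (fst p) * (\<beta> (snd p) * \<eta> n (snd p))))
          \<longlonglongrightarrow> v p powr s * (deriv \<alpha> (fst p) * (\<beta> (snd p) * indicator {0<..} (snd p)))"
          by (intro tendsto_mult_left \<eta>_lim)
        then show "(\<lambda>n. v p powr s * tens (deriv \<alpha>) (\<lambda>t. \<beta> t * \<eta> n t) p)
          \<longlonglongrightarrow> v p powr s * tens (deriv \<alpha>) \<beta> p"
          by (cases "0 < snd p") (simp_all add: tens_def v_neg)
      qed
      show "AE p in lborel. norm (v p powr s * tens (deriv \<alpha>) (\<lambda>t. \<beta> t * \<eta> n t) p) \<le> norm (v p powr s * tens (deriv \<alpha>) \<beta> p)" for n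
        using \<eta>(2,3) by (intro AE_I2) (auto simp: tens_def abs_mult intro!: mult_left_mono mult_left_le)
    qed simp_all
  qed
  moreover have "B \<longlonglongrightarrow> (LINT p|lborel. v p powr \<theta> * tens \<alpha> (deriv \<beta>) p) - P * (- \<beta> 0)"
    unfolding B_def
  proof (intro tendsto_diff tendsto_mult_left)
    have i: "integrable lborel (\<lambda>p. v p powr \<theta> * tens \<alpha> (deriv \<beta>) p)"
      by (rule v_powr_mult_tens[OF \<alpha>(1) test_deriv[OF \<beta>(1)] \<theta>0(1)])
    show "(\<lambda>n. LINT p|lborel. v p powr \<theta> * tens \<alpha> (\<lambda>t. deriv \<beta> t * \<eta> n t) p)
        \<longlonglongrightarrow> (LINT p|lborel. v p powr \<theta> * tens \<alpha> (deriv \<beta>) p)"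
    proof (rule integral_dominated_convergence[OF _ _ integrable_norm[OF i]])
      show "AE p in lborel. (\<lambda>n. v p powr \<theta> * tens \<alpha> (\<lambda>t. deriv \<beta> t * \<eta> n t) p)
          \<longlonglongrightarrow> v p powr \<theta> * tens \<alpha> (deriv \<beta>) p"
      proof (rule AE_I2)
        fix p :: "real \<times> real"
        have "(\<lambda>n. v p powr \<theta> * (\<alpha> (fst p) * (deriv \<beta> (snd p) * \<eta> n (snd p))))
          \<longlonglongrightarrow> v p powr \<theta> * (\<alpha> (fst p) * (deriv \<beta> (snd p) * indicator {0<..} (snd p)))"
          by (intro tendsto_mult_left \<eta>_lim)
        then show "(\<lambda>n. v p powr \<theta> * tens \<alpha> (\<lambda>t. deriv \<beta> t * \<eta> n t) p)
          \<longlonglongrightarrow> v p powr \<theta> * tens \<alpha> (deriv \<beta>) p"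
          by (cases "0 < snd p") (simp_all add: tens_def v_neg)
      qed
      show "AE p in lborel. norm (v p powr \<theta> * tens \<alpha> (\<lambda>t. deriv \<beta> t * \<eta> n t) p) \<le> norm (v p powr \<theta> * tens \<alpha> (deriv \<beta>) p)" for n
        using \<eta>(2,3) by (intro AE_I2) (auto simp: tens_def abs_mult intro!: mult_left_mono mult_left_le)
    qed simp_all
    have i': "integrable lborel (deriv \<beta>)" by (rule test_integrable[OF test_deriv[OF \<beta>(1)]])
    have "(\<lambda>n. LINT t|lborel. deriv \<beta> t * \<eta> n t) \<longlonglongrightarrow> (LINT t|lborel. indicator {0<..} t * deriv \<beta> t)"
    proof (rule integral_dominated_convergence[OF _ _ integrable_norm[OF i']])
      show "AE t in lborel. (\<lambda>n. deriv \<beta> t * \<eta> n t) \<longlonglongrightarrow> indicator {0<..} t * deriv \<beta> t"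
        using tendsto_mult_left[OF \<eta>_lim] by (intro AE_I2) (simp add: mult.commute)
      show "AE t in lborel. norm (deriv \<beta> t * \<eta> n t) \<le> norm (deriv \<beta> t)" for n
        using \<eta>(2,3) by (intro AE_I2) (auto simp: abs_mult intro!: mult_left_le)
    qed simp_all
    then show "(\<lambda>n. LINT t|lborel. deriv \<beta> t * \<eta> n t) \<longlonglongrightarrow> - \<beta> 0"
      by (simp only: test_integral_half_line[OF \<beta>(1)])
  qed
  ultimately have "\<sigma> * (c * (LINT p|lborel. v p powr s * tens (deriv \<alpha>) \<beta> p))
      \<le> (LINT p|lborel. v p powr \<theta> * tens \<alpha> (deriv \<beta>) p) - P * (- \<beta> 0)"
    by (intro LIMSEQ_le[of A _ B]) auto
  then show ?thesis by (simp add: P_def mult.commute)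
qed

text \<open>Testing with \<open>\<kappa>(x) \<psi>(t)\<close>, where \<open>\<psi> = 1\<close> up to a large time: nonnegativity of \<open>v\<close> limits the mass
  that can leave the support of \<open>\<kappa>\<close>, whereas the flux through its two edges is bounded by the data.\<close>

lemma data_inequality:
  assumes \<kappa>: "test_function UNIV \<kappa>" "\<And>x. 0 \<le> \<kappa> x" "deriv \<kappa> = (\<lambda>x. A x - B x)"
    and A: "test_function UNIV A" "\<And>x. 0 \<le> A x" and B: "test_function UNIV B" "\<And>x. 0 \<le> B x"
  shows "0 \<le> L \<kappa> + (LINT x|lborel. v0 x powr \<theta> * A x) + (LINT x|lborel. v0 x powr \<theta> * B x)"
    (is "0 \<le> ?D")
proof (rule ccontr)
  assume neg: "\<not> 0 \<le> ?D"
  define m where "m = (LINT x|lborel. v0 x * \<kappa> x)"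
  have m: "0 \<le> m" unfolding m_def using v0_bounds \<kappa>(2) by (intro integral_nonneg_AE AE_I2) auto
  \<comment> \<open>T is the length of the plateau of \<psi>: the initial mass \<open>m\<close> is
    fixed, while the outflow accumulates linearly in T.\<close>
  have key: "0 \<le> m + T * ?D" if T: "0 < T" for T
  proof -
    obtain \<rho> :: "real \<Rightarrow> real" where \<rho>: "test_function {0..1} \<rho>" "\<And>x. 0 \<le> \<rho> x" "\<And>x. x \<notin> {0<..<1} \<Longrightarrow> \<rho> x = 0" "(LINT x|lborel. \<rho> x) = 1"
      by (rule unit_bump[of 0 1]) auto
    have \<rho>U: "test_function UNIV \<rho>" by (rule test_mono[OF \<rho>(1)]) simp
    have shift: "test_function UNIV (\<lambda>t. \<rho> (1 * t + d))" for d
      by (rule test_functionI[where a="-d" and b="1-d", OF smooth_affine[OF test_smooth[OF \<rho>U]]]) (auto intro!: \<rho>(3))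
    have "(LINT t|lborel. \<rho> (1 * t + d)) = 1" for d
      using lborel_integral_real_affine[of 1 \<rho> d] \<rho>(4) by (simp add: add.commute)
    note unit = this
    \<comment> \<open>\<psi> rises on (-1, 0), before the solution starts, and falls on (T, T + 1);
      equal masses give it compact support.\<close>
    have "(LINT t|lborel. \<rho> (1 * t + 1) - \<rho> (1 * t + (- T))) = 0"
      unfolding Bochner_Integration.integral_diff[OF test_integrable[OF shift] test_integrable[OF shift]] unit by simp
    then obtain \<psi> where \<psi>: "test_function UNIV \<psi>" "deriv \<psi> = (\<lambda>t. \<rho> (1 * t + 1) - \<rho> (1 * t + (- T)))"
      by (rule test_antiderivative_zero_mean[OF test_diff[OF shift shift] is_interval_univ UNIV_not_empty])
    have \<psi>': "deriv \<psi> t = - \<rho> (1 * t + (- T))" if "0 \<le> t" for t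
      using that \<rho>(3)[of "1 * t + 1"] by (simp add: \<psi>(2))
    have \<psi>_nonneg: "0 \<le> \<psi> t" if "0 \<le> t" for t
      by (rule test_nonneg_of_decreasing[OF \<psi>(1)]) (use that \<psi>' \<rho>(2) in auto)
    have \<psi>_flat: "\<psi> t = \<psi> 0" if t: "0 \<le> t" "t \<le> T" for t
    proof (cases "t = 0")
      case False
      then have "0 < t" using t by simp
      obtain z where "0 < z" "z < t" "\<psi> t - \<psi> 0 = (t - 0) * deriv \<psi> z"
        using MVT2[OF \<open>0 < t\<close> test_DERIV[OF \<psi>(1)]] by blast
      then show ?thesis using \<psi>'[of z] \<rho>(3)[of "1 * z + (- T)"] t by simp
    qed simp
    have \<psi>0: "\<psi> 0 = 1"
    proof -
      have "- \<psi> 0 = (LINT t|lborel. indicator {0<..} t * deriv \<psi> t)"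
        by (rule test_integral_half_line[OF \<psi>(1), symmetric])
      also have "\<dots> = (LINT t|lborel. - \<rho> (1 * t + (- T)))"
        by (rule Bochner_Integration.integral_cong[OF refl]) (use \<psi>' \<rho>(3) T in \<open>auto simp: indicator_def\<close>)
      also have "\<dots> = - 1" using unit[of "- T"] by simp
      finally show ?thesis by simp
    qed
    obtain \<beta> where \<beta>: "test_function UNIV \<beta>" "\<And>t. 0 \<le> t \<Longrightarrow> deriv \<beta> t = \<psi> t" "\<And>t. 0 \<le> t \<Longrightarrow> deriv (deriv \<beta>) t = deriv \<psi> t"
      using half_line_antiderivative[OF \<psi>(1)] by metis
    \<comment> \<open>For t \<ge> 0 this is the integral of \<psi> from t to infinity: nonnegative,
      decreasing, and at least T at t = 0.\<close>
    define \<Psi> where "\<Psi> t = - \<beta> t" for t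
    have \<Psi>: "test_function UNIV \<Psi>" unfolding \<Psi>_def[abs_def] by (rule test_minus[OF \<beta>(1)])
    have \<Psi>': "deriv \<Psi> t = - deriv \<beta> t" for t
      unfolding \<Psi>_def[abs_def] by (intro DERIV_imp_deriv DERIV_minus test_DERIV[OF \<beta>(1)])
    have \<Psi>_nonneg: "0 \<le> \<Psi> t" if "0 \<le> t" for t
      by (rule test_nonneg_of_decreasing[OF \<Psi>]) (use that \<Psi>' \<beta>(2) \<psi>_nonneg in auto)
    have \<Psi>0: "T \<le> \<Psi> 0"
    proof -
      obtain z where z: "0 < z" "z < T" "\<Psi> T - \<Psi> 0 = (T - 0) * deriv \<Psi> z"
        using MVT2[OF T test_DERIV[OF \<Psi>]] by blast
      then have "\<Psi> T - \<Psi> 0 = - T" using \<Psi>'[of z] \<beta>(2)[of z] \<psi>_flat[of z] \<psi>0 by simp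
      then show ?thesis using \<Psi>_nonneg[of T] T by simp
    qed
    have \<theta>0: "0 \<le> \<theta>" "0 \<le> s" using exponents(1) s by auto
    have edge: "\<sigma> * (c * (LINT p|lborel. v p powr s * tens (deriv E) \<Psi> p)) \<le> \<Psi> 0 * (LINT x|lborel. v0 x powr \<theta> * E x)"
      if "test_function UNIV E" "\<And>x. 0 \<le> E x" "\<bar>\<sigma>\<bar> = 1" for E \<sigma>
    proof -
      have "(LINT p|lborel. v p powr \<theta> * tens E (deriv \<Psi>) p) \<le> (LINT p|(lborel :: (real \<times> real) measure). 0)"
      proof (rule integral_mono)
        show "integrable lborel (\<lambda>p. v p powr \<theta> * tens E (deriv \<Psi>) p)"
          by (rule v_powr_mult_tens[OF that(1) test_deriv[OF \<Psi>] \<theta>0(1)])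
        show "v p powr \<theta> * tens E (deriv \<Psi>) p \<le> 0" for p
        proof (cases "snd p \<le> 0")
          case False
          then have "0 \<le> v p powr \<theta> * (E (fst p) * \<psi> (snd p))"
            using that(2) \<psi>_nonneg by auto
          then show ?thesis using False by (simp add: tens_def \<Psi>' \<beta>(2))
        qed (simp add: v_neg)
      qed simp
      then show ?thesis
        using flux_le[OF that(1,2) \<Psi> \<Psi>_nonneg that(3)] by simp
    qed
    have A': "(LINT p|lborel. v p powr s * tens (deriv (deriv \<kappa>)) \<beta> p)
        = (LINT p|lborel. v p powr s * tens (deriv B) \<Psi> p) - (LINT p|lborel. v p powr s * tens (deriv A) \<Psi> p)"
    proof -
      have "deriv (\<lambda>x. A x - B x) x = deriv A x - deriv B x" for x
        by (intro DERIV_imp_deriv DERIV_diff test_DERIV[OF A(1)] test_DERIV[OF B(1)])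
      note this [simp]
      have "v p powr s * tens (deriv (deriv \<kappa>)) \<beta> p = v p powr s * tens (deriv B) \<Psi> p - v p powr s * tens (deriv A) \<Psi> p" for p
        by (simp add: \<kappa>(3) tens_def \<Psi>_def) (simp add: algebra_simps)
      then show ?thesis
        by (simp add: Bochner_Integration.integral_diff[OF v_powr_mult_tens[OF test_deriv[OF B(1)] \<Psi> \<theta>0(2)] v_powr_mult_tens[OF test_deriv[OF A(1)] \<Psi> \<theta>0(2)]])
    qed
    \<comment> \<open>This term is minus a weighted mean over (T, T + 1) of the mass remaining under
      \<kappa>.\<close>
    have "(LINT p|lborel. v p * tens \<kappa> (deriv (deriv \<beta>)) p) \<le> (LINT p|(lborel :: (real \<times> real) measure). 0)"
    proof (rule integral_mono)
      show "integrable lborel (\<lambda>p. v p * tens \<kappa> (deriv (deriv \<beta>)) p)"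
        by (rule v_mult_tens[OF \<kappa>(1) test_deriv[OF test_deriv[OF \<beta>(1)]]])
      show "v p * tens \<kappa> (deriv (deriv \<beta>)) p \<le> 0" for p
      proof (cases "snd p \<le> 0")
        case False
        have "0 \<le> v p * (\<kappa> (fst p) * \<rho> (1 * snd p + (- T)))"
          using v_bounds(1) \<kappa>(2) \<rho>(2) by (intro mult_nonneg_nonneg)
        then show ?thesis using False by (simp add: tens_def \<beta>(3) \<psi>')
      qed (simp add: v_neg)
    qed simp
    then have 1: "(LINT p|lborel. v p * tens \<kappa> (deriv (deriv \<beta>)) p) \<le> 0" by simp
    have 2: "(LINT p|lborel. v p * tens \<kappa> (deriv (deriv \<beta>)) p)
        - c * ((LINT p|lborel. v p powr s * tens (deriv B) \<Psi> p) - (LINT p|lborel. v p powr s * tens (deriv A) \<Psi> p))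
        + m + \<Psi> 0 * L \<kappa> = 0"
      using wave[OF \<kappa>(1) \<beta>(1)] unfolding A' by (simp add: m_def \<beta>(2) \<psi>0 \<Psi>_def)
    \<comment> \<open>The two edges enter the flux with opposite signs, hence the opposite choices
      of \<sigma>.\<close>
    have "0 \<le> m + \<Psi> 0 * ?D"
      using 1 2 edge[OF A, of 1] edge[OF B, of "-1"] by (simp add: algebra_simps)
    also have "\<dots> \<le> m + T * ?D"
      using neg \<Psi>0 by (simp add: mult_right_mono_neg)
    finally show ?thesis .
  qed
  \<comment> \<open>This value of T makes \<open>m + T * ?D\<close> equal to -1.\<close>
  have "0 < (m + 1) / (- ?D)" using m neg by (intro divide_pos_pos) auto
  from key[OF this] have "0 \<le> m + (m + 1) / (- ?D) * ?D" .
  also have "\<dots> = -1" using neg by (simp add: field_simps)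
  finally show False by simp
qed

end

section \<open>Borel representatives\<close>

lemma lebesgue_measurable_AE:
  fixes F F' :: "'a::euclidean_space \<Rightarrow> real"
  assumes F': "F' \<in> borel_measurable borel" and eq: "AE x in lborel. F x = F' x"
  shows "F \<in> borel_measurable lebesgue"
proof (rule measurableI)
  fix B :: "real set" assume B: "B \<in> sets borel"
  have "F' -` B \<in> sets borel" using measurable_sets[OF F' B] by simp
  then have 1: "F' -` B \<in> sets (completion lborel)" by (intro sets_completionI_sets) simp
  have 2: "AE x in completion lborel. x \<in> F' -` B \<longleftrightarrow> x \<in> F -` B"
    using AE_completion[OF eq] by eventually_elim auto
  have "F -` B \<in> sets (completion lborel)"
    by (rule completion.in_sets_AE[OF 2 1]) simp
  then show "F -` B \<inter> space lebesgue \<in> sets lebesgue" by simp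
qed simp

lemma lebesgue_integral_rep:
  fixes F F' :: "'a::euclidean_space \<Rightarrow> real"
  assumes F': "F' \<in> borel_measurable borel" and eq: "AE x in lborel. F x = F' x"
  shows "integral\<^sup>L lebesgue F = integral\<^sup>L lborel F'" "integrable lebesgue F \<longleftrightarrow> integrable lborel F'"
proof -
  have m1: "F' \<in> borel_measurable lborel" using F' by simp
  note m = m1 lebesgue_measurable_AE[OF assms] measurable_completion[OF m1]
  have "integral\<^sup>L lebesgue F = integral\<^sup>L lebesgue F'"
    by (rule integral_cong_AE[OF m(2,3) AE_completion[OF eq]])
  then show "integral\<^sup>L lebesgue F = integral\<^sup>L lborel F'" using integral_completion[OF m(1)] by simp
  have "integrable lebesgue F \<longleftrightarrow> integrable lebesgue F'"
    by (rule integrable_cong_AE[OF m(2,3) AE_completion[OF eq]])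
  then show "integrable lebesgue F \<longleftrightarrow> integrable lborel F'" using integrable_completion[OF m(1)] by simp
qed

text \<open>A Borel representative that is zero off \<Omega> turns Lebesgue integrals over \<Omega>
  into \<open>lborel\<close> integrals over the whole space, to which Fubini applies.\<close>

lemma lebesgue_on_integral_rep:
  fixes F F' :: "'a::euclidean_space \<Rightarrow> real"
  assumes \<Omega>: "\<Omega> \<in> sets borel" and F': "F' \<in> borel_measurable borel"
    and eq: "AE x in lborel. x \<in> \<Omega> \<longrightarrow> F x = F' x" and zero: "\<And>x. x \<notin> \<Omega> \<Longrightarrow> F' x = 0"
  shows "integral\<^sup>L (lebesgue_on \<Omega>) F = integral\<^sup>L lborel F'"
    "integrable (lebesgue_on \<Omega>) F \<longleftrightarrow> integrable lborel F'"
proof -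
  have \<Omega>': "\<Omega> \<inter> space lebesgue \<in> sets lebesgue" using \<Omega> by simp
  have eq': "AE x in lborel. indicator \<Omega> x *\<^sub>R F x = F' x"
    using eq by eventually_elim (auto simp: indicator_def zero)
  show "integral\<^sup>L (lebesgue_on \<Omega>) F = integral\<^sup>L lborel F'"
    unfolding integral_restrict_space[OF \<Omega>'] by (rule lebesgue_integral_rep[OF F' eq'])
  show "integrable (lebesgue_on \<Omega>) F \<longleftrightarrow> integrable lborel F'"
    unfolding integrable_restrict_space[OF \<Omega>'] by (rule lebesgue_integral_rep[OF F' eq'])
qed

lemma AE_lebesgue_on_iff:
  fixes P :: "'a::euclidean_space \<Rightarrow> bool"
  assumes "\<Omega> \<in> sets borel"
  shows "(AE x in lebesgue_on \<Omega>. P x) \<longleftrightarrow> (AE x in lborel. x \<in> \<Omega> \<longrightarrow> P x)"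
  using assms by (subst AE_restrict_space_iff) (simp_all add: AE_completion_iff)

lemma halfplane_borel: "halfplane \<in> sets borel"
  unfolding halfplane_def by (intro borel_open open_Times) auto

lemma mem_halfplane: "p \<in> halfplane \<longleftrightarrow> 0 < snd p"
  by (cases p) (auto simp: halfplane_def)

text \<open>Clamping at the essential bound turns a bound almost everywhere into a bound everywhere.
  The absolute value of \<open>B\<close> guards against a negative bound, which can occur when
  \<Omega> is null.\<close>

lemma Linf_rep:
  fixes u :: "'a::euclidean_space \<Rightarrow> real"
  assumes u: "u \<in> Linf \<Omega>" and \<Omega>: "\<Omega> \<in> sets borel"
  obtains u' B where "u' \<in> borel_measurable borel" "\<And>x. \<bar>u' x\<bar> \<le> B" "\<And>x. x \<notin> \<Omega> \<Longrightarrow> u' x = 0"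
    "AE x in lborel. x \<in> \<Omega> \<longrightarrow> u x = u' x"
proof -
  have [measurable]: "\<Omega> \<in> sets borel" by (rule \<Omega>)
  have "(\<lambda>x. indicator \<Omega> x *\<^sub>R u x) \<in> borel_measurable lebesgue"
    using u \<Omega> by (subst borel_measurable_restrict_space_iff[symmetric]) (auto simp: Linf_def)
  then obtain f where f: "f \<in> borel_measurable lborel" "AE x in lborel. indicator \<Omega> x *\<^sub>R u x = f x"
    using completion_ex_borel_measurable_real by blast
  have [measurable]: "f \<in> borel_measurable borel" using f(1) by simp
  obtain B where B: "AE x in lborel. x \<in> \<Omega> \<longrightarrow> \<bar>u x\<bar> \<le> B"
    using u \<Omega> by (auto simp: Linf_def AE_lebesgue_on_iff)
  define u' where "u' x = indicator \<Omega> x * max (- \<bar>B\<bar>) (min \<bar>B\<bar> (f x))" for x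
  show ?thesis
  proof (rule that[of u' "\<bar>B\<bar>"])
    show "u' \<in> borel_measurable borel" unfolding u'_def by measurable
    show "\<bar>u' x\<bar> \<le> \<bar>B\<bar>" for x by (auto simp: u'_def indicator_def)
    show "AE x in lborel. x \<in> \<Omega> \<longrightarrow> u x = u' x"
      using B f(2) by eventually_elim (auto simp: u'_def indicator_def)
  qed (simp add: u'_def)
qed

lemma Linf_rep_nonneg:
  fixes u :: "'a::euclidean_space \<Rightarrow> real"
  assumes u: "u \<in> Linf \<Omega>" and \<Omega>: "\<Omega> \<in> sets borel" and nonneg: "AE x in lebesgue_on \<Omega>. 0 \<le> u x"
  obtains u' B where "u' \<in> borel_measurable borel" "\<And>x. 0 \<le> u' x" "\<And>x. u' x \<le> B" "\<And>x. x \<notin> \<Omega> \<Longrightarrow> u' x = 0"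
    "AE x in lborel. x \<in> \<Omega> \<longrightarrow> u x = u' x"
proof -
  obtain f B where f: "f \<in> borel_measurable borel" "\<And>x. \<bar>f x\<bar> \<le> B" "\<And>x. x \<notin> \<Omega> \<Longrightarrow> f x = 0"
    "AE x in lborel. x \<in> \<Omega> \<longrightarrow> u x = f x"
    using Linf_rep[OF u \<Omega>] by metis
  have "0 \<le> B" using order_trans[OF abs_ge_zero f(2)] .
  show ?thesis
  proof (rule that[of "\<lambda>x. max 0 (f x)" B])
    show "(\<lambda>x. max 0 (f x)) \<in> borel_measurable borel" using f(1) by measurable
    show "max 0 (f x) \<le> B" for x using f(2)[of x] \<open>0 \<le> B\<close> by auto
    show "AE x in lborel. x \<in> \<Omega> \<longrightarrow> u x = max 0 (f x)"
      using f(4) nonneg[unfolded AE_lebesgue_on_iff[OF \<Omega>]] by eventually_elim auto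
  qed (use f(3) in auto)
qed

text \<open>Local integrability supplies measurability only on compact sets; the half-plane is
  exhausted by closed boxes, and the limit of the truncated functions is measurable.\<close>

lemma loc_int_rep:
  assumes g: "locally_integrable halfplane g"
  obtains g' where "loc_int g'" "\<And>p. snd p \<le> 0 \<Longrightarrow> g' p = 0" "AE p in lborel. 0 < snd p \<longrightarrow> g p = g' p"
proof -
  have [measurable]: "halfplane \<in> sets borel" by (rule halfplane_borel)
  have cbox_sub: "cbox (a, c) (b, d) \<subseteq> halfplane" if "0 < c" for a b c d :: real
    using that by (auto simp: mem_halfplane cbox_Pair_eq)
  have int: "integrable lebesgue (\<lambda>p. indicator (cbox (a, c) (b, d)) p * g p)" if "0 < c" for a b c d :: real
  proof -
    have "integrable (lebesgue_on (cbox (a, c) (b, d))) g"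
      using g cbox_sub[OF that] by (auto simp: locally_integrable_def)
    then show ?thesis by (subst (asm) integrable_restrict_space) auto
  qed
  let ?K = "\<lambda>n::nat. cbox (- real n, 1 / (real n + 1)) (real n, real n)"
  have "(\<lambda>p. indicator halfplane p * g p) \<in> borel_measurable lebesgue"
  proof (rule borel_measurable_LIMSEQ_real)
    show "(\<lambda>p. indicator (?K n) p * g p) \<in> borel_measurable lebesgue" for n
      using int[of "1 / (real n + 1)"] by auto
    fix p :: "real \<times> real"
    show "(\<lambda>n. indicator (?K n) p * g p) \<longlonglongrightarrow> indicator halfplane p * g p"
    proof (cases "0 < snd p")
      case False
      then have "p \<notin> ?K n" for n using cbox_sub[of "1 / (real n + 1)"] mem_halfplane[of p] by fastforce
      then show ?thesis using False by (simp add: mem_halfplane)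
    next
      case True
      obtain n1 :: nat where n1: "1 / snd p < real n1" using reals_Archimedean2 by blast
      obtain n2 :: nat where n2: "\<bar>fst p\<bar> + \<bar>snd p\<bar> < real n2" using reals_Archimedean2 by blast
      have "p \<in> ?K n" if "max n1 n2 \<le> n" for n
      proof -
        have "1 / snd p < real n + 1" "\<bar>fst p\<bar> + \<bar>snd p\<bar> < real n" using n1 n2 that by auto
        then show ?thesis using True by (cases p) (auto simp: cbox_Pair_eq field_simps)
      qed
      then have "\<forall>\<^sub>F n in sequentially. indicator (?K n) p * g p = indicator halfplane p * g p"
        using True by (auto simp: eventually_sequentially mem_halfplane intro!: exI[of _ "max n1 n2"])
      then show ?thesis by (rule tendsto_eventually)
    qed
  qed
  then obtain f where f: "f \<in> borel_measurable lborel" "AE p in lborel. indicator halfplane p * g p = f p"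
    using completion_ex_borel_measurable_real by blast
  have [measurable]: "f \<in> borel_measurable borel" using f(1) by simp
  define g' where "g' p = indicator halfplane p * f p" for p
  have eq: "AE p in lborel. 0 < snd p \<longrightarrow> g p = g' p"
    using f(2) by eventually_elim (auto simp: g'_def indicator_def mem_halfplane)
  have [measurable]: "g' \<in> borel_measurable borel" unfolding g'_def[abs_def] by measurable
  have "loc_int g'"
    unfolding loc_int_def
  proof (intro conjI allI impI)
    fix a b c d :: real assume c: "0 < c"
    have "AE p in lborel. indicator (cbox (a, c) (b, d)) p * g p = indicator (cbox (a, c) (b, d)) p * g' p"
      using eq
    proof eventually_elim
      case (elim p)
      have "p \<in> cbox (a, c) (b, d) \<Longrightarrow> 0 < snd p" using cbox_sub[OF c, of a b d] mem_halfplane[of p] by blast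
      then show ?case using elim by (cases "p \<in> cbox (a, c) (b, d)") auto
    qed
    from lebesgue_integral_rep(2)[OF _ this] int[OF c]
    have "integrable lborel (\<lambda>p. indicator (cbox (a, c) (b, d)) p * g' p)" by simp
    then have "integrable lborel (\<lambda>p. indicator (box (a, c) (b, d)) p *\<^sub>R (indicator (cbox (a, c) (b, d)) p * g' p))"
      by (intro integrable_mult_indicator) auto
    moreover have "indicator (box (a, c) (b, d)) p *\<^sub>R (indicator (cbox (a, c) (b, d)) p * g' p) = indicator (box (a, c) (b, d)) p * g' p" for p
      using box_subset_cbox[of "(a, c)" "(b, d)"] by (auto simp: indicator_def)
    ultimately show "integrable lborel (\<lambda>p. indicator (box (a, c) (b, d)) p * g' p)" by (simp only:)
  qed simp
  then show ?thesis
    by (rule that) (use eq in \<open>auto simp: g'_def mem_halfplane\<close>)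
qed

lemma test_pos_zero:
  fixes \<beta> :: "real \<Rightarrow> real"
  assumes "test_function {0<..} \<beta>" "t \<le> 0" shows "\<beta> t = 0"
  using assms closure_subset[of "{x. \<beta> x \<noteq> 0}"] unfolding test_function_def by (auto simp: subset_iff)

lemma halfplane_integral_tens:
  assumes f': "f' \<in> borel_measurable borel" and eq: "AE p in lborel. 0 < snd p \<longrightarrow> f p = f' p"
    and \<alpha>: "test_function UNIV \<alpha>" and \<beta>: "test_function {0<..} \<beta>"
  shows "(LINT p|lebesgue_on halfplane. f p * tens \<alpha> \<beta> p) = (LINT p|lborel. f' p * tens \<alpha> \<beta> p)"
proof (rule lebesgue_on_integral_rep(1)[OF halfplane_borel])
  show "(\<lambda>p. f' p * tens \<alpha> \<beta> p) \<in> borel_measurable borel"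
    using borel_measurable_tens[OF test_borel[OF \<alpha>] test_borel[OF \<beta>]] f' by measurable
  show "AE p in lborel. p \<in> halfplane \<longrightarrow> f p * tens \<alpha> \<beta> p = f' p * tens \<alpha> \<beta> p"
    using eq by eventually_elim (auto simp: mem_halfplane)
  show "f' p * tens \<alpha> \<beta> p = 0" if "p \<notin> halfplane" for p
    using that test_pos_zero[OF \<beta>, of "snd p"] by (auto simp: mem_halfplane tens_def)
qed

lemma has_weak_deriv_rep:
  assumes fg: "has_weak_deriv d halfplane f g"
    and f': "f' \<in> borel_measurable borel" "AE p in lborel. 0 < snd p \<longrightarrow> f p = f' p"
    and g': "g' \<in> borel_measurable borel" "AE p in lborel. 0 < snd p \<longrightarrow> g p = g' p"
  shows "d = (1, 0) \<Longrightarrow> weak_x f' g'" "d = (0, 1) \<Longrightarrow> weak_t f' g'"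
proof -
  have *: "(LINT p|lebesgue_on halfplane. f p * dir_deriv d (tens \<alpha> \<beta>) p) = - (LINT p|lborel. g' p * tens \<alpha> \<beta> p)"
    if \<alpha>: "test_function UNIV \<alpha>" and \<beta>: "test_function {0<..} \<beta>" for \<alpha> \<beta>
  proof -
    have "test_function halfplane (tens \<alpha> \<beta>)" by (rule test_tens[OF \<alpha> \<beta>]) (simp add: halfplane_def)
    then show ?thesis using fg halfplane_integral_tens[OF g' \<alpha> \<beta>] by (auto simp: has_weak_deriv_def)
  qed
  show "weak_x f' g'" if "d = (1, 0)"
    unfolding weak_x_def
  proof (intro allI impI)
    fix \<alpha> \<beta> :: "real \<Rightarrow> real" assume \<alpha>: "test_function UNIV \<alpha>" and \<beta>: "test_function {0<..} \<beta>"
    show "(LINT p|lborel. f' p * tens (deriv \<alpha>) \<beta> p) = - (LINT p|lborel. g' p * tens \<alpha> \<beta> p)"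
      using *[OF \<alpha> \<beta>] halfplane_integral_tens[OF f' test_deriv[OF \<alpha>] \<beta>]
      by (simp add: that dir_deriv_tens(1)[OF test_smooth[OF \<alpha>] test_smooth[OF \<beta>]])
  qed
  show "weak_t f' g'" if "d = (0, 1)"
    unfolding weak_t_def
  proof (intro allI impI)
    fix \<alpha> \<beta> :: "real \<Rightarrow> real" assume \<alpha>: "test_function UNIV \<alpha>" and \<beta>: "test_function {0<..} \<beta>"
    show "(LINT p|lborel. f' p * tens \<alpha> (deriv \<beta>) p) = - (LINT p|lborel. g' p * tens \<alpha> \<beta> p)"
      using *[OF \<alpha> \<beta>] halfplane_integral_tens[OF f' \<alpha> test_deriv[OF \<beta>]]
      by (simp add: that dir_deriv_tens(2)[OF test_smooth[OF \<alpha>] test_smooth[OF \<beta>]])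
  qed
qed

lemma weak_x_add:
  assumes "weak_x f g" "weak_x f' g'" and f: "f \<in> borel_measurable borel" "\<And>p. \<bar>f p\<bar> \<le> B"
    and f': "f' \<in> borel_measurable borel" "\<And>p. \<bar>f' p\<bar> \<le> B'" and g: "loc_int g" "loc_int g'"
  shows "weak_x (\<lambda>p. f p + k * f' p) (\<lambda>p. g p + k * g' p)"
  unfolding weak_x_def
proof (intro allI impI)
  fix \<alpha> \<beta> :: "real \<Rightarrow> real" assume \<alpha>: "test_function UNIV \<alpha>" and \<beta>: "test_function {0<..} \<beta>"
  note i = bounded_mult_tens[OF f test_deriv[OF \<alpha>] \<beta>] bounded_mult_tens[OF f' test_deriv[OF \<alpha>] \<beta>]
    loc_int_mult_tens[OF g(1) \<alpha> \<beta>] loc_int_mult_tens[OF g(2) \<alpha> \<beta>]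
  have "(LINT p|lborel. (f p + k * f' p) * tens (deriv \<alpha>) \<beta> p)
      = (LINT p|lborel. f p * tens (deriv \<alpha>) \<beta> p + k * (f' p * tens (deriv \<alpha>) \<beta> p))"
    by (simp add: algebra_simps)
  also have "\<dots> = - (LINT p|lborel. g p * tens \<alpha> \<beta> p) - k * (LINT p|lborel. g' p * tens \<alpha> \<beta> p)"
    using i weak_xD[OF assms(1) \<alpha> \<beta>] weak_xD[OF assms(2) \<alpha> \<beta>] by simp
  also have "\<dots> = - (LINT p|lborel. g p * tens \<alpha> \<beta> p + k * (g' p * tens \<alpha> \<beta> p))"
    using i by simp
  also have "\<dots> = - (LINT p|lborel. (g p + k * g' p) * tens \<alpha> \<beta> p)"
    by (simp add: algebra_simps)
  finally show "(LINT p|lborel. (f p + k * f' p) * tens (deriv \<alpha>) \<beta> p) = - (LINT p|lborel. (g p + k * g' p) * tens \<alpha> \<beta> p)" .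
qed

section \<open>Monotone functions\<close>

text \<open>By the second mean value theorem the integral equals (m a - m b) \<alpha>(c) for some c,
  because \<alpha>' integrates to \<alpha>(c) on the left of c and to - \<alpha>(c) on the
  right.\<close>

lemma antimono_mult_test_deriv:
  fixes m \<alpha> :: "real \<Rightarrow> real"
  assumes m: "antimono m" and \<alpha>: "test_function UNIV \<alpha>" "\<And>x. 0 \<le> \<alpha> x"
  shows "0 \<le> (LINT x|lborel. m x * deriv \<alpha> x)"
proof -
  obtain a b where ab: "a < b" "test_function {a<..<b} \<alpha>" using test_enlarge_UNIV[OF \<alpha>(1)] by blast
  have zero: "\<alpha> x = 0" "deriv \<alpha> x = 0" if "x \<notin> {a<..<b}" for x
    using test_Ioo_zero[OF ab(2) that] by auto
  have mono: "mono (\<lambda>x. - m x)" using m by (auto simp: mono_def antimono_def)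
  have "(\<lambda>x. - m x) \<in> borel_measurable borel" by (rule borel_measurable_mono[OF mono])
  then have [measurable]: "m \<in> borel_measurable borel" by simp
  have [measurable]: "deriv \<alpha> \<in> borel_measurable borel" by (rule test_borel[OF test_deriv[OF \<alpha>(1)]])
  have ftc: "(deriv \<alpha> has_integral (\<alpha> y - \<alpha> x)) {x..y}" if "x \<le> y" for x y
    using test_DERIV[OF \<alpha>(1)]
    by (intro fundamental_theorem_of_calculus[OF that] has_vector_derivative_at_within[of _ _ _ "{x..y}"])
      (simp add: has_real_derivative_iff_has_vector_derivative)
  have int: "integrable lborel (\<lambda>x. - m x * deriv \<alpha> x)"
  proof -
    have "integrable lborel (\<lambda>x. deriv \<alpha> x * (indicator {a..b} x * (- m x)))"
    proof (rule integrable_mult_bounded[OF test_integrable[OF test_deriv[OF \<alpha>(1)]]])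
      show "\<bar>indicator {a..b} x * (- m x)\<bar> \<le> \<bar>m a\<bar> + \<bar>m b\<bar>" for x
        using antimonoD[OF m, of a x] antimonoD[OF m, of x b] by (auto simp: indicator_def)
    qed simp
    moreover have "deriv \<alpha> x * (indicator {a..b} x * (- m x)) = - m x * deriv \<alpha> x" for x
      using zero(2)[of x] by (cases "x \<in> {a<..<b}") auto
    ultimately show ?thesis by (simp only:)
  qed
  obtain c where c: "c \<in> {a..b}"
    "integral {a..b} (\<lambda>x. - m x * deriv \<alpha> x) = - m a * integral {a..c} (deriv \<alpha>) + - m b * integral {c..b} (deriv \<alpha>)"
  proof (rule second_mean_value_theorem[of "deriv \<alpha>" a b "\<lambda>x. - m x"])
    show "deriv \<alpha> integrable_on {a..b}" using ftc[of a b] ab(1) by (auto intro: has_integral_integrable)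
    show "- m x \<le> - m y" if "x \<le> y" for x y by (rule monoD[OF mono that])
  qed (use ab(1) in auto)
  have "((\<lambda>x. - m x * deriv \<alpha> x) has_integral (LINT x|lborel. - m x * deriv \<alpha> x)) UNIV"
    by (rule has_integral_integral_lborel[OF int])
  moreover have "(\<lambda>x. - m x * deriv \<alpha> x) = (\<lambda>x. if x \<in> {a..b} then - m x * deriv \<alpha> x else 0)"
    (is "_ = ?r")
  proof
    show "- m x * deriv \<alpha> x = (if x \<in> {a..b} then - m x * deriv \<alpha> x else 0)" for x
      using zero(2)[of x] by (cases "x \<in> {a<..<b}") auto
  qed
  ultimately have "(?r has_integral (LINT x|lborel. - m x * deriv \<alpha> x)) UNIV" by metis
  then have "((\<lambda>x. - m x * deriv \<alpha> x) has_integral (LINT x|lborel. - m x * deriv \<alpha> x)) {a..b}"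
    by (simp only: has_integral_restrict_UNIV)
  then have "(LINT x|lborel. - m x * deriv \<alpha> x) = integral {a..b} (\<lambda>x. - m x * deriv \<alpha> x)"
    by (rule integral_unique[symmetric])
  also have "\<dots> = - m a * (\<alpha> c - \<alpha> a) + - m b * (\<alpha> b - \<alpha> c)"
    using c ftc[of a c] ftc[of c b] by (simp add: integral_unique)
  also have "\<dots> = - ((m a - m b) * \<alpha> c)" using zero(1)[of a] zero(1)[of b] by (simp add: algebra_simps)
  finally have "(LINT x|lborel. m x * deriv \<alpha> x) = (m a - m b) * \<alpha> c" by simp
  then show ?thesis using antimonoD[OF m, of a b] ab(1) \<alpha>(2)[of c] by simp
qed

lemma Fubini_snd:
  fixes f :: "real \<times> real \<Rightarrow> real"
  assumes "integrable lborel f"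
  shows "(LINT p|lborel. f p) = (LINT t|lborel. LINT x|lborel. f (x, t))"
    and "integrable lborel (\<lambda>t. LINT x|lborel. f (x, t))"
proof -
  have b: "f \<in> borel_measurable borel" using assms by auto
  have i: "integrable lborel (\<lambda>p. f (prod.swap p))" using plane_swap(2)[OF b] assms by simp
  show "(LINT p|lborel. f p) = (LINT t|lborel. LINT x|lborel. f (x, t))"
    using plane_Fubini(1)[OF i] plane_swap(1)[OF b] by simp
  show "integrable lborel (\<lambda>t. LINT x|lborel. f (x, t))"
    using plane_Fubini(2)[OF i] by simp
qed

lemma AE_snd:
  fixes P :: "real \<times> real \<Rightarrow> bool"
  assumes "AE p in lborel. P p" shows "AE t in lborel. AE x in lborel. P (x, t)"
  using plane_AE[OF plane_swap_AE[OF assms]] by simp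

definition decr :: "(real \<times> real \<Rightarrow> real) \<Rightarrow> bool" where
  "decr f \<longleftrightarrow> (AE t in lborel. 0 < t \<longrightarrow> (\<exists>m. antimono m \<and> (AE x in lborel. f (x, t) = m x)))"

text \<open>On almost every slice \<open>antimono_mult_test_deriv\<close> gives a sign, and Fubini
  integrates it against \<beta> \<ge> 0.\<close>

lemma decr_weak_deriv_nonpos:
  assumes d: "decr f" and w: "weak_x f F" and f: "f \<in> borel_measurable borel" "\<And>p. \<bar>f p\<bar> \<le> B" and F: "loc_int F"
  shows "AE p in lborel. 0 < snd p \<longrightarrow> F p \<le> 0"
proof -
  have "AE p in lborel. 0 < snd p \<longrightarrow> 0 \<le> (- 1) * F p"
  proof (rule AE_nonneg_halfplane[OF loc_int_scale[OF F]])
    fix \<alpha> \<beta> :: "real \<Rightarrow> real"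
    assume \<alpha>: "test_function UNIV \<alpha>" and \<beta>: "test_function {0<..} \<beta>" and nonneg: "\<forall>x. 0 \<le> \<alpha> x" "\<forall>t. 0 \<le> \<beta> t"
    have [measurable]: "f \<in> borel_measurable borel" by (rule f(1))
    have [measurable]: "deriv \<alpha> \<in> borel_measurable borel" by (rule test_borel[OF test_deriv[OF \<alpha>]])
    have i: "integrable lborel (\<lambda>p. f p * tens (deriv \<alpha>) \<beta> p)"
      by (rule bounded_mult_tens[OF f test_deriv[OF \<alpha>] \<beta>])
    have "0 \<le> (LINT t|lborel. LINT x|lborel. f (x, t) * tens (deriv \<alpha>) \<beta> (x, t))"
    proof (rule integral_nonneg_AE)
      show "AE t in lborel. 0 \<le> (LINT x|lborel. f (x, t) * tens (deriv \<alpha>) \<beta> (x, t))"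
        using d[unfolded decr_def]
      proof eventually_elim
        case (elim t)
        show ?case
        proof (cases "0 < t")
          case True
          then obtain m where m: "antimono m" "AE x in lborel. f (x, t) = m x" using elim by auto
          have "(\<lambda>x. - m x) \<in> borel_measurable borel"
            by (rule borel_measurable_mono) (use m(1) in \<open>auto simp: mono_def antimono_def\<close>)
          then have [measurable]: "m \<in> borel_measurable borel" by simp
          have "(LINT x|lborel. f (x, t) * tens (deriv \<alpha>) \<beta> (x, t)) = (LINT x|lborel. \<beta> t * (m x * deriv \<alpha> x))"
          proof (rule integral_cong_AE)
            show "AE x in lborel. f (x, t) * tens (deriv \<alpha>) \<beta> (x, t) = \<beta> t * (m x * deriv \<alpha> x)"
              using m(2) by eventually_elim (simp add: tens_def)
          qed (simp_all add: tens_def borel_measurable_curry)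
          then show ?thesis using antimono_mult_test_deriv[OF m(1) \<alpha>] nonneg by simp
        next
          case False
          then show ?thesis using test_pos_zero[OF \<beta>, of t] by (simp add: tens_def)
        qed
      qed
    qed
    then have "0 \<le> (LINT p|lborel. f p * tens (deriv \<alpha>) \<beta> p)" using Fubini_snd(1)[OF i] by simp
    then show "0 \<le> (LINT p|lborel. (- 1) * F p * tens \<alpha> \<beta> p)"
      using weak_xD[OF w \<alpha> \<beta>] by simp
  qed
  then show ?thesis by eventually_elim auto
qed

lemma decr_add:
  assumes "decr f" "decr f'" shows "decr (\<lambda>p. f p + f' p)"
  using assms unfolding decr_def
proof eventually_elim
  case (elim t)
  show ?case
  proof
    assume "0 < t"
    then obtain m m' where m: "antimono m" "AE x in lborel. f (x, t) = m x"
      "antimono m'" "AE x in lborel. f' (x, t) = m' x"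
      using elim by auto
    have "antimono (\<lambda>x. m x + m' x)" using m(1,3) by (auto simp: antimono_def intro: add_mono)
    moreover have "AE x in lborel. f (x, t) + f' (x, t) = m x + m' x"
      using m(2,4) by eventually_elim simp
    ultimately show "\<exists>m. antimono m \<and> (AE x in lborel. f (x, t) + f' (x, t) = m x)" by blast
  qed
qed

lemma decr_rep:
  assumes mono: "AE t in lebesgue_on {0..}. ess_decreasing (\<lambda>x. w (x, t))"
    and eq: "AE p in lborel. 0 < snd p \<longrightarrow> w p = w' p"
  shows "decr w'"
proof -
  have "AE t in lborel. t \<in> {0..} \<longrightarrow> ess_decreasing (\<lambda>x. w (x, t))"
    using mono by (subst (asm) AE_lebesgue_on_iff) auto
  with AE_snd[OF eq] show ?thesis
    unfolding decr_def
  proof eventually_elim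
    case (elim t)
    show ?case
    proof
      assume t: "0 < t"
      then obtain m where m: "antimono m" "AE x in lebesgue. w (x, t) = m x"
        using elim by (auto simp: ess_decreasing_def)
      have "AE x in lborel. w (x, t) = m x" using m(2) by (simp add: AE_completion_iff)
      with elim(1) have "AE x in lborel. w' (x, t) = m x" by eventually_elim (use t in auto)
      then show "\<exists>m. antimono m \<and> (AE x in lborel. w' (x, t) = m x)" using m(1) by blast
    qed
  qed
qed

text \<open>Both parts of the theorem reduce to the following situation, with \<open>w + v\<^sup>\<theta>\<close> and \<open>z - v\<^sup>\<theta>\<close> equal
  up to a function of time and \<open>v\<^sub>t = g\<close> their common \<open>x\<close>-derivative.\<close>

lemma degenerate_waveI:
  fixes v w z g W Z :: "real \<times> real \<Rightarrow> real"
  assumes s: "1 < s" "\<theta> = (s + 1) / 2" "c = \<theta>\<^sup>2 / s"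
    and v: "v \<in> borel_measurable borel" "\<And>p. 0 \<le> v p" "\<And>p. v p \<le> M" "\<And>p. snd p \<le> 0 \<Longrightarrow> v p = 0"
    and v0: "v0 \<in> borel_measurable borel" "\<And>x. 0 \<le> v0 x" "\<And>x. v0 x \<le> M"
    and w: "w \<in> borel_measurable borel" "\<And>p. \<bar>w p\<bar> \<le> B" "decr w" "weak_x w W"
    and z: "z \<in> borel_measurable borel" "\<And>p. \<bar>z p\<bar> \<le> B" "decr z" "weak_x z Z"
    and loc: "loc_int g" "loc_int W" "loc_int Z"
    and g: "weak_t v g" "weak_x (\<lambda>p. w p + v p powr \<theta>) g" "weak_x (\<lambda>p. z p - v p powr \<theta>) g"
    and wave: "\<And>\<alpha> \<beta>. test_function UNIV \<alpha> \<Longrightarrow> test_function UNIV \<beta> \<Longrightarrow>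
      (LINT p|lborel. v p * tens \<alpha> (deriv (deriv \<beta>)) p) - c * (LINT p|lborel. v p powr s * tens (deriv (deriv \<alpha>)) \<beta> p)
        + deriv \<beta> 0 * (LINT x|lborel. v0 x * \<alpha> x) - \<beta> 0 * L \<alpha> = 0"
  shows "degenerate_wave s \<theta> c M v g (\<lambda>p. g p - W p) (\<lambda>p. Z p - g p) v0 L"
proof
  have [measurable]: "v \<in> borel_measurable borel" "w \<in> borel_measurable borel" "z \<in> borel_measurable borel"
    by fact+
  have pb: "\<bar>v p powr \<theta>\<bar> \<le> M powr \<theta>" for p
    using v(2,3)[of p] s by (simp add: powr_mono2)
  have b: "\<bar>w p + v p powr \<theta>\<bar> \<le> B + M powr \<theta>" "\<bar>z p - v p powr \<theta>\<bar> \<le> B + M powr \<theta>" "\<bar>w p + z p\<bar> \<le> B + B" for p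
    using pb[of p] w(2)[of p] z(2)[of p] by linarith+
  show "1 < s" "\<theta> = (s + 1) / 2" "c = \<theta>\<^sup>2 / s" by fact+
  show "loc_int g" "loc_int (\<lambda>p. g p - W p)" "loc_int (\<lambda>p. Z p - g p)" by (intro loc_int_diff loc)+
  \<comment> \<open>The x-derivative of v^\<theta> is obtained twice: from (w + v^\<theta>) - w, and
    from z - (z - v^\<theta>).\<close>
  have "weak_x (\<lambda>p. w p + v p powr \<theta> + (- 1) * w p) (\<lambda>p. g p + (- 1) * W p)"
    by (rule weak_x_add[OF g(2) w(4) _ b(1) w(1,2) loc(1,2)]) simp
  then show "weak_x (\<lambda>p. v p powr \<theta>) (\<lambda>p. g p - W p)" by simp
  have "weak_x (\<lambda>p. z p + (- 1) * (z p - v p powr \<theta>)) (\<lambda>p. Z p + (- 1) * g p)"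
    by (rule weak_x_add[OF z(4) g(3) z(1,2) _ b(2) loc(3,1)]) simp
  then show "weak_x (\<lambda>p. v p powr \<theta>) (\<lambda>p. Z p - g p)" by simp
  \<comment> \<open>Adding eliminates v^\<theta>: w + z is decreasing with x-derivative 2 g, which
    gives the sign of v_t.\<close>
  have "weak_x (\<lambda>p. w p + v p powr \<theta> + 1 * (z p - v p powr \<theta>)) (\<lambda>p. g p + 1 * g p)"
    by (rule weak_x_add[OF g(2,3) _ b(1) _ b(2) loc(1,1)]) simp_all
  then have "weak_x (\<lambda>p. w p + z p) (\<lambda>p. g p + g p)" by simp
  from decr_weak_deriv_nonpos[OF decr_add[OF w(3) z(3)] this _ b(3) loc_int_add[OF loc(1,1)]]
  show "AE p in lborel. 0 < snd p \<longrightarrow> g p \<le> 0" by (auto elim!: eventually_mono)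
  show "AE p in lborel. 0 < snd p \<longrightarrow> g p \<le> g p - W p"
    using decr_weak_deriv_nonpos[OF w(3,4,1,2) loc(2)] by eventually_elim auto
  show "AE p in lborel. 0 < snd p \<longrightarrow> g p \<le> - (Z p - g p)"
    using decr_weak_deriv_nonpos[OF z(3,4,1,2) loc(3)] by eventually_elim auto
qed (use v v0 g(1) wave in auto)

text \<open>The difference of a smooth step rising just left of a and one rising just right of b.
  \<open>A\<close> and \<open>B\<close> are their slopes, of unit mass, so that integrals against
  them are averages over the two edges.\<close>

lemma trapezoid:
  fixes a b :: real
  assumes "a \<le> b"
  obtains \<kappa> A B where "test_function UNIV \<kappa>" "\<And>x. 0 \<le> \<kappa> x" "\<And>x. \<kappa> x \<le> 1" "\<And>x. x \<in> {a..b} \<Longrightarrow> \<kappa> x = 1"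
    "deriv \<kappa> = (\<lambda>x. A x - B x)"
    "test_function UNIV A" "\<And>x. 0 \<le> A x" "(LINT x|lborel. A x) = 1" "\<And>x. x \<notin> {a - 1<..<a} \<Longrightarrow> A x = 0"
    "test_function UNIV B" "\<And>x. 0 \<le> B x" "(LINT x|lborel. B x) = 1" "\<And>x. x \<notin> {b<..<b + 1} \<Longrightarrow> B x = 0"
proof -
  have step: "\<exists>A F. test_function UNIV A \<and> (\<forall>x. 0 \<le> A x) \<and> (LINT x|lborel. A x) = 1 \<and> (\<forall>x. x \<notin> {l<..<r} \<longrightarrow> A x = 0)
      \<and> (\<forall>x. (F has_real_derivative A x) (at x)) \<and> smooth F \<and> (\<forall>x. 0 \<le> F x \<and> F x \<le> 1) \<and> (\<forall>x\<le>l. F x = 0) \<and> (\<forall>x\<ge>r. F x = 1)"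
    if lr: "l < r" for l r :: real
  proof -
    obtain A :: "real \<Rightarrow> real" where A: "test_function {l..r} A" "\<And>x. 0 \<le> A x" "\<And>x. x \<notin> {l<..<r} \<Longrightarrow> A x = 0" "(LINT x|lborel. A x) = 1"
      using unit_bump[OF lr] by blast
    obtain F a' b' where F: "a' \<le> b'" "{a'..b'} \<subseteq> {l..r}" "smooth F" "\<And>x. (F has_real_derivative A x) (at x)"
      "\<And>x. x \<le> a' \<Longrightarrow> F x = 0" "\<And>x. b' \<le> x \<Longrightarrow> F x = 1"
      by (rule test_antiderivative[OF A(1)]) (use lr in \<open>auto simp: A(4) is_interval_cc\<close>)
    have "l \<le> a'" "b' \<le> r" using F(1,2) by auto
    have mono: "x \<le> y \<Longrightarrow> F x \<le> F y" for x y
      by (rule DERIV_nonneg_imp_nondecreasing) (use F(4) A(2) in blast)+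
    have "0 \<le> F x" "F x \<le> 1" for x
      using mono[of "min a' x" x] mono[of x "max b' x"] F(5)[of "min a' x"] F(6)[of "max b' x"] by auto
    moreover have "test_function UNIV A" by (rule test_mono[OF A(1)]) simp
    ultimately show ?thesis
      using A F \<open>l \<le> a'\<close> \<open>b' \<le> r\<close> by (intro exI[of _ A] exI[of _ F]) auto
  qed
  obtain A F where A: "test_function UNIV A" "\<And>x. 0 \<le> A x" "(LINT x|lborel. A x) = 1" "\<And>x. x \<notin> {a - 1<..<a} \<Longrightarrow> A x = 0"
    and F: "\<And>x. (F has_real_derivative A x) (at x)" "smooth F" "\<And>x. 0 \<le> F x" "\<And>x. F x \<le> 1" "\<And>x. x \<le> a - 1 \<Longrightarrow> F x = 0" "\<And>x. a \<le> x \<Longrightarrow> F x = 1"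
    using step[of "a - 1" a] by simp blast
  obtain B G where B: "test_function UNIV B" "\<And>x. 0 \<le> B x" "(LINT x|lborel. B x) = 1" "\<And>x. x \<notin> {b<..<b + 1} \<Longrightarrow> B x = 0"
    and G: "\<And>x. (G has_real_derivative B x) (at x)" "smooth G" "\<And>x. 0 \<le> G x" "\<And>x. G x \<le> 1" "\<And>x. x \<le> b \<Longrightarrow> G x = 0" "\<And>x. b + 1 \<le> x \<Longrightarrow> G x = 1"
    using step[of b "b + 1"] by simp blast
  show ?thesis
  proof (rule that[of "\<lambda>x. F x - G x" A B])
    show "test_function UNIV (\<lambda>x. F x - G x)"
      by (rule test_functionI[where a="a - 1" and b="b + 1"]) (use F G assms in \<open>auto intro: smooth_diff\<close>)
    show "0 \<le> F x - G x" for x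
      using F(3,6)[of x] G(4,5)[of x] assms by (cases "x \<le> b") auto
    show "F x - G x \<le> 1" for x using F(4)[of x] G(3)[of x] by linarith
    show "F x - G x = 1" if "x \<in> {a..b}" for x using that F(6)[of x] G(5)[of x] by auto
    show "deriv (\<lambda>x. F x - G x) = (\<lambda>x. A x - B x)"
      by (rule ext, intro DERIV_imp_deriv DERIV_diff F(1) G(1))
  qed (use A B in auto)
qed

section \<open>Representatives of the initial data and of the weak equations\<close>

lemma UNIV_Linf_rep:
  fixes u :: "real \<Rightarrow> real"
  assumes "u \<in> Linf UNIV"
  obtains u' B where "u' \<in> borel_measurable borel" "\<And>x. \<bar>u' x\<bar> \<le> B" "AE x in lborel. u x = u' x"
  using Linf_rep[OF assms] by auto

lemma W11_loc_weak_dx: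
  assumes "f \<in> W11_loc halfplane"
  obtains F where "has_weak_deriv (1, 0) halfplane f F"
  using assms by (auto simp: W11_loc_def weakly_differentiable_def Basis_prod_def)

lemma lebesgue_mult_test:
  fixes f f' \<phi> :: "real \<Rightarrow> real"
  assumes f': "f' \<in> borel_measurable borel" "\<And>x. \<bar>f' x\<bar> \<le> B" "AE x in lborel. f x = f' x"
    and \<phi>: "test_function UNIV \<phi>"
  shows "(LINT x|lebesgue. f x * \<phi> x) = (LINT x|lborel. f' x * \<phi> x)" "integrable lebesgue (\<lambda>x. f x * \<phi> x)"
    "integrable lborel (\<lambda>x. f' x * \<phi> x)"
proof -
  have [measurable]: "\<phi> \<in> borel_measurable borel" "f' \<in> borel_measurable borel" using test_borel[OF \<phi>] f'(1) by auto
  show i: "integrable lborel (\<lambda>x. f' x * \<phi> x)"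
    using integrable_mult_bounded[OF test_integrable[OF \<phi>], of f' B] f'(2) by (simp add: mult.commute)
  have m: "(\<lambda>x. f' x * \<phi> x) \<in> borel_measurable borel" by measurable
  have eq: "AE x in lborel. f x * \<phi> x = f' x * \<phi> x" using f'(3) by eventually_elim simp
  show "(LINT x|lebesgue. f x * \<phi> x) = (LINT x|lborel. f' x * \<phi> x)" "integrable lebesgue (\<lambda>x. f x * \<phi> x)"
    using lebesgue_integral_rep[OF m eq] i by auto
qed

lemma lebesgue_mult_tens_initial:
  fixes f f' \<alpha> \<beta> :: "real \<Rightarrow> real"
  assumes "f' \<in> borel_measurable borel" "\<And>x. \<bar>f' x\<bar> \<le> B" "AE x in lborel. f x = f' x"
    and "test_function UNIV \<alpha>"
  shows "(LINT x|lebesgue. f x * tens \<alpha> \<beta> (x, 0)) = \<beta> 0 * (LINT x|lborel. f' x * \<alpha> x)"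
proof -
  have "(LINT x|lebesgue. f x * tens \<alpha> \<beta> (x, 0)) = (LINT x|lebesgue. f x * \<alpha> x * \<beta> 0)"
    by (simp only: tens_def fst_conv snd_conv mult.assoc)
  also have "\<dots> = (LINT x|lebesgue. f x * \<alpha> x) * \<beta> 0" by (rule integral_mult_left_zero)
  finally show ?thesis using lebesgue_mult_test(1)[OF assms] by simp
qed

text \<open>Since \<open>v\<^sub>0\<^sup>\<theta>\<close> is half the difference of essentially bounded functions, \<open>v\<^sub>0\<close> is measurable and
  essentially bounded.\<close>

lemma initial_v_rep:
  fixes v0 q :: "real \<Rightarrow> real"
  assumes \<theta>: "0 < \<theta>" and q: "q \<in> borel_measurable borel" "\<And>x. \<bar>q x\<bar> \<le> B"
    and v0: "\<And>x. 0 \<le> v0 x" and eq: "AE x in lborel. v0 x powr \<theta> = q x"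
  obtains v0' where "v0' \<in> borel_measurable borel" "\<And>x. 0 \<le> v0' x" "\<And>x. v0' x \<le> B powr (1 / \<theta>)"
    "AE x in lborel. v0 x = v0' x"
proof (rule that[of "\<lambda>x. max 0 (q x) powr (1 / \<theta>)"])
  show "(\<lambda>x. max 0 (q x) powr (1 / \<theta>)) \<in> borel_measurable borel" using q(1) by measurable
  show "max 0 (q x) powr (1 / \<theta>) \<le> B powr (1 / \<theta>)" for x
    using q(2)[of x] \<theta> by (intro powr_mono2) auto
  show "AE x in lborel. v0 x = max 0 (q x) powr (1 / \<theta>)"
    using eq
  proof eventually_elim
    case (elim x)
    have "max 0 (q x) = v0 x powr \<theta>" using elim by (simp add: max_absorb2 flip: elim)
    then show ?case using \<theta> v0[of x] by (simp add: powr_powr)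
  qed
qed simp

lemma powr_s_mult: "0 \<le> (y::real) \<Longrightarrow> 1 < s \<Longrightarrow> \<bar>y\<bar> powr (s - 1) * y = y powr s"
  by (cases "y = 0") (simp_all add: powr_diff)

text \<open>The common shape of the two equations of the system and of the wave equation.\<close>

lemma halfplane_integral_tens2:
  assumes f': "f' \<in> borel_measurable borel" "\<And>p. \<bar>f' p\<bar> \<le> B" "\<And>p. snd p \<le> 0 \<Longrightarrow> f' p = 0"
      "AE p in lborel. 0 < snd p \<longrightarrow> f p = f' p"
    and h': "h' \<in> borel_measurable borel" "\<And>p. \<bar>h' p\<bar> \<le> B'" "\<And>p. snd p \<le> 0 \<Longrightarrow> h' p = 0"
      "AE p in lborel. 0 < snd p \<longrightarrow> h p = h' p"
    and t: "test_function UNIV \<alpha>1" "test_function UNIV \<beta>1" "test_function UNIV \<alpha>2" "test_function UNIV \<beta>2"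
  shows "(LINT p|lebesgue_on halfplane. f p * tens \<alpha>1 \<beta>1 p - h p * tens \<alpha>2 \<beta>2 p)
    = (LINT p|lborel. f' p * tens \<alpha>1 \<beta>1 p) - (LINT p|lborel. h' p * tens \<alpha>2 \<beta>2 p)"
proof -
  have [measurable]: "tens \<alpha>1 \<beta>1 \<in> borel_measurable borel" "tens \<alpha>2 \<beta>2 \<in> borel_measurable borel"
    "f' \<in> borel_measurable borel" "h' \<in> borel_measurable borel"
    using f'(1) h'(1) t by (auto intro!: borel_measurable_tens test_borel)
  have "(LINT p|lebesgue_on halfplane. f p * tens \<alpha>1 \<beta>1 p - h p * tens \<alpha>2 \<beta>2 p)
      = (LINT p|lborel. f' p * tens \<alpha>1 \<beta>1 p - h' p * tens \<alpha>2 \<beta>2 p)"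
  proof (rule lebesgue_on_integral_rep(1)[OF halfplane_borel])
    show "AE p in lborel. p \<in> halfplane \<longrightarrow> f p * tens \<alpha>1 \<beta>1 p - h p * tens \<alpha>2 \<beta>2 p = f' p * tens \<alpha>1 \<beta>1 p - h' p * tens \<alpha>2 \<beta>2 p"
      using f'(4) h'(4) by eventually_elim (auto simp: mem_halfplane)
    show "f' p * tens \<alpha>1 \<beta>1 p - h' p * tens \<alpha>2 \<beta>2 p = 0" if "p \<notin> halfplane" for p
      using that f'(3)[of p] h'(3)[of p] by (simp add: mem_halfplane)
  qed measurable
  also have "\<dots> = (LINT p|lborel. f' p * tens \<alpha>1 \<beta>1 p) - (LINT p|lborel. h' p * tens \<alpha>2 \<beta>2 p)"
    by (rule Bochner_Integration.integral_diff[OF bounded_mult_tens[OF f'(1,2) t(1,2)] bounded_mult_tens[OF h'(1,2) t(3,4)]])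
  finally show ?thesis .
qed

section \<open>The first-order system\<close>

text \<open>Testing the first equation with \<alpha> \<beta>' and the second with \<alpha>' \<beta>
  and adding cancels \<open>u\<close> and leaves the wave equation, with minus the integral of u0
  \<alpha>' as velocity term. For a trapezoid around x and y the data inequality says that the mean
  of w0 over the left edge is at most the mean of z0 over the right edge, which the gap
  contradicts.\<close>

lemma system_nonexistence:
  fixes u0 v0 :: "real \<Rightarrow> real" and v u :: "real \<times> real \<Rightarrow> real"
  assumes s: "1 < s" "\<theta> = (s + 1) / 2" "c = \<theta>\<^sup>2 / s"
    and v0_nonneg: "\<And>x. 0 \<le> v0 x"
    and w0_def: "w0 = (\<lambda>x. u0 x - v0 x powr \<theta>)" and z0_def: "z0 = (\<lambda>x. u0 x + v0 x powr \<theta>)"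
    and Linf: "w0 \<in> Linf UNIV" "z0 \<in> Linf UNIV" and mono: "antimono w0" "antimono z0" and gap: "z0 y < w0 x"
    and sol: "gen_solution_system s c v0 u0 v u"
    and props: "solution_properties w0 z0 v (\<lambda>p. u p - v p powr \<theta>) (\<lambda>p. u p + v p powr \<theta>)"
  shows False
proof -
  have \<theta>: "1 < \<theta>" using s by simp
  have uv: "v \<in> Linf halfplane" "u \<in> Linf halfplane"
    using sol by (auto simp: gen_solution_system_def)
  have P: "AE p in lebesgue_on halfplane. 0 \<le> v p"
    "AE t in lebesgue_on {0..}. ess_decreasing (\<lambda>x. u (x, t) - v (x, t) powr \<theta>) \<and> ess_decreasing (\<lambda>x. u (x, t) + v (x, t) powr \<theta>)"
    "(\<lambda>p. u p - v p powr \<theta>) \<in> W11_loc halfplane" "(\<lambda>p. u p + v p powr \<theta>) \<in> W11_loc halfplane"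
    using props by (simp_all add: solution_properties_def)
  obtain v' M1 where v': "v' \<in> borel_measurable borel" "\<And>p. 0 \<le> v' p" "\<And>p. v' p \<le> M1" "\<And>p. p \<notin> halfplane \<Longrightarrow> v' p = 0"
    "AE p in lborel. p \<in> halfplane \<longrightarrow> v p = v' p"
    using Linf_rep_nonneg[OF uv(1) halfplane_borel P(1)] by blast
  obtain u' U where u': "u' \<in> borel_measurable borel" "\<And>p. \<bar>u' p\<bar> \<le> U" "\<And>p. p \<notin> halfplane \<Longrightarrow> u' p = 0"
    "AE p in lborel. p \<in> halfplane \<longrightarrow> u p = u' p"
    using Linf_rep[OF uv(2) halfplane_borel] by blast
  note v' = v'(1-3) v'(4)[unfolded mem_halfplane not_less] v'(5)[unfolded mem_halfplane]
  note u' = u'(1-2) u'(3)[unfolded mem_halfplane not_less] u'(4)[unfolded mem_halfplane]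
  have [measurable]: "v' \<in> borel_measurable borel" "u' \<in> borel_measurable borel" by fact+
  define w' z' where "w' p = u' p - v' p powr \<theta>" and "z' p = u' p + v' p powr \<theta>" for p
  have [measurable]: "w' \<in> borel_measurable borel" "z' \<in> borel_measurable borel"
    unfolding w'_def[abs_def] z'_def[abs_def] by measurable
  have vb: "\<bar>v' p powr \<theta>\<bar> \<le> M1 powr \<theta>" for p
    using v'(2,3)[of p] \<theta> by (simp add: powr_mono2)
  have wzb: "\<bar>w' p\<bar> \<le> U + M1 powr \<theta>" "\<bar>z' p\<bar> \<le> U + M1 powr \<theta>" for p
    unfolding w'_def z'_def using vb[of p] u'(2)[of p] by linarith+
  have weq: "AE p in lborel. 0 < snd p \<longrightarrow> u p - v p powr \<theta> = w' p"
    and zeq: "AE p in lborel. 0 < snd p \<longrightarrow> u p + v p powr \<theta> = z' p"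
    using v'(5) u'(4) by (eventually_elim, simp add: w'_def z'_def)+
  obtain W where W: "has_weak_deriv (1, 0) halfplane (\<lambda>p. u p - v p powr \<theta>) W"
    using W11_loc_weak_dx[OF P(3)] by blast
  obtain Z where Z: "has_weak_deriv (1, 0) halfplane (\<lambda>p. u p + v p powr \<theta>) Z"
    using W11_loc_weak_dx[OF P(4)] by blast
  obtain W' where W': "loc_int W'" "AE p in lborel. 0 < snd p \<longrightarrow> W p = W' p"
    using loc_int_rep[of W] W unfolding has_weak_deriv_def by blast
  obtain Z' where Z': "loc_int Z'" "AE p in lborel. 0 < snd p \<longrightarrow> Z p = Z' p"
    using loc_int_rep[of Z] Z unfolding has_weak_deriv_def by blast
  have wW: "weak_x w' W'" using W'(1) by (intro has_weak_deriv_rep(1)[OF W _ weq _ W'(2)]) (auto simp: loc_int_def)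
  have zZ: "weak_x z' Z'" using Z'(1) by (intro has_weak_deriv_rep(1)[OF Z _ zeq _ Z'(2)]) (auto simp: loc_int_def)
  have decr: "decr w'" "decr z'"
    using decr_rep[OF _ weq] decr_rep[OF _ zeq] P(2) by simp_all
  \<comment> \<open>Half the sum of the derivatives of w and z, that is u_x, which the first
    equation identifies with v_t.\<close>
  define g where "g p = (1 / 2) * (W' p + Z' p)" for p
  have g_loc: "loc_int g" unfolding g_def by (intro loc_int_scale loc_int_add W' Z')
  have ug: "weak_x u' g"
    unfolding weak_x_def
  proof (intro allI impI)
    fix \<alpha> \<beta> :: "real \<Rightarrow> real" assume \<alpha>: "test_function UNIV \<alpha>" and \<beta>: "test_function {0<..} \<beta>"
    have "weak_x (\<lambda>p. w' p + 1 * z' p) (\<lambda>p. W' p + 1 * Z' p)"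
      by (rule weak_x_add[OF wW zZ _ wzb(1) _ wzb(2) W'(1) Z'(1)]) simp_all
    from weak_xD[OF this \<alpha> \<beta>]
    show "(LINT p|lborel. u' p * tens (deriv \<alpha>) \<beta> p) = - (LINT p|lborel. g p * tens \<alpha> \<beta> p)"
      by (simp add: w'_def z'_def g_def mult.assoc flip: mult_2)
  qed
  obtain w0' B1 where w0': "w0' \<in> borel_measurable borel" "\<And>x. \<bar>w0' x\<bar> \<le> B1" "AE x in lborel. w0 x = w0' x"
    using UNIV_Linf_rep[OF Linf(1)] by blast
  obtain z0' B2 where z0': "z0' \<in> borel_measurable borel" "\<And>x. \<bar>z0' x\<bar> \<le> B2" "AE x in lborel. z0 x = z0' x"
    using UNIV_Linf_rep[OF Linf(2)] by blast
  have [measurable]: "w0' \<in> borel_measurable borel" "z0' \<in> borel_measurable borel" by fact+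
  have q: "\<bar>(z0' x - w0' x) / 2\<bar> \<le> (B1 + B2) / 2" "\<bar>(w0' x + z0' x) / 2\<bar> \<le> (B1 + B2) / 2" for x
    using w0'(2)[of x] z0'(2)[of x] by auto
  have "AE x in lborel. v0 x powr \<theta> = (z0' x - w0' x) / 2"
    using w0'(3) z0'(3) by eventually_elim (simp add: w0_def z0_def)
  then obtain v0' where v0': "v0' \<in> borel_measurable borel" "\<And>x. 0 \<le> v0' x" "\<And>x. v0' x \<le> ((B1 + B2) / 2) powr (1 / \<theta>)"
    "AE x in lborel. v0 x = v0' x"
    using initial_v_rep[of \<theta> "\<lambda>x. (z0' x - w0' x) / 2" "(B1 + B2) / 2" v0] \<theta> q(1) v0_nonneg by auto
  define u0' where "u0' x = (w0' x + z0' x) / 2" for x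
  have u0': "u0' \<in> borel_measurable borel" "\<And>x. \<bar>u0' x\<bar> \<le> (B1 + B2) / 2" "AE x in lborel. u0 x = u0' x"
    using q(2) w0'(3) z0'(3) unfolding u0'_def[abs_def] by (auto simp: w0_def z0_def elim: eventually_elim2)
  have v0b: "\<bar>v0' x\<bar> \<le> ((B1 + B2) / 2) powr (1 / \<theta>)" for x using v0'(2,3)[of x] by simp
  have vb1: "\<bar>v' p\<bar> \<le> M1" for p using v'(2,3)[of p] by simp
  have vsb: "\<bar>c * v' p powr s\<bar> \<le> \<bar>c\<bar> * M1 powr s" for p
    using v'(2,3)[of p] s(1) by (simp add: abs_mult powr_mono2 mult_left_mono)
  have vs_eq: "AE p in lborel. 0 < snd p \<longrightarrow> c * \<bar>v p\<bar> powr (s - 1) * v p = c * v' p powr s"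
    using v'(5) by eventually_elim (use powr_s_mult[OF v'(2) s(1)] in \<open>simp add: mult.assoc\<close>)
  have eq1: "(LINT p|lborel. v' p * tens \<alpha> (deriv \<beta>) p) - (LINT p|lborel. u' p * tens (deriv \<alpha>) \<beta> p)
      + \<beta> 0 * (LINT x|lborel. v0' x * \<alpha> x) = 0"
    if \<alpha>: "test_function UNIV \<alpha>" and \<beta>: "test_function UNIV \<beta>" for \<alpha> \<beta> :: "real \<Rightarrow> real"
  proof -
    have "test_function UNIV (tens \<alpha> \<beta>)" by (rule test_tens[OF \<alpha> \<beta>]) simp
    then have "(LINT p|lebesgue_on halfplane. v p * tens \<alpha> (deriv \<beta>) p - u p * tens (deriv \<alpha>) \<beta> p)
        + (LINT x|lebesgue. v0 x * tens \<alpha> \<beta> (x, 0)) = 0"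
      using sol by (auto simp: gen_solution_system_def dir_deriv_tens[OF test_smooth[OF \<alpha>] test_smooth[OF \<beta>]])
    moreover have "(LINT x|lebesgue. v0 x * tens \<alpha> \<beta> (x, 0)) = \<beta> 0 * (LINT x|lborel. v0' x * \<alpha> x)"
      by (rule lebesgue_mult_tens_initial[OF v0'(1) v0b v0'(4) \<alpha>])
    ultimately show ?thesis
      using halfplane_integral_tens2[OF v'(1) vb1 v'(4,5) u' \<alpha> test_deriv[OF \<beta>] test_deriv[OF \<alpha>] \<beta>] by simp
  qed
  have eq2: "(LINT p|lborel. u' p * tens \<alpha> (deriv \<beta>) p) - (LINT p|lborel. c * v' p powr s * tens (deriv \<alpha>) \<beta> p)
      + \<beta> 0 * (LINT x|lborel. u0' x * \<alpha> x) = 0"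
    if \<alpha>: "test_function UNIV \<alpha>" and \<beta>: "test_function UNIV \<beta>" for \<alpha> \<beta> :: "real \<Rightarrow> real"
  proof -
    have "test_function UNIV (tens \<alpha> \<beta>)" by (rule test_tens[OF \<alpha> \<beta>]) simp
    then have "(LINT p|lebesgue_on halfplane. u p * tens \<alpha> (deriv \<beta>) p - c * \<bar>v p\<bar> powr (s - 1) * v p * tens (deriv \<alpha>) \<beta> p)
        + (LINT x|lebesgue. u0 x * tens \<alpha> \<beta> (x, 0)) = 0"
      using sol by (auto simp: gen_solution_system_def dir_deriv_tens[OF test_smooth[OF \<alpha>] test_smooth[OF \<beta>]])
    moreover have "(LINT x|lebesgue. u0 x * tens \<alpha> \<beta> (x, 0)) = \<beta> 0 * (LINT x|lborel. u0' x * \<alpha> x)"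
      by (rule lebesgue_mult_tens_initial[OF u0' \<alpha>])
    ultimately show ?thesis
      using halfplane_integral_tens2[OF u' _ vsb _ vs_eq \<alpha> test_deriv[OF \<beta>] test_deriv[OF \<alpha>] \<beta>] v'(4) by simp
  qed
  have vg: "weak_t v' g"
    unfolding weak_t_def
  proof (intro allI impI)
    fix \<alpha> \<beta> :: "real \<Rightarrow> real" assume \<alpha>: "test_function UNIV \<alpha>" and \<beta>: "test_function {0<..} \<beta>"
    have "test_function UNIV \<beta>" by (rule test_mono[OF \<beta>]) simp
    from eq1[OF \<alpha> this] weak_xD[OF ug \<alpha> \<beta>] test_pos_zero[OF \<beta>, of 0]
    show "(LINT p|lborel. v' p * tens \<alpha> (deriv \<beta>) p) = - (LINT p|lborel. g p * tens \<alpha> \<beta> p)" by simp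
  qed
  define M where "M = max M1 (((B1 + B2) / 2) powr (1 / \<theta>))"
  define L where "L \<alpha> = - (LINT x|lborel. u0' x * deriv \<alpha> x)" for \<alpha>
  interpret degenerate_wave s \<theta> c M v' g "\<lambda>p. g p - W' p" "\<lambda>p. Z' p - g p" v0' L
  proof (rule degenerate_waveI[OF s v'(1,2) _ v'(4) v0'(1,2) _ _ wzb(1) decr(1) wW _ wzb(2) decr(2) zZ g_loc W'(1) Z'(1) vg])
    show "weak_x (\<lambda>p. w' p + v' p powr \<theta>) g" "weak_x (\<lambda>p. z' p - v' p powr \<theta>) g"
      using ug by (simp_all add: w'_def z'_def)
    fix \<alpha> \<beta> :: "real \<Rightarrow> real" assume \<alpha>: "test_function UNIV \<alpha>" and \<beta>: "test_function UNIV \<beta>"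
    show "(LINT p|lborel. v' p * tens \<alpha> (deriv (deriv \<beta>)) p) - c * (LINT p|lborel. v' p powr s * tens (deriv (deriv \<alpha>)) \<beta> p)
        + deriv \<beta> 0 * (LINT x|lborel. v0' x * \<alpha> x) - \<beta> 0 * L \<alpha> = 0"
      using eq1[OF \<alpha> test_deriv[OF \<beta>]] eq2[OF test_deriv[OF \<alpha>] \<beta>] by (simp add: L_def mult.assoc)
  qed (use v'(3) v0'(3) in \<open>auto simp: M_def le_max_iff_disj\<close>)
  \<comment> \<open>x and y come in no particular order; since w0 and z0 decrease, moving the edges
    outward only widens the gap.\<close>
  have "min x y \<le> max x y" by simp
  then obtain \<kappa> A B where \<kappa>: "test_function UNIV \<kappa>" "\<And>t. 0 \<le> \<kappa> t" "deriv \<kappa> = (\<lambda>t. A t - B t)"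
    and A: "test_function UNIV A" "\<And>t. 0 \<le> A t" "(LINT t|lborel. A t) = 1" "\<And>t. t \<notin> {min x y - 1<..<min x y} \<Longrightarrow> A t = 0"
    and B: "test_function UNIV B" "\<And>t. 0 \<le> B t" "(LINT t|lborel. B t) = 1" "\<And>t. t \<notin> {max x y<..<max x y + 1} \<Longrightarrow> B t = 0"
    by (rule trapezoid) blast
  have bd: "\<bar>w0' x\<bar> \<le> B1" "\<bar>z0' x\<bar> \<le> B2" "\<bar>u0' x\<bar> \<le> (B1 + B2) / 2" "\<bar>v0' x powr \<theta>\<bar> \<le> (((B1 + B2) / 2) powr (1 / \<theta>)) powr \<theta>" for x
    using w0'(2) z0'(2) u0'(2) powr_mono2[OF _ v0'(2,3), of \<theta> x] exponents(1) by simp_all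
  have int: "integrable lborel (\<lambda>t. f t * E t)" if "f \<in> borel_measurable borel" "\<And>x. \<bar>f x\<bar> \<le> K" "test_function UNIV E" for f E :: "real \<Rightarrow> real" and K
    using integrable_mult_bounded[OF test_integrable[OF that(3)] _ that(2)] that(1) by (simp add: mult.commute)
  have p0: "AE t in lborel. v0' t powr \<theta> = (z0' t - w0' t) / 2"
    using v0'(4) w0'(3) z0'(3) by eventually_elim (simp add: w0_def z0_def)
  have [measurable]: "A \<in> borel_measurable borel" "B \<in> borel_measurable borel" "v0' \<in> borel_measurable borel" "u0' \<in> borel_measurable borel"
    using test_borel[OF A(1)] test_borel[OF B(1)] v0'(1) u0'(1) by auto
  have LA: "L \<kappa> = - (LINT t|lborel. u0' t * A t) + (LINT t|lborel. u0' t * B t)"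
    unfolding L_def \<kappa>(3) right_diff_distrib
    by (subst Bochner_Integration.integral_diff[OF int[OF u0'(1,2) A(1)] int[OF u0'(1,2) B(1)]]) simp
  \<comment> \<open>Here u0 - v0^\<theta> recombines to w0, which on the left edge is at least
    \<open>w0 x\<close>.\<close>
  have left: "- (LINT t|lborel. u0' t * A t) + (LINT t|lborel. v0' t powr \<theta> * A t) \<le> - w0 x"
  proof -
    have "(LINT t|lborel. w0 x * A t) \<le> (LINT t|lborel. u0' t * A t - v0' t powr \<theta> * A t)"
    proof (rule integral_mono_AE)
      show "integrable lborel (\<lambda>t. w0 x * A t)" using test_integrable[OF A(1)] by simp
      show "integrable lborel (\<lambda>t. u0' t * A t - v0' t powr \<theta> * A t)"
        by (intro Bochner_Integration.integrable_diff int[OF _ bd(3) A(1)] int[OF _ bd(4) A(1)]) simp_all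
      show "AE t in lborel. w0 x * A t \<le> u0' t * A t - v0' t powr \<theta> * A t"
        using p0 w0'(3)
      proof eventually_elim
        case (elim t)
        have "w0 x * A t \<le> w0 t * A t"
          using A(2,4)[of t] antimonoD[OF mono(1), of t x] by (cases "t \<le> x") (auto intro: mult_right_mono)
        moreover have "u0' t - v0' t powr \<theta> = w0 t" using elim by (simp add: u0'_def field_simps)
        ultimately show ?case by (simp flip: left_diff_distrib)
      qed
    qed
    also have "\<dots> = (LINT t|lborel. u0' t * A t) - (LINT t|lborel. v0' t powr \<theta> * A t)"
      by (intro Bochner_Integration.integral_diff int[OF _ bd(3) A(1)] int[OF _ bd(4) A(1)]) simp_all
    finally show ?thesis using A(3) by simp
  qed
  \<comment> \<open>Here u0 + v0^\<theta> recombines to z0, which on the right edge is at most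
    \<open>z0 y\<close>.\<close>
  have right: "(LINT t|lborel. u0' t * B t) + (LINT t|lborel. v0' t powr \<theta> * B t) \<le> z0 y"
  proof -
    have "(LINT t|lborel. u0' t * B t + v0' t powr \<theta> * B t) \<le> (LINT t|lborel. z0 y * B t)"
    proof (rule integral_mono_AE)
      show "integrable lborel (\<lambda>t. z0 y * B t)" using test_integrable[OF B(1)] by simp
      show "integrable lborel (\<lambda>t. u0' t * B t + v0' t powr \<theta> * B t)"
        by (intro Bochner_Integration.integrable_add int[OF _ bd(3) B(1)] int[OF _ bd(4) B(1)]) simp_all
      show "AE t in lborel. u0' t * B t + v0' t powr \<theta> * B t \<le> z0 y * B t"
        using p0 z0'(3)
      proof eventually_elim
        case (elim t)
        have "z0 t * B t \<le> z0 y * B t"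
          using B(2,4)[of t] antimonoD[OF mono(2), of y t] by (cases "y \<le> t") (auto intro: mult_right_mono)
        moreover have "u0' t + v0' t powr \<theta> = z0 t" using elim by (simp add: u0'_def field_simps)
        ultimately show ?case by (simp flip: distrib_right)
      qed
    qed
    also have "(LINT t|lborel. u0' t * B t + v0' t powr \<theta> * B t) = (LINT t|lborel. u0' t * B t) + (LINT t|lborel. v0' t powr \<theta> * B t)"
      by (intro Bochner_Integration.integral_add int[OF _ bd(3) B(1)] int[OF _ bd(4) B(1)]) simp_all
    finally show ?thesis using B(3) by simp
  qed
  show False
    using data_inequality[OF \<kappa> A(1,2) B(1,2)] LA left right gap by linarith
qed

section \<open>The wave equation\<close>

text \<open>\<open>chain_rule_line\<close> with the identity as outer function, over an interval
  containing the support.\<close>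

lemma indefinite_integral_mult_test_deriv:
  fixes G \<alpha> :: "real \<Rightarrow> real"
  assumes G: "integrable lborel G" and \<alpha>: "test_function UNIV \<alpha>"
  shows "(LINT x|lborel. (k + (LINT y|lborel. indicator {..x} y * G y)) * deriv \<alpha> x) = - (LINT x|lborel. G x * \<alpha> x)"
proof -
  obtain a b where ab: "a < b" "test_function {a<..<b} \<alpha>" using test_enlarge_UNIV[OF \<alpha>] by blast
  define F where "F x = k + (LINT y|lborel. indicator {..x} y * G y)" for x
  have cF: "continuous_on UNIV F"
    unfolding F_def by (intro continuous_intros continuous_indefinite_integral G)
  have [measurable]: "G \<in> borel_measurable borel" "F \<in> borel_measurable borel" "\<alpha> \<in> borel_measurable borel" "deriv \<alpha> \<in> borel_measurable borel"
    using G cF test_borel[OF \<alpha>] test_borel[OF test_deriv[OF \<alpha>]] by (auto intro: borel_measurable_continuous_onI)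
  obtain K where K: "\<And>x. \<bar>\<alpha> x\<bar> \<le> K" using test_bounded[OF \<alpha>] by blast
  have i1: "integrable lborel (\<lambda>x. G x * \<alpha> x)" by (rule integrable_mult_bounded[OF G _ K]) simp
  have Fb: "\<bar>F x\<bar> \<le> \<bar>k\<bar> + (LINT y|lborel. \<bar>G y\<bar>)" for x
  proof -
    have "\<bar>LINT y|lborel. indicator {..x} y * G y\<bar> \<le> (LINT y|lborel. \<bar>indicator {..x} y * G y\<bar>)"
      by (rule integral_abs_bound)
    also have "\<dots> \<le> (LINT y|lborel. \<bar>G y\<bar>)"
      using integrable_abs[OF G] integrable_mult_indicator[OF _ G, of "{..x}"]
      by (intro integral_mono) (auto simp: indicator_def)
    finally show ?thesis unfolding F_def by linarith
  qed
  have "integrable lborel (\<lambda>x. deriv \<alpha> x * F x)"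
    by (rule integrable_mult_bounded[OF test_integrable[OF test_deriv[OF \<alpha>]] _ Fb]) simp
  then have i2: "integrable lborel (\<lambda>x. F x * deriv \<alpha> x)" by (simp add: mult.commute)
  have "(LINT x|lborel. indicator {a<..b} x * (1 * \<alpha> x * G x + F x * deriv \<alpha> x)) = F b * \<alpha> b - F a * \<alpha> a"
    unfolding F_def
    by (rule chain_rule_line[OF G _ _ test_DERIV[OF \<alpha>] test_continuous[OF test_deriv[OF \<alpha>]], where \<Phi>="\<lambda>y. y"])
      (use ab(1) in auto)
  also have "\<dots> = 0" using test_Ioo_zero(1)[OF ab(2), of a] test_Ioo_zero(1)[OF ab(2), of b] by simp
  also have "(\<lambda>x. indicator {a<..b} x * (1 * \<alpha> x * G x + F x * deriv \<alpha> x)) = (\<lambda>x. G x * \<alpha> x + F x * deriv \<alpha> x)"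
  proof
    show "indicator {a<..b} x * (1 * \<alpha> x * G x + F x * deriv \<alpha> x) = G x * \<alpha> x + F x * deriv \<alpha> x" for x
      using test_Ioo_zero[OF ab(2), of x] by (cases "x \<in> {a<..<b}") auto
  qed
  finally have "(LINT x|lborel. G x * \<alpha> x) + (LINT x|lborel. F x * deriv \<alpha> x) = 0"
    using i1 i2 by simp
  then show ?thesis unfolding F_def by simp
qed

text \<open>Integration by parts on almost every horizontal line, assembled by Fubini. The constant
  k may depend on t in any way, since \<alpha>' has mean zero and removes it.\<close>

lemma weak_x_of_lines:
  assumes f: "f \<in> borel_measurable borel" "\<And>p. \<bar>f p\<bar> \<le> B" and g: "loc_int g"
    and lines: "AE t in lborel. 0 < t \<longrightarrow> integrable lborel (\<lambda>x. g (x, t)) \<and>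
      (\<exists>k. AE x in lborel. f (x, t) = k + (LINT y|lborel. indicator {..x} y * g (y, t)))"
  shows "weak_x f g"
  unfolding weak_x_def
proof (intro allI impI)
  fix \<alpha> \<beta> :: "real \<Rightarrow> real" assume \<alpha>: "test_function UNIV \<alpha>" and \<beta>: "test_function {0<..} \<beta>"
  have i1: "integrable lborel (\<lambda>p. f p * tens (deriv \<alpha>) \<beta> p)"
    by (rule bounded_mult_tens[OF f test_deriv[OF \<alpha>] \<beta>])
  have i2: "integrable lborel (\<lambda>p. g p * tens \<alpha> \<beta> p)" by (rule loc_int_mult_tens[OF g \<alpha> \<beta>])
  have [measurable]: "(\<lambda>x. f (x, t)) \<in> borel_measurable borel" for t by (rule borel_measurable_curry[OF f(1)])
  have [measurable]: "deriv \<alpha> \<in> borel_measurable borel" by (rule test_borel[OF test_deriv[OF \<alpha>]])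
  have "(LINT p|lborel. f p * tens (deriv \<alpha>) \<beta> p) = (LINT t|lborel. LINT x|lborel. f (x, t) * tens (deriv \<alpha>) \<beta> (x, t))"
    by (rule Fubini_snd(1)[OF i1])
  also have "\<dots> = (LINT t|lborel. - (LINT x|lborel. g (x, t) * tens \<alpha> \<beta> (x, t)))"
  proof (rule integral_cong_AE)
    show "AE t in lborel. (LINT x|lborel. f (x, t) * tens (deriv \<alpha>) \<beta> (x, t)) = - (LINT x|lborel. g (x, t) * tens \<alpha> \<beta> (x, t))"
      using lines
    proof eventually_elim
      case (elim t)
      show ?case
      proof (cases "0 < t")
        case True
        then obtain k where gt: "integrable lborel (\<lambda>x. g (x, t))"
          and k: "AE x in lborel. f (x, t) = k + (LINT y|lborel. indicator {..x} y * g (y, t))"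
          using elim by auto
        have [measurable]: "(\<lambda>x. LINT y|lborel. indicator {..x} y * g (y, t)) \<in> borel_measurable borel"
          by (intro borel_measurable_continuous_onI continuous_indefinite_integral gt)
        have "(LINT x|lborel. f (x, t) * tens (deriv \<alpha>) \<beta> (x, t))
            = (LINT x|lborel. (k + (LINT y|lborel. indicator {..x} y * g (y, t))) * deriv \<alpha> x * \<beta> t)"
        proof (rule integral_cong_AE)
          show "AE x in lborel. f (x, t) * tens (deriv \<alpha>) \<beta> (x, t)
              = (k + (LINT y|lborel. indicator {..x} y * g (y, t))) * deriv \<alpha> x * \<beta> t"
            using k by eventually_elim (simp add: tens_def)
        qed (simp_all add: tens_def)
        also have "\<dots> = - (LINT x|lborel. g (x, t) * \<alpha> x) * \<beta> t"
          by (simp add: indefinite_integral_mult_test_deriv[OF gt \<alpha>])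
        also have "\<dots> = - (LINT x|lborel. g (x, t) * tens \<alpha> \<beta> (x, t))"
          by (simp add: tens_def mult.assoc flip: integral_mult_left_zero)
        finally show ?thesis .
      next
        case False
        then show ?thesis using test_pos_zero[OF \<beta>, of t] by (simp add: tens_def)
      qed
    qed
  qed (use Fubini_snd(2)[OF i1] Fubini_snd(2)[OF i2] in auto)
  also have "\<dots> = - (LINT p|lborel. g p * tens \<alpha> \<beta> p)" using Fubini_snd(1)[OF i2] by simp
  finally show "(LINT p|lborel. f p * tens (deriv \<alpha>) \<beta> p) = - (LINT p|lborel. g p * tens \<alpha> \<beta> p)" .
qed

text \<open>Both rays are expressed through the same primitive, so that w + v^\<theta> and z -
  v^\<theta> will differ by a function of t only.\<close>

lemma lebesgue_ray_integrals:
  fixes G G' :: "real \<Rightarrow> real"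
  assumes G: "integrable lebesgue G" and G': "G' \<in> borel_measurable borel" and eq: "AE y in lborel. G y = G' y"
  shows "integrable lborel G'" "(LINT y|lebesgue. G y) = (LINT y|lborel. G' y)"
    "(LINT y|lebesgue_on {..x}. G y) = (LINT y|lborel. indicator {..x} y * G' y)"
    "(LINT y|lebesgue_on {x..}. G y) = (LINT y|lborel. G' y) - (LINT y|lborel. indicator {..x} y * G' y)"
proof -
  have [measurable]: "G' \<in> borel_measurable borel" by (rule G')
  show i: "integrable lborel G'" "(LINT y|lebesgue. G y) = (LINT y|lborel. G' y)"
    using lebesgue_integral_rep[OF G' eq] G by auto
  have ray: "(LINT y|lebesgue_on S. G y) = (LINT y|lborel. indicator S y * G' y)" if S: "S \<in> sets borel" for S
  proof (rule lebesgue_on_integral_rep(1)[OF S])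
    show "(\<lambda>y. indicator S y * G' y) \<in> borel_measurable borel" using S by measurable
    show "AE y in lborel. y \<in> S \<longrightarrow> G y = indicator S y * G' y" using eq by eventually_elim auto
  qed simp
  show "(LINT y|lebesgue_on {..x}. G y) = (LINT y|lborel. indicator {..x} y * G' y)" by (rule ray) simp
  have ix: "integrable lborel (\<lambda>y. indicator {..x} y * G' y)"
    using integrable_mult_indicator[OF _ i(1), of "{..x}"] by simp
  have "(LINT y|lebesgue_on {x..}. G y) = (LINT y|lborel. indicator {x..} y * G' y)" by (rule ray) simp
  also have "\<dots> = (LINT y|lborel. G' y - indicator {..x} y * G' y)"
  proof (rule integral_cong_AE)
    have "AE y in lborel. y \<noteq> x" by (rule AE_lborel_singleton)
    then show "AE y in lborel. indicator {x..} y * G' y = G' y - indicator {..x} y * G' y"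
      by eventually_elim (auto simp: indicator_def)
  qed simp_all
  also have "\<dots> = (LINT y|lborel. G' y) - (LINT y|lborel. indicator {..x} y * G' y)"
    by (rule Bochner_Integration.integral_diff[OF i(1) ix])
  finally show "(LINT y|lebesgue_on {x..}. G y) = (LINT y|lborel. G' y) - (LINT y|lborel. indicator {..x} y * G' y)" .
qed

text \<open>The trapezoid is spread over [-n, n]: its integral against v1 tends to the total
  integral, and the edge means of v0^\<theta> tend to the limits at infinity. For large n the data
  inequality therefore contradicts the negative sum.\<close>

lemma wave_nonexistence:
  fixes v0 v1 :: "real \<Rightarrow> real" and v :: "real \<times> real \<Rightarrow> real"
  assumes s: "1 < s" "\<theta> = (s + 1) / 2" "c = \<theta>\<^sup>2 / s"
    and v0_nonneg: "\<And>x. 0 \<le> v0 x" and v1: "integrable lebesgue v1"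
    and w0_def: "w0 = (\<lambda>x. (LINT y|lebesgue_on {..x}. v1 y) - v0 x powr \<theta>)"
    and z0_def: "z0 = (\<lambda>x. - (LINT y|lebesgue_on {x..}. v1 y) + v0 x powr \<theta>)"
    and Linf: "w0 \<in> Linf UNIV" "z0 \<in> Linf UNIV"
    and lims: "((\<lambda>x. v0 x powr \<theta>) \<longlongrightarrow> Lplus) at_top" "((\<lambda>x. v0 x powr \<theta>) \<longlongrightarrow> Lminus) at_bot"
    and gap: "(LINT x|lebesgue. v1 x) + Lplus + Lminus < 0"
    and sol: "gen_solution_wave s c v0 v1 v" and v_t: "integrable_time_deriv v"
    and props: "solution_properties w0 z0 v
      (\<lambda>(x, t). (LINT y|lebesgue_on {..x}. weak_dt v (y, t)) - v (x, t) powr \<theta>)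
      (\<lambda>(x, t). - (LINT y|lebesgue_on {x..}. weak_dt v (y, t)) + v (x, t) powr \<theta>)"
  shows False
proof -
  have \<theta>1: "1 < \<theta>" using s by simp
  define G where "G = weak_dt v"
  define w z where "w = (\<lambda>(x, t). (LINT y|lebesgue_on {..x}. G (y, t)) - v (x, t) powr \<theta>)"
    and "z = (\<lambda>(x, t). - (LINT y|lebesgue_on {x..}. G (y, t)) + v (x, t) powr \<theta>)"
  have vL: "v \<in> Linf halfplane" using sol by (simp add: gen_solution_wave_def)
  have P: "AE p in lebesgue_on halfplane. 0 \<le> v p"
    "AE t in lebesgue_on {0..}. ess_decreasing (\<lambda>x. w (x, t)) \<and> ess_decreasing (\<lambda>x. z (x, t))"
    "w \<in> Linf halfplane" "z \<in> Linf halfplane" "w \<in> W11_loc halfplane" "z \<in> W11_loc halfplane"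
    using props by (simp_all add: solution_properties_def w_def z_def G_def)
  \<comment> \<open>Existence is what makes the chosen \<open>weak_dt v\<close> an actual weak
    derivative.\<close>
  have "\<exists>g. has_weak_deriv (0, 1) halfplane v g"
    using v_t by (simp add: integrable_time_deriv_def weakly_differentiable_def)
  then have G: "has_weak_deriv (0, 1) halfplane v G"
    unfolding G_def weak_deriv_def by (rule someI_ex)
  have G_int: "AE t in lborel. t \<in> {0..} \<longrightarrow> integrable lebesgue (\<lambda>x. G (x, t))"
    using v_t by (subst AE_lebesgue_on_iff[symmetric]) (auto simp: integrable_time_deriv_def G_def)
  obtain v' M1 where v': "v' \<in> borel_measurable borel" "\<And>p. 0 \<le> v' p" "\<And>p. v' p \<le> M1" "\<And>p. p \<notin> halfplane \<Longrightarrow> v' p = 0"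
    "AE p in lborel. p \<in> halfplane \<longrightarrow> v p = v' p"
    using Linf_rep_nonneg[OF vL halfplane_borel P(1)] by blast
  obtain w' B1 where w': "w' \<in> borel_measurable borel" "\<And>p. \<bar>w' p\<bar> \<le> B1" "\<And>p. p \<notin> halfplane \<Longrightarrow> w' p = 0" "AE p in lborel. p \<in> halfplane \<longrightarrow> w p = w' p"
    using Linf_rep[OF P(3) halfplane_borel] by blast
  obtain z' B2 where z': "z' \<in> borel_measurable borel" "\<And>p. \<bar>z' p\<bar> \<le> B2" "\<And>p. p \<notin> halfplane \<Longrightarrow> z' p = 0" "AE p in lborel. p \<in> halfplane \<longrightarrow> z p = z' p"
    using Linf_rep[OF P(4) halfplane_borel] by blast
  note v' = v'(1-3) v'(4)[unfolded mem_halfplane not_less] v'(5)[unfolded mem_halfplane]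
  note w' = w'(1-2) w'(4)[unfolded mem_halfplane]
  note z' = z'(1-2) z'(4)[unfolded mem_halfplane]
  have [measurable]: "v' \<in> borel_measurable borel" "w' \<in> borel_measurable borel" "z' \<in> borel_measurable borel" by fact+
  have vb: "\<bar>v' p powr \<theta>\<bar> \<le> M1 powr \<theta>" for p
    using v'(2,3)[of p] \<theta>1 by (simp add: powr_mono2)
  have wzb: "\<bar>w' p\<bar> \<le> max B1 B2" "\<bar>z' p\<bar> \<le> max B1 B2" for p
    using w'(2)[of p] z'(2)[of p] by auto
  have sumb: "\<bar>w' p + v' p powr \<theta>\<bar> \<le> B1 + M1 powr \<theta>" "\<bar>z' p - v' p powr \<theta>\<bar> \<le> B2 + M1 powr \<theta>" for p
    using vb[of p] w'(2)[of p] z'(2)[of p] by linarith+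
  obtain W where W: "has_weak_deriv (1, 0) halfplane w W"
    using W11_loc_weak_dx[OF P(5)] by blast
  obtain Z where Z: "has_weak_deriv (1, 0) halfplane z Z"
    using W11_loc_weak_dx[OF P(6)] by blast
  obtain W' where W': "loc_int W'" "AE p in lborel. 0 < snd p \<longrightarrow> W p = W' p"
    using loc_int_rep[of W] W unfolding has_weak_deriv_def by blast
  obtain Z' where Z': "loc_int Z'" "AE p in lborel. 0 < snd p \<longrightarrow> Z p = Z' p"
    using loc_int_rep[of Z] Z unfolding has_weak_deriv_def by blast
  obtain G' where G': "loc_int G'" "AE p in lborel. 0 < snd p \<longrightarrow> G p = G' p"
    using loc_int_rep[of G] G unfolding has_weak_deriv_def by blast
  have borel: "W' \<in> borel_measurable borel" "Z' \<in> borel_measurable borel" "G' \<in> borel_measurable borel"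
    using W' Z' G' by (auto simp: loc_int_def)
  have wW: "weak_x w' W'" by (rule has_weak_deriv_rep(1)[OF W w'(1,3) borel(1) W'(2) refl])
  have zZ: "weak_x z' Z'" by (rule has_weak_deriv_rep(1)[OF Z z'(1,3) borel(2) Z'(2) refl])
  have vG: "weak_t v' G'" by (rule has_weak_deriv_rep(2)[OF G v'(1,5) borel(3) G'(2) refl])
  have decr: "decr w'" "decr z'"
    using decr_rep[OF _ w'(3)] decr_rep[OF _ z'(3)] P(2) by simp_all
  \<comment> \<open>The integration constant in x is 0 for w + v^\<theta>, and minus the total
    integral of v_t for z - v^\<theta>.\<close>
  have lines: "AE t in lborel. 0 < t \<longrightarrow> integrable lborel (\<lambda>x. G' (x, t)) \<and>
      (AE x in lborel. w' (x, t) + v' (x, t) powr \<theta> = 0 + (LINT y|lborel. indicator {..x} y * G' (y, t))) \<and>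
      (AE x in lborel. z' (x, t) - v' (x, t) powr \<theta> = - (LINT y|lborel. G' (y, t)) + (LINT y|lborel. indicator {..x} y * G' (y, t)))"
    using G_int AE_snd[OF G'(2)] AE_snd[OF v'(5)] AE_snd[OF w'(3)] AE_snd[OF z'(3)]
  proof eventually_elim
    case (elim t)
    show ?case
    proof
      assume t: "0 < t"
      have Gt: "integrable lebesgue (\<lambda>x. G (x, t))" "AE x in lborel. G (x, t) = G' (x, t)" using elim t by auto
      note ray = lebesgue_ray_integrals[OF Gt(1) borel_measurable_curry(2)[OF borel(3)] Gt(2)]
      have "AE x in lborel. w' (x, t) + v' (x, t) powr \<theta> = 0 + (LINT y|lborel. indicator {..x} y * G' (y, t))"
        using elim(3,4) by eventually_elim (use t in \<open>auto simp: w_def ray(3)\<close>)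
      moreover have "AE x in lborel. z' (x, t) - v' (x, t) powr \<theta> = - (LINT y|lborel. G' (y, t)) + (LINT y|lborel. indicator {..x} y * G' (y, t))"
        using elim(3,5) by eventually_elim (use t in \<open>auto simp: z_def ray(4)\<close>)
      ultimately show "integrable lborel (\<lambda>x. G' (x, t)) \<and>
        (AE x in lborel. w' (x, t) + v' (x, t) powr \<theta> = 0 + (LINT y|lborel. indicator {..x} y * G' (y, t))) \<and>
        (AE x in lborel. z' (x, t) - v' (x, t) powr \<theta> = - (LINT y|lborel. G' (y, t)) + (LINT y|lborel. indicator {..x} y * G' (y, t)))"
        using ray(1) by blast
    qed
  qed
  have wG: "weak_x (\<lambda>p. w' p + v' p powr \<theta>) G'"
  proof (rule weak_x_of_lines[OF _ sumb(1) G'(1)])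
    show "AE t in lborel. 0 < t \<longrightarrow> integrable lborel (\<lambda>x. G' (x, t)) \<and>
      (\<exists>k. AE x in lborel. w' (x, t) + v' (x, t) powr \<theta> = k + (LINT y|lborel. indicator {..x} y * G' (y, t)))"
      using lines by eventually_elim blast
  qed measurable
  have zG: "weak_x (\<lambda>p. z' p - v' p powr \<theta>) G'"
  proof (rule weak_x_of_lines[OF _ sumb(2) G'(1)])
    show "AE t in lborel. 0 < t \<longrightarrow> integrable lborel (\<lambda>x. G' (x, t)) \<and>
      (\<exists>k. AE x in lborel. z' (x, t) - v' (x, t) powr \<theta> = k + (LINT y|lborel. indicator {..x} y * G' (y, t)))"
      using lines by eventually_elim blast
  qed measurable
  obtain v1' where "v1' \<in> borel_measurable lborel" and v1_eq: "AE x in lborel. v1 x = v1' x"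
    using completion_ex_borel_measurable_real[of v1 lborel] v1 by auto
  then have v1'[measurable]: "v1' \<in> borel_measurable borel" by simp
  note ray = lebesgue_ray_integrals[OF v1 v1' v1_eq]
  define m where "m = (LINT x|lborel. v1' x)"
  obtain w0' D1 where w0': "w0' \<in> borel_measurable borel" "\<And>x. \<bar>w0' x\<bar> \<le> D1" "AE x in lborel. w0 x = w0' x"
    using UNIV_Linf_rep[OF Linf(1)] by blast
  obtain z0' D2 where z0': "z0' \<in> borel_measurable borel" "\<And>x. \<bar>z0' x\<bar> \<le> D2" "AE x in lborel. z0 x = z0' x"
    using UNIV_Linf_rep[OF Linf(2)] by blast
  have [measurable]: "w0' \<in> borel_measurable borel" "z0' \<in> borel_measurable borel" by fact+
  \<comment> \<open>The two ray integrals of v1 add up to \<open>m\<close>, so z0 - w0 = 2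
    v0^\<theta> - m.\<close>
  have q: "\<bar>(z0' x - w0' x + m) / 2\<bar> \<le> (D1 + D2 + \<bar>m\<bar>) / 2" for x
    using w0'(2)[of x] z0'(2)[of x] by auto
  have "AE x in lborel. v0 x powr \<theta> = (z0' x - w0' x + m) / 2"
    using w0'(3) z0'(3)
  proof eventually_elim
    case (elim x)
    then show ?case unfolding w0_def z0_def m_def ray(3,4) by simp
  qed
  then obtain v0' where v0': "v0' \<in> borel_measurable borel" "\<And>x. 0 \<le> v0' x"
    "\<And>x. v0' x \<le> ((D1 + D2 + \<bar>m\<bar>) / 2) powr (1 / \<theta>)" "AE x in lborel. v0 x = v0' x"
    using initial_v_rep[of \<theta> "\<lambda>x. (z0' x - w0' x + m) / 2" "(D1 + D2 + \<bar>m\<bar>) / 2" v0] \<theta>1 q v0_nonneg by auto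
  have v0b: "\<bar>v0' x\<bar> \<le> ((D1 + D2 + \<bar>m\<bar>) / 2) powr (1 / \<theta>)" for x using v0'(2,3)[of x] by simp
  have vb1: "\<bar>v' p\<bar> \<le> M1" for p using v'(2,3)[of p] by simp
  have vsb: "\<bar>c * v' p powr s\<bar> \<le> \<bar>c\<bar> * M1 powr s" for p
    using v'(2,3)[of p] s(1) by (simp add: abs_mult powr_mono2 mult_left_mono)
  have vs_eq: "AE p in lborel. 0 < snd p \<longrightarrow> c * \<bar>v p\<bar> powr (s - 1) * v p = c * v' p powr s"
    using v'(5) by eventually_elim (use powr_s_mult[OF v'(2) s(1)] in \<open>simp add: mult.assoc\<close>)
  have v1_test: "integrable lebesgue (\<lambda>x. v1 x * \<alpha> x)" "integrable lborel (\<lambda>x. v1' x * \<alpha> x)"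
    "(LINT x|lebesgue. v1 x * \<alpha> x) = (LINT x|lborel. v1' x * \<alpha> x)"
    if \<alpha>: "test_function UNIV \<alpha>" for \<alpha>
  proof -
    have [measurable]: "\<alpha> \<in> borel_measurable borel" using \<alpha> by (rule test_borel)
    obtain K where K: "\<And>x. \<bar>\<alpha> x\<bar> \<le> K" using test_bounded[OF \<alpha>] by blast
    show i: "integrable lborel (\<lambda>x. v1' x * \<alpha> x)" by (rule integrable_mult_bounded[OF ray(1) _ K]) simp
    have b: "(\<lambda>x. v1' x * \<alpha> x) \<in> borel_measurable borel" by measurable
    have e: "AE x in lborel. v1 x * \<alpha> x = v1' x * \<alpha> x" using v1_eq by eventually_elim simp
    show "integrable lebesgue (\<lambda>x. v1 x * \<alpha> x)" "(LINT x|lebesgue. v1 x * \<alpha> x) = (LINT x|lborel. v1' x * \<alpha> x)"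
      using lebesgue_integral_rep[OF b e] i by auto
  qed
  define M where "M = max M1 (((D1 + D2 + \<bar>m\<bar>) / 2) powr (1 / \<theta>))"
  define L where "L \<alpha> = (LINT x|lborel. v1' x * \<alpha> x)" for \<alpha>
  interpret degenerate_wave s \<theta> c M v' G' "\<lambda>p. G' p - W' p" "\<lambda>p. Z' p - G' p" v0' L
  proof (rule degenerate_waveI[OF s v'(1,2) _ v'(4) v0'(1,2) _ w'(1) wzb(1) decr(1) wW z'(1) wzb(2) decr(2) zZ G'(1) W'(1) Z'(1) vG wG zG])
    fix \<alpha> \<beta> :: "real \<Rightarrow> real" assume \<alpha>: "test_function UNIV \<alpha>" and \<beta>: "test_function UNIV \<beta>"
    have sm: "smooth \<alpha>" "smooth \<beta>" "smooth (deriv \<alpha>)" "smooth (deriv \<beta>)"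
      using test_smooth[OF \<alpha>] test_smooth[OF \<beta>] smooth_deriv by auto
    have "test_function UNIV (tens \<alpha> \<beta>)" by (rule test_tens[OF \<alpha> \<beta>]) simp
    then have "(LINT p|lebesgue_on halfplane. v p * tens \<alpha> (deriv (deriv \<beta>)) p - c * \<bar>v p\<bar> powr (s - 1) * v p * tens (deriv (deriv \<alpha>)) \<beta> p)
        + (LINT x|lebesgue. v0 x * tens \<alpha> (deriv \<beta>) (x, 0) - v1 x * tens \<alpha> \<beta> (x, 0)) = 0"
      using sol by (auto simp: gen_solution_wave_def dir_deriv_tens sm)
    moreover have "(LINT x|lebesgue. v0 x * tens \<alpha> (deriv \<beta>) (x, 0) - v1 x * tens \<alpha> \<beta> (x, 0))
        = deriv \<beta> 0 * (LINT x|lborel. v0' x * \<alpha> x) - \<beta> 0 * L \<alpha>"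
    proof -
      have "(LINT x|lebesgue. v0 x * tens \<alpha> (deriv \<beta>) (x, 0) - v1 x * tens \<alpha> \<beta> (x, 0))
          = (LINT x|lebesgue. (v0 x * \<alpha> x) * deriv \<beta> 0 - (v1 x * \<alpha> x) * \<beta> 0)"
        by (simp only: tens_def fst_conv snd_conv mult.assoc)
      also have "\<dots> = (LINT x|lebesgue. (v0 x * \<alpha> x) * deriv \<beta> 0) - (LINT x|lebesgue. (v1 x * \<alpha> x) * \<beta> 0)"
        by (intro Bochner_Integration.integral_diff integrable_mult_left
            lebesgue_mult_test(2)[OF v0'(1) v0b v0'(4) \<alpha>] v1_test(1)[OF \<alpha>])
      also have "\<dots> = (LINT x|lebesgue. v0 x * \<alpha> x) * deriv \<beta> 0 - (LINT x|lebesgue. v1 x * \<alpha> x) * \<beta> 0"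
        by (simp only: integral_mult_left_zero)
      finally show ?thesis
        unfolding lebesgue_mult_test(1)[OF v0'(1) v0b v0'(4) \<alpha>] v1_test(3)[OF \<alpha>] L_def by (simp only: mult.commute)
    qed
    moreover have "(LINT p|lebesgue_on halfplane. v p * tens \<alpha> (deriv (deriv \<beta>)) p - c * \<bar>v p\<bar> powr (s - 1) * v p * tens (deriv (deriv \<alpha>)) \<beta> p)
        = (LINT p|lborel. v' p * tens \<alpha> (deriv (deriv \<beta>)) p) - (LINT p|lborel. c * v' p powr s * tens (deriv (deriv \<alpha>)) \<beta> p)"
      by (rule halfplane_integral_tens2[OF v'(1) vb1 v'(4,5) _ vsb _ vs_eq \<alpha> test_deriv[OF test_deriv[OF \<beta>]] test_deriv[OF test_deriv[OF \<alpha>]] \<beta>])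
        (simp_all add: v'(4))
    ultimately show "(LINT p|lborel. v' p * tens \<alpha> (deriv (deriv \<beta>)) p) - c * (LINT p|lborel. v' p powr s * tens (deriv (deriv \<alpha>)) \<beta> p)
        + deriv \<beta> 0 * (LINT x|lborel. v0' x * \<alpha> x) - \<beta> 0 * L \<alpha> = 0"
      by (simp add: mult.assoc)
  qed (use v'(3) v0'(3) in \<open>auto simp: M_def le_max_iff_disj\<close>)
  \<comment> \<open>Three errors occur, one on each edge and one from the tail of v1; each is kept
    to a quarter of this gap, so the sum stays negative.\<close>
  define \<delta> where "\<delta> = - (m + Lplus + Lminus)"
  have \<delta>: "0 < \<delta>" using gap ray(2) by (simp add: \<delta>_def m_def)
  have "\<forall>\<^sub>F x in at_top. v0 x powr \<theta> < Lplus + \<delta> / 4" by (rule order_tendstoD(2)[OF lims(1)]) (use \<delta> in simp)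
  then obtain N1 where N1: "\<And>x. N1 \<le> x \<Longrightarrow> v0 x powr \<theta> < Lplus + \<delta> / 4" by (auto simp: eventually_at_top_linorder)
  have "\<forall>\<^sub>F x in at_bot. v0 x powr \<theta> < Lminus + \<delta> / 4" by (rule order_tendstoD(2)[OF lims(2)]) (use \<delta> in simp)
  then obtain N2 where N2: "\<And>x. x \<le> N2 \<Longrightarrow> v0 x powr \<theta> < Lminus + \<delta> / 4" by (auto simp: eventually_at_bot_linorder)
  have "(\<lambda>n::nat. LINT x|lborel. indicator (- {- real n..real n}) x * \<bar>v1' x\<bar>) \<longlonglongrightarrow> (LINT x|(lborel :: real measure). 0)"
  proof (rule integral_dominated_convergence[where w="\<lambda>x. \<bar>v1' x\<bar>"])
    show "AE x in lborel. (\<lambda>n. indicator (- {- real n..real n}) x * \<bar>v1' x\<bar>) \<longlonglongrightarrow> 0"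
    proof (rule AE_I2)
      fix x :: real
      obtain N :: nat where "\<bar>x\<bar> < real N" using reals_Archimedean2 by blast
      then have "\<forall>\<^sub>F n in sequentially. indicator (- {- real n..real n}) x * \<bar>v1' x\<bar> = 0"
        by (auto simp: eventually_sequentially indicator_def intro!: exI[of _ N])
      then show "(\<lambda>n. indicator (- {- real n..real n}) x * \<bar>v1' x\<bar>) \<longlonglongrightarrow> 0" by (rule tendsto_eventually)
    qed
    show "integrable lborel (\<lambda>x. \<bar>v1' x\<bar>)" using ray(1) by simp
  qed (auto simp: indicator_def)
  then have "(\<lambda>n::nat. LINT x|lborel. indicator (- {- real n..real n}) x * \<bar>v1' x\<bar>) \<longlonglongrightarrow> 0" by simp
  then have "\<forall>\<^sub>F n in sequentially. (LINT x|lborel. indicator (- {- real n..real n}) x * \<bar>v1' x\<bar>) < \<delta> / 4"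
    by (rule order_tendstoD(2)) (use \<delta> in simp)
  then obtain N3 where N3: "\<And>n. N3 \<le> n \<Longrightarrow> (LINT x|lborel. indicator (- {- real n..real n}) x * \<bar>v1' x\<bar>) < \<delta> / 4"
    by (auto simp: eventually_sequentially)
  obtain N4 :: nat where N4: "\<bar>N1\<bar> + \<bar>N2\<bar> < real N4" using reals_Archimedean2 by blast
  define n where "n = max N3 N4"
  have n: "N1 \<le> real n" "- real n \<le> N2" "- real n \<le> real n" using N4 by (auto simp: n_def)
  obtain \<kappa> A B where \<kappa>: "test_function UNIV \<kappa>" "\<And>x. 0 \<le> \<kappa> x" "\<And>x. \<kappa> x \<le> 1" "\<And>x. x \<in> {- real n..real n} \<Longrightarrow> \<kappa> x = 1"
      "deriv \<kappa> = (\<lambda>x. A x - B x)"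
    and A: "test_function UNIV A" "\<And>x. 0 \<le> A x" "(LINT x|lborel. A x) = 1" "\<And>x. x \<notin> {- real n - 1<..<- real n} \<Longrightarrow> A x = 0"
    and B: "test_function UNIV B" "\<And>x. 0 \<le> B x" "(LINT x|lborel. B x) = 1" "\<And>x. x \<notin> {real n<..<real n + 1} \<Longrightarrow> B x = 0"
    using n(3) by (rule trapezoid) blast
  have edge: "(LINT x|lborel. v0' x powr \<theta> * E x) \<le> K"
    if E: "test_function UNIV E" "\<And>x. 0 \<le> E x" "(LINT x|lborel. E x) = 1" and K: "\<And>x. E x \<noteq> 0 \<Longrightarrow> v0 x powr \<theta> < K" for E K
  proof -
    have "(LINT x|lborel. v0' x powr \<theta> * E x) \<le> (LINT x|lborel. K * E x)"
    proof (rule integral_mono_AE[OF v0_powr_mult_test[OF E(1)]])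
      show "integrable lborel (\<lambda>x. K * E x)" using test_integrable[OF E(1)] by simp
      show "AE x in lborel. v0' x powr \<theta> * E x \<le> K * E x"
        using v0'(4)
      proof eventually_elim
        case (elim x)
        then show ?case using K[of x] E(2)[of x] by (cases "E x = 0") (auto intro: mult_right_mono)
      qed
    qed
    then show ?thesis using E(3) by simp
  qed
  have eA: "(LINT x|lborel. v0' x powr \<theta> * A x) \<le> Lminus + \<delta> / 4"
  proof (rule edge[OF A(1-3)])
    fix x assume "A x \<noteq> 0"
    then have "x \<in> {- real n - 1<..<- real n}" using A(4) by blast
    then show "v0 x powr \<theta> < Lminus + \<delta> / 4" using n(2) by (intro N2) auto
  qed
  have eB: "(LINT x|lborel. v0' x powr \<theta> * B x) \<le> Lplus + \<delta> / 4"
  proof (rule edge[OF B(1-3)])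
    fix x assume "B x \<noteq> 0"
    then have "x \<in> {real n<..<real n + 1}" using B(4) by blast
    then show "v0 x powr \<theta> < Lplus + \<delta> / 4" using n(1) by (intro N1) auto
  qed
  \<comment> \<open>\<kappa> is 1 on [-n, n] and lies between 0 and 1 elsewhere, so the difference
    is at most the tail of |v1|.\<close>
  have "L \<kappa> - m = (LINT x|lborel. v1' x * \<kappa> x - v1' x)"
    unfolding L_def m_def by (rule Bochner_Integration.integral_diff[OF v1_test(2)[OF \<kappa>(1)] ray(1), symmetric])
  also have "\<dots> \<le> (LINT x|lborel. indicator (- {- real n..real n}) x * \<bar>v1' x\<bar>)"
  proof (rule integral_mono)
    show "integrable lborel (\<lambda>x. v1' x * \<kappa> x - v1' x)"
      by (intro Bochner_Integration.integrable_diff v1_test(2)[OF \<kappa>(1)] ray(1))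
    show "integrable lborel (\<lambda>x. indicator (- {- real n..real n}) x * \<bar>v1' x\<bar>)"
      using integrable_mult_indicator[OF _ integrable_abs[OF ray(1)], of "- {- real n..real n}"] by simp
    fix x :: real
    show "v1' x * \<kappa> x - v1' x \<le> indicator (- {- real n..real n}) x * \<bar>v1' x\<bar>"
    proof (cases "x \<in> {- real n..real n}")
      case False
      have "v1' x * \<kappa> x - v1' x = (- v1' x) * (1 - \<kappa> x)" by (simp add: algebra_simps)
      also have "\<dots> \<le> \<bar>v1' x\<bar> * (1 - \<kappa> x)" using \<kappa>(3)[of x] by (intro mult_right_mono) auto
      also have "\<dots> \<le> \<bar>v1' x\<bar>" using \<kappa>(2)[of x] by (intro mult_left_le) auto
      finally show ?thesis using False by simp
    qed (simp add: \<kappa>(4))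
  qed
  also have "\<dots> < \<delta> / 4" by (rule N3) (simp add: n_def)
  finally have "L \<kappa> < m + \<delta> / 4" by simp
  then show False
    using data_inequality[OF \<kappa>(1,2,5) A(1,2) B(1,2)] eA eB \<delta> \<delta>_def by linarith
qed

theorem theorem2:
  fixes s \<theta> c :: real
  assumes "s > 1" and "\<theta> = (s + 1) / 2" and "c = \<theta>\<^sup>2 / s"
  shows
   "(\<forall>u0 v0 w0 z0 :: real \<Rightarrow> real.
       (\<forall>x. v0 x \<ge> 0)
       \<and> w0 = (\<lambda>x. u0 x - v0 x powr \<theta>)
       \<and> z0 = (\<lambda>x. u0 x + v0 x powr \<theta>)
       \<and> w0 \<in> W11_loc UNIV \<inter> Linf UNIV \<and> z0 \<in> W11_loc UNIV \<inter> Linf UNIV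
       \<and> antimono w0 \<and> antimono z0
       \<and> (\<exists>x y. w0 x > z0 y)
       \<longrightarrow> \<not> (\<exists>v u :: real \<times> real \<Rightarrow> real.
              gen_solution_system s c v0 u0 v u
              \<and> solution_properties w0 z0 v
                  (\<lambda>p. u p - v p powr \<theta>) (\<lambda>p. u p + v p powr \<theta>)))
    \<and>
    (\<forall>v0 v1 w0 z0 :: real \<Rightarrow> real. \<forall>Lplus Lminus :: real.
       (\<forall>x. v0 x \<ge> 0) \<and> integrable lebesgue v1
       \<and> w0 = (\<lambda>x. (LINT y|lebesgue_on {..x}. v1 y) - v0 x powr \<theta>)
       \<and> z0 = (\<lambda>x. - (LINT y|lebesgue_on {x..}. v1 y) + v0 x powr \<theta>)
       \<and> w0 \<in> W11_loc UNIV \<inter> Linf UNIV \<and> z0 \<in> W11_loc UNIV \<inter> Linf UNIV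
       \<and> ((\<lambda>x. v0 x powr \<theta>) \<longlongrightarrow> Lplus) at_top
       \<and> ((\<lambda>x. v0 x powr \<theta>) \<longlongrightarrow> Lminus) at_bot
       \<and> (AE x in lebesgue. v1 x + weak_deriv 1 UNIV (\<lambda>x. v0 x powr \<theta>) x \<le> 0)
       \<and> (AE x in lebesgue. v1 x - weak_deriv 1 UNIV (\<lambda>x. v0 x powr \<theta>) x \<le> 0)
       \<and> (LINT x|lebesgue. v1 x) + Lplus + Lminus < 0
       \<longrightarrow> \<not> (\<exists>v :: real \<times> real \<Rightarrow> real.
              gen_solution_wave s c v0 v1 v
              \<and> integrable_time_deriv v
              \<and> solution_properties w0 z0 v
                  (\<lambda>(x, t). (LINT y|lebesgue_on {..x}. weak_dt v (y, t)) - v (x, t) powr \<theta>)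
                  (\<lambda>(x, t). - (LINT y|lebesgue_on {x..}. weak_dt v (y, t)) + v (x, t) powr \<theta>)))"
proof (intro conjI allI impI notI)
  fix u0 v0 w0 z0 :: "real \<Rightarrow> real"
  assume data: "(\<forall>x. v0 x \<ge> 0)
       \<and> w0 = (\<lambda>x. u0 x - v0 x powr \<theta>)
       \<and> z0 = (\<lambda>x. u0 x + v0 x powr \<theta>)
       \<and> w0 \<in> W11_loc UNIV \<inter> Linf UNIV \<and> z0 \<in> W11_loc UNIV \<inter> Linf UNIV
       \<and> antimono w0 \<and> antimono z0
       \<and> (\<exists>x y. w0 x > z0 y)"
    and "\<exists>v u :: real \<times> real \<Rightarrow> real.
              gen_solution_system s c v0 u0 v u
              \<and> solution_properties w0 z0 v
                  (\<lambda>p. u p - v p powr \<theta>) (\<lambda>p. u p + v p powr \<theta>)"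
  then obtain x y v u where "w0 x > z0 y" "gen_solution_system s c v0 u0 v u"
    "solution_properties w0 z0 v (\<lambda>p. u p - v p powr \<theta>) (\<lambda>p. u p + v p powr \<theta>)"
    by auto
  with data show False
    by (intro system_nonexistence[OF assms, of v0 w0 u0 z0 y x v u]) auto
next
  fix v0 v1 w0 z0 :: "real \<Rightarrow> real" and Lplus Lminus :: real
  assume data: "(\<forall>x. v0 x \<ge> 0) \<and> integrable lebesgue v1
       \<and> w0 = (\<lambda>x. (LINT y|lebesgue_on {..x}. v1 y) - v0 x powr \<theta>)
       \<and> z0 = (\<lambda>x. - (LINT y|lebesgue_on {x..}. v1 y) + v0 x powr \<theta>)
       \<and> w0 \<in> W11_loc UNIV \<inter> Linf UNIV \<and> z0 \<in> W11_loc UNIV \<inter> Linf UNIV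
       \<and> ((\<lambda>x. v0 x powr \<theta>) \<longlongrightarrow> Lplus) at_top
       \<and> ((\<lambda>x. v0 x powr \<theta>) \<longlongrightarrow> Lminus) at_bot
       \<and> (AE x in lebesgue. v1 x + weak_deriv 1 UNIV (\<lambda>x. v0 x powr \<theta>) x \<le> 0)
       \<and> (AE x in lebesgue. v1 x - weak_deriv 1 UNIV (\<lambda>x. v0 x powr \<theta>) x \<le> 0)
       \<and> (LINT x|lebesgue. v1 x) + Lplus + Lminus < 0"
    and "\<exists>v :: real \<times> real \<Rightarrow> real.
              gen_solution_wave s c v0 v1 v
              \<and> integrable_time_deriv v
              \<and> solution_properties w0 z0 v
                  (\<lambda>(x, t). (LINT y|lebesgue_on {..x}. weak_dt v (y, t)) - v (x, t) powr \<theta>)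
                  (\<lambda>(x, t). - (LINT y|lebesgue_on {x..}. weak_dt v (y, t)) + v (x, t) powr \<theta>)"
  then obtain v where v: "gen_solution_wave s c v0 v1 v" "integrable_time_deriv v"
    "solution_properties w0 z0 v
      (\<lambda>(x, t). (LINT y|lebesgue_on {..x}. weak_dt v (y, t)) - v (x, t) powr \<theta>)
      (\<lambda>(x, t). - (LINT y|lebesgue_on {x..}. weak_dt v (y, t)) + v (x, t) powr \<theta>)"
    by blast
  have "\<And>x. 0 \<le> v0 x" "integrable lebesgue v1"
    "w0 = (\<lambda>x. (LINT y|lebesgue_on {..x}. v1 y) - v0 x powr \<theta>)"
    "z0 = (\<lambda>x. - (LINT y|lebesgue_on {x..}. v1 y) + v0 x powr \<theta>)"
    "w0 \<in> Linf UNIV" "z0 \<in> Linf UNIV"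
    "((\<lambda>x. v0 x powr \<theta>) \<longlongrightarrow> Lplus) at_top" "((\<lambda>x. v0 x powr \<theta>) \<longlongrightarrow> Lminus) at_bot"
    "(LINT x|lebesgue. v1 x) + Lplus + Lminus < 0"
    using data by blast+
  from wave_nonexistence[OF assms this v] show False .
qed

end
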